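(* Let $\gamma,r>0$ and let $\Lambda^{(2)}$ be the multiplier operator associated with $\lambda^{(2)}_{m,n}=e^{-\gamma(\max\{m,n\})^r}$, $m,n\in\mathbb{N}$. Let $\phi_k=\dim\mathcal{T}_k$, $\psi_k=\phi_k-\phi_k^{1-r/(2d-1)}-1$, and $$\mathcal{R}=\gamma\Big(\frac{d!\,(d-1)!}{2}\Big)^{r/(2d-1)},\qquad \kappa_k=\begin{cases}1,&1\le p\le2,\ 1<q\le2,\\1,&2\le p<\infty,\ 2\le q\le\infty,\\1,&1\le p\le2\le q\le\infty,\\(\ln k)^{-1/2},&1\le p\le2,\ q=1,\\(\ln k)^{-1/2},&p=\infty,\ 2\le q\le\infty.\end{cases}$$ Then, for $k\in\mathbb{N}$, $$d_{[\psi_k]}(\Lambda^{(2)}U_p,L^q)\gg e^{-\mathcal{R}\phi_k^{r/(2d-1)}}\kappa_k,\qquad r>0,$$ $$d_{[\psi_k]}(\Lambda^{(2)}U_p,L^q)\gg e^{-\mathcal{R}\psi_k^{r/(2d-1)}}\kappa_k,\qquad 0<r\le2d-1,$$ $$d_{\phi_k-1}(\Lambda^{(2)}U_p,L^q)\gg e^{-\mathcal{R}\phi_k^{r/(2d-1)}}\kappa_k,\qquad r>2d-1,$$ $$d_k(\Lambda^{(2)}U_p,L^q)\gg e^{-\mathcal{R}k^{r/(2d-1)}}\kappa_k,\qquad 0<r\le1.$$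
   Context: $\mathbb{N}=\{0,1,2,\dots\}$; $d\ge2$ is a fixed integer; $[x]$ is the integer part of $x$. The notation $a_k\gg b_k$ means that there is a constant $C>0$, independent of $k$, with $a_k\ge Cb_k$; it is understood for those $k\ge2$ for which the width index (and $\psi_k$ where it is raised to a power) is non-negative. $\Omega_d$ is the unit sphere of $\mathbb{C}^d$ with surface measure $\sigma_d$ (the Lebesgue surface measure of $S^{2d-1}\subset\mathbb{R}^{2d}$ under $\mathbb{C}^d\cong\mathbb{R}^{2d}$). $L^p=L^p(\Omega_d)$ is the usual space of complex-valued functions, with closed unit ball $U_p$. $\mathcal{H}_{m,n}$ is the space of restrictions to $\Omega_d$ of polynomials in $z,\bar z$ homogeneous of degree $m$ in $z$ and degree $n$ in $\bar z$ and in the kernel of $4\sum_j\partial^2/\partial z_j\partial\bar z_j$. $\mathcal{T}_N=\bigoplus_{\max\{m,n\}\le N}\mathcal{H}_{m,n}$. Let $Z_w^{(m,n)}$ be the reproducing kernel of $\mathcal{H}_{m,n}$ at $w\in\Omega_d$, and $(\varphi*\widetilde Z^{(m,n)})(w)=\int_{\Omega_d}\varphi\,\overline{Z_w^{(m,n)}}\,d\sigma_d$ (the orthogonal projection onto $\mathcal{H}_{m,n}$ on $L^2$). The multiplier operator $\Lambda$ associated with $\{\lambda_{m,n}\}$ sends $\varphi$ to the function $\Lambda\varphi$ with formal expansion $\Lambda\varphi\sim\sum_{m,n}\lambda_{m,n}\varphi*\widetilde Z^{(m,n)}$. Kolmogorov width: $d_n(A,X)=\inf_{X_n}\sup_{x\in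 A}\inf_{y\in X_n}\|x-y\|_X$, $X_n$ ranging over the subspaces of $X$ of dimension $n$. *)

theory Defs
  imports
    "HOL-Analysis.Analysis"
    "HOL-Probability.Essential_Supremum"
    "HOL-Library.Function_Algebras"
begin

text \<open>
  The space \<open>\<complex>\<^sup>d\<close> is \<open>complex ^ 'n\<close> with \<open>d = CARD('n)\<close>, and the unit sphere is
  \<open>sphere 0 1\<close>. Complex-valued functions form a complex vector space under pointwise
  operations; the following interpretation makes the library's \<open>span\<close>, \<open>independent\<close> and \<open>dim\<close>
  (all over the scalar field \<open>\<complex>\<close>) available for them.
\<close>

global_interpretation cfun: vector_space "\<lambda>(c::complex) (f::'a \<Rightarrow> complex) x. c * f x"
  by unfold_locales (auto simp: fun_eq_iff algebra_simps)


section \<open>Surface measure and Lebesgue spaces on the sphere\<close>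

text \<open>
  Lebesgue surface measure in polar coordinates: the measure of a Borel set \<open>A\<close> of the sphere of
  \<open>\<real>\<^bsup>2d\<^esup>\<close> is \<open>2d\<close> times the volume of the cone \<open>{t x | x \<in> A, 0 < t \<le> 1}\<close>. Note \<open>sgn x = x / |x|\<close>.
\<close>

definition surface_measure :: "(complex ^ 'n::finite) measure" where
  "surface_measure =
     scale_measure (2 * of_nat CARD('n))
       (distr (restrict_space lborel (cball 0 1 - {0})) (restrict_space borel (sphere 0 1)) sgn)"

text \<open>
  Elements of \<open>L\<^sup>p\<close> are represented by functions on \<open>\<complex>\<^sup>d\<close>, of which only the values on the sphere
  matter; functions that agree almost everywhere on the sphere represent the same element.
\<close>

definition Lp_norm :: "ennreal \<Rightarrow> (complex ^ 'n::finite \<Rightarrow> complex) \<Rightarrow> ennreal" where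
  "Lp_norm p f =
     (if p = \<infinity> then esssup surface_measure (\<lambda>w. ennreal (norm (f w)))
      else let I = \<integral>\<^sup>+ w. ennreal (norm (f w) powr enn2real p) \<partial>surface_measure
           in if I = \<infinity> then \<infinity> else ennreal (enn2real I powr (1 / enn2real p)))"

definition Lp :: "ennreal \<Rightarrow> (complex ^ 'n::finite \<Rightarrow> complex) set" where
  "Lp p = {f \<in> borel_measurable surface_measure. Lp_norm p f < \<infinity>}"

definition Lp_ball :: "ennreal \<Rightarrow> (complex ^ 'n::finite \<Rightarrow> complex) set" where
  "Lp_ball p = {f \<in> Lp p. Lp_norm p f \<le> 1}"


section \<open>The spaces of harmonic polynomials\<close>

definition bihomogeneous :: "nat \<Rightarrow> nat \<Rightarrow> (complex ^ 'n::finite \<Rightarrow> complex) set" where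
  "bihomogeneous m n =
     {f. \<exists>c :: ('n \<Rightarrow> nat) \<Rightarrow> ('n \<Rightarrow> nat) \<Rightarrow> complex.
        f = (\<lambda>z. \<Sum>\<alpha> | (\<Sum>j\<in>UNIV. \<alpha> j) = m. \<Sum>\<beta> | (\<Sum>j\<in>UNIV. \<beta> j) = n.
               c \<alpha> \<beta> * (\<Prod>j\<in>UNIV. (z $ j) ^ \<alpha> j * cnj (z $ j) ^ \<beta> j))}"

text \<open>The Wirtinger operators \<open>\<partial>/\<partial>z\<^sub>j = (\<partial>/\<partial>x\<^sub>j - i \<partial>/\<partial>y\<^sub>j)/2\<close> and
  \<open>\<partial>/\<partial>\<bar>z\<^sub>j = (\<partial>/\<partial>x\<^sub>j + i \<partial>/\<partial>y\<^sub>j)/2\<close>.\<close>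

definition d_z :: "'n \<Rightarrow> (complex ^ 'n::finite \<Rightarrow> complex) \<Rightarrow> complex ^ 'n \<Rightarrow> complex" where
  "d_z j f z =
     (frechet_derivative f (at z) (axis j 1) - \<i> * frechet_derivative f (at z) (axis j \<i>)) / 2"

definition d_zbar :: "'n \<Rightarrow> (complex ^ 'n::finite \<Rightarrow> complex) \<Rightarrow> complex ^ 'n \<Rightarrow> complex" where
  "d_zbar j f z =
     (frechet_derivative f (at z) (axis j 1) + \<i> * frechet_derivative f (at z) (axis j \<i>)) / 2"

definition laplacian :: "(complex ^ 'n::finite \<Rightarrow> complex) \<Rightarrow> complex ^ 'n \<Rightarrow> complex" where
  "laplacian f z = 4 * (\<Sum>j\<in>UNIV. d_z j (d_zbar j f) z)"

text \<open>Restrictions to the sphere are represented by functions that vanish off the sphere, so that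
  equality and linear independence are those of functions on the sphere.\<close>

definition sphere_restrict :: "(complex ^ 'n::finite \<Rightarrow> complex) \<Rightarrow> complex ^ 'n \<Rightarrow> complex" where
  "sphere_restrict f = (\<lambda>z. if z \<in> sphere 0 1 then f z else 0)"

definition H :: "nat \<Rightarrow> nat \<Rightarrow> (complex ^ 'n::finite \<Rightarrow> complex) set" where
  "H m n = {sphere_restrict f | f. f \<in> bihomogeneous m n \<and> (\<forall>z. laplacian f z = 0)}"

text \<open>The sum of the spaces \<open>H m n\<close>; it is direct because they are mutually orthogonal.\<close>

definition T :: "nat \<Rightarrow> (complex ^ 'n::finite \<Rightarrow> complex) set" where
  "T N = cfun.span (\<Union>(m, n)\<in>{(m, n). max m n \<le> N}. H m n)"


section \<open>Multiplier operators\<close>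

definition repr_kernel :: "nat \<Rightarrow> nat \<Rightarrow> complex ^ 'n::finite \<Rightarrow> complex ^ 'n \<Rightarrow> complex" where
  "repr_kernel m n w =
     (THE Z. Z \<in> H m n \<and>
        (\<forall>f\<in>H m n. f w = (\<integral>v. f v * cnj (Z v) \<partial>surface_measure)))"

definition kernel_conv ::
    "(complex ^ 'n::finite \<Rightarrow> complex) \<Rightarrow> nat \<Rightarrow> nat \<Rightarrow> complex ^ 'n \<Rightarrow> complex" where
  "kernel_conv \<phi> m n w = (\<integral>v. \<phi> v * cnj (repr_kernel m n w v) \<partial>surface_measure)"

text \<open>\<open>f\<close> represents \<open>\<Lambda>\<phi>\<close>: the formal expansion of \<open>f\<close> is \<open>\<Sum> \<lambda>\<^sub>m\<^sub>n (\<phi> * Z\<^sub>m\<^sub>n)\<close>. This determines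
  \<open>f\<close> almost everywhere on the sphere.\<close>

definition is_multiplier_value ::
    "(nat \<Rightarrow> nat \<Rightarrow> complex) \<Rightarrow> (complex ^ 'n::finite \<Rightarrow> complex) \<Rightarrow> (complex ^ 'n \<Rightarrow> complex) \<Rightarrow> bool"
  where
  "is_multiplier_value lam \<phi> f \<longleftrightarrow>
     f \<in> Lp 1 \<and> (\<forall>m n. \<forall>w\<in>sphere 0 1. kernel_conv f m n w = lam m n * kernel_conv \<phi> m n w)"

definition multiplier_image ::
    "(nat \<Rightarrow> nat \<Rightarrow> complex) \<Rightarrow> (complex ^ 'n::finite \<Rightarrow> complex) set \<Rightarrow> (complex ^ 'n \<Rightarrow> complex) set"
  where
  "multiplier_image lam A = {f. \<exists>\<phi>\<in>A. is_multiplier_value lam \<phi> f}"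


section \<open>Kolmogorov widths\<close>

text \<open>The \<open>n\<close>-dimensional subspaces of \<open>L\<^sup>q\<close>, each given by the span of representatives of a
  basis. The last condition says that no nonzero member of the span is a null function, so the
  dimension is still \<open>n\<close> after almost everywhere equal functions are identified.\<close>

definition Lp_subspaces :: "ennreal \<Rightarrow> nat \<Rightarrow> (complex ^ 'n::finite \<Rightarrow> complex) set set" where
  "Lp_subspaces q n =
     {cfun.span B | B. B \<subseteq> Lp q \<and> finite B \<and> card B = n \<and> cfun.independent B \<and>
        (\<forall>f\<in>cfun.span B. (AE w in surface_measure. f w = 0) \<longrightarrow> f = 0)}"

definition kolmogorov_width ::
    "nat \<Rightarrow> (complex ^ 'n::finite \<Rightarrow> complex) set \<Rightarrow> ennreal \<Rightarrow> ennreal" where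
  "kolmogorov_width n A q =
     (INF Y\<in>Lp_subspaces q n. SUP f\<in>A. INF g\<in>Y. Lp_norm q (f - g))"


section \<open>The quantities in the estimates\<close>

definition lam2 :: "real \<Rightarrow> real \<Rightarrow> nat \<Rightarrow> nat \<Rightarrow> complex" where
  "lam2 \<gamma> r m n = of_real (exp (- \<gamma> * real (max m n) powr r))"

text \<open>In the following, the type argument carries the dimension \<open>d = CARD('n)\<close>.\<close>

definition phi :: "'n::finite itself \<Rightarrow> nat \<Rightarrow> nat" where
  "phi _ k = cfun.dim (T k :: (complex ^ 'n \<Rightarrow> complex) set)"

definition psi :: "'n::finite itself \<Rightarrow> real \<Rightarrow> nat \<Rightarrow> real" where
  "psi _ r k =
     (let \<phi> = real (phi TYPE('n) k); d = real CARD('n)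
      in \<phi> - \<phi> powr (1 - r / (2 * d - 1)) - 1)"

definition R_const :: "'n::finite itself \<Rightarrow> real \<Rightarrow> real \<Rightarrow> real" where
  "R_const _ \<gamma> r =
     (let d = CARD('n) in \<gamma> * (fact d * fact (d - 1) / 2) powr (r / (2 * real d - 1)))"

definition kappa_one_range :: "ennreal \<Rightarrow> ennreal \<Rightarrow> bool" where
  "kappa_one_range p q \<longleftrightarrow>
     (1 \<le> p \<and> p \<le> 2 \<and> 1 < q \<and> q \<le> 2) \<or>
     (2 \<le> p \<and> p < \<infinity> \<and> 2 \<le> q \<and> q \<le> \<infinity>) \<or>
     (1 \<le> p \<and> p \<le> 2 \<and> 2 \<le> q \<and> q \<le> \<infinity>)"

definition kappa_log_range :: "ennreal \<Rightarrow> ennreal \<Rightarrow> bool" where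
  "kappa_log_range p q \<longleftrightarrow>
     (1 \<le> p \<and> p \<le> 2 \<and> q = 1) \<or>
     (p = \<infinity> \<and> 2 \<le> q \<and> q \<le> \<infinity>)"

text \<open>The two ranges are disjoint; outside their union the value is irrelevant.\<close>

definition kappa :: "ennreal \<Rightarrow> ennreal \<Rightarrow> nat \<Rightarrow> real" where
  "kappa p q k = (if kappa_one_range p q then 1 else ln (real k) powr (- 1 / 2))"

end

theory Submission
  imports Defs
begin

text \<open>
  Write \<open>N = phi k\<close>, \<open>s = r / (2d - 1)\<close>, and let \<open>\<lambda>\<^sub>Y = exp (- \<gamma> l\<^sup>r)\<close> be the eigenvalue of \<open>\<Lambda>\<close> on a
  basis function \<open>Y\<close> of level \<open>l\<close>, that is, \<open>Y \<in> H m n\<close> with \<open>max m n = l\<close>.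

  \<^bold>\<open>Reduction to one inequality.\<close> By duality a width is bounded below as soon as, for every \<open>n\<close> linear
  conditions on \<open>T k\<close>, there is \<open>h \<in> T k\<close> satisfying them with \<open>\<Lambda> h\<close> of \<open>L\<^sup>2\<close> norm 1 and the \<open>L\<^sup>t\<close> norm
  of \<open>h\<close> at most \<open>b\<close>: the width of index \<open>n\<close> is then at least a constant times \<open>1 / b\<close>
  (\<open>kolmogorov_width_ge\<close>). For \<open>p, q \<le> 2\<close> the set contains a multiple of \<open>\<Lambda>\<^sup>2 h\<close>, which is tested
  against \<open>h\<close>, and \<open>t\<close> is at least the exponent dual to \<open>q\<close>; for \<open>q \<ge> 2\<close> it contains a multiple of
  \<open>\<Lambda> h\<close>, which is tested against itself, and \<open>t \<ge> p\<close>.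

  \<^bold>\<open>Random signs.\<close> The functions \<open>\<Lambda> h\<close> allowed by the conditions contain \<open>m = N - n\<close> orthonormal
  functions \<open>g\<^sub>1, \<dots>, g\<^sub>m\<close>. Every signed sum \<open>g = \<Sum> \<plusminus> g\<^sub>i\<close> has \<open>L\<^sup>2\<close> norm \<open>sqrt m\<close>, and Khintchine's
  inequality bounds the average of \<open>\<bar>\<Lambda>\<^sup>-\<^sup>1 g\<bar>\<^sup>2\<^sup>l\<close> at a point \<open>z\<close> by that power of
  \<open>sqrt (l \<Sum>\<bar>\<Lambda>\<^sup>-\<^sup>1 g\<^sub>i(z)\<bar>\<^sup>2)\<close>. By Bessel's inequality this sum is at most \<open>\<Sum>\<^sub>Y \<lambda>\<^sub>Y\<^sup>-\<^sup>2 \<bar>Y(z)\<bar>\<^sup>2\<close>,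
  whatever the conditions are, and this is independent of \<open>z\<close> because every \<open>T l\<close> is invariant under
  unitary maps. Hence \<open>b\<^sup>2\<close> may be taken as a constant times \<open>l S / m\<close> with \<open>S = \<Sum>\<^sub>Y \<lambda>\<^sub>Y\<^sup>-\<^sup>2\<close>
  (\<open>small_moment_in_kernel\<close>). For finite \<open>t\<close> the number \<open>l\<close> is fixed; for \<open>t = \<infinity>\<close> one takes \<open>l\<close> of the
  order of \<open>ln k\<close> and passes from \<open>2l\<close>-th moments to the supremum by \<open>nikolskii\<close>, which costs the
  factor \<open>(ln k)\<^sup>-\<^sup>1\<^sup>/\<^sup>2\<close> in \<open>\<kappa>\<close>.

  \<^bold>\<open>The exponents.\<close> The dimension is \<open>phi l = \<Prod>\<^sub>j (l + j)\<^sup>2 (2l + d) / (d! (d-1)!)\<close> with \<open>j\<close> from 1 to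
  \<open>d - 1\<close>. It is at least \<open>2 (l + 1)\<^bsup>2d-1\<^esup> / (d! (d-1)!)\<close>, which says that \<open>\<gamma> (l + 1)\<^sup>r \<le> R (phi l)\<^sup>s\<close>.
  Therefore \<open>S\<close> is at most the sum of \<open>exp (2 R j\<^sup>s)\<close> over \<open>j < N\<close>, which is at most of the order of
  \<open>(N\<^bsup>1-s\<^esup> + 1) exp (2 R N\<^sup>s)\<close>. The index \<open>psi k\<close> is chosen so that \<open>m \<ge> N\<^bsup>1-s\<^esup> + 1\<close>, which cancels the
  first factor and leaves \<open>1 / b \<ge> c exp (- R N\<^sup>s)\<close>. The second estimate follows from
  the first one because \<open>N\<^sup>s\<close> exceeds \<open>(psi k)\<^sup>s\<close> by at most 2 when \<open>s \<le> 1\<close>; the other two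
  estimates use the same argument with other pairs of a level and an index.

  \<^bold>\<open>Harmonic analysis.\<close> All facts about \<open>H m n\<close> and \<open>T k\<close> come from one identity, integration by
  parts on the sphere (\<open>integral_by_parts_zbar\<close>), the infinitesimal form of unitary invariance: it
  gives the orthogonality of the \<open>H m n\<close>, the decomposition of polynomials into harmonic ones, and
  with it the description of \<open>T k\<close> by monomials from which the dimension is read off.
\<close>

section \<open>Surface measure is invariant under linear isometries\<close>

text \<open>
  Uniqueness of Haar measure in the form needed here. Let \<open>\<mu>\<close> be the image of Lebesgue measure
  \<open>\<nu>\<close> under \<open>U\<close>; both are invariant under translations and reflections. Fubini's theorem and the
  substitutions \<open>y \<mapsto> y - U x\<close> and \<open>x \<mapsto> V y - x\<close>, with \<open>U (V y) = y\<close>, give \<open>\<mu> A \<cdot> \<nu> B = \<nu> A \<cdot> \<mu> B\<close>. For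
  the unit ball \<open>B\<close>, which \<open>U\<close> preserves, this is \<open>\<mu> A = \<nu> A\<close>.
\<close>

lemma lborel_distr_isometry:
  fixes U :: "'a::euclidean_space \<Rightarrow> 'a"
  assumes lin: "linear U" and iso: "\<And>x. norm (U x) = norm x"
  shows "distr lborel borel U = lborel"
proof (rule measure_eqI)
  show "sets (distr lborel borel U) = sets (lborel :: 'a measure)" by simp
  fix A assume "A \<in> sets (distr lborel borel U)"
  then have A [measurable]: "A \<in> sets borel" by simp
  have U [measurable]: "U \<in> borel_measurable borel"
    using lin by (intro borel_measurable_continuous_onI linear_continuous_on linear_conv_bounded_linear[THEN iffD1])
  have "inj U"
    using lin iso by (metis linear_injective_0 norm_eq_zero)
  then have "surj U"
    using lin by (simp add: linear_injective_imp_surjective)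
  then obtain V where V: "\<And>y. U (V y) = y" by (metis surj_def)
  define B :: "'a set" where "B = ball 0 1"
  have B [measurable]: "B \<in> sets borel" by (simp add: B_def)
  have shift: "(\<integral>\<^sup>+y. f (y - c) \<partial>lborel) = (\<integral>\<^sup>+y. f y \<partial>lborel)"
    if "f \<in> borel_measurable borel" for f :: "'a \<Rightarrow> ennreal" and c
  proof -
    have "(\<integral>\<^sup>+y. f y \<partial>lborel) = (\<integral>\<^sup>+y. f y \<partial>distr lborel borel ((+) (- c)))"
      by (simp only: lborel_distr_plus)
    then show ?thesis using that by (simp add: nn_integral_distr)
  qed
  have reflect: "(\<integral>\<^sup>+x. f (t - x) \<partial>lborel) = (\<integral>\<^sup>+x. f x \<partial>lborel)"
    if "f \<in> borel_measurable borel" for f :: "'a \<Rightarrow> ennreal" and t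
  proof -
    have "lborel = distr lborel borel (\<lambda>x::'a. t - x)"
      using lborel_affine[of "-1" t] by (simp add: density_1)
    then have "(\<integral>\<^sup>+x. f x \<partial>lborel) = (\<integral>\<^sup>+x. f x \<partial>distr lborel borel (\<lambda>x::'a. t - x))"
      by simp
    then show ?thesis using that by (simp add: nn_integral_distr)
  qed
  let ?i = "\<lambda>S x. indicator S x :: ennreal"
  let ?m = "\<lambda>S. \<integral>\<^sup>+x. ?i S (U x) \<partial>lborel"
  have m: "emeasure (distr lborel borel U) S = ?m S" if S: "S \<in> sets borel" for S
    using S nn_integral_distr[OF _ borel_measurable_indicator, of U lborel borel S]
    by (simp add: nn_integral_distr)
  have "?m A * emeasure lborel B = (\<integral>\<^sup>+x. \<integral>\<^sup>+y. ?i A (U x) * ?i B y \<partial>lborel \<partial>lborel)"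
    by (simp add: nn_integral_cmult nn_integral_multc)
  also have "\<dots> = (\<integral>\<^sup>+x. \<integral>\<^sup>+y. ?i A (U x) * ?i B (y - U x) \<partial>lborel \<partial>lborel)"
  proof (rule nn_integral_cong)
    fix x
    show "(\<integral>\<^sup>+y. ?i A (U x) * ?i B y \<partial>lborel) = (\<integral>\<^sup>+y. ?i A (U x) * ?i B (y - U x) \<partial>lborel)"
      using shift[of "\<lambda>y. ?i A (U x) * ?i B y" "U x"] by simp
  qed
  also have "\<dots> = (\<integral>\<^sup>+y. \<integral>\<^sup>+x. ?i A (U x) * ?i B (y - U x) \<partial>lborel \<partial>lborel)"
    by (rule lborel_pair.Fubini'[symmetric]) measurable
  also have "\<dots> = (\<integral>\<^sup>+y. \<integral>\<^sup>+x. ?i A (y - U x) * ?i B (U x) \<partial>lborel \<partial>lborel)"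
  proof (rule nn_integral_cong)
    fix y
    have "(\<integral>\<^sup>+x. ?i A (U x) * ?i B (y - U x) \<partial>lborel) =
        (\<integral>\<^sup>+x. ?i A (U (V y - x)) * ?i B (y - U (V y - x)) \<partial>lborel)"
      by (subst reflect[where f = "\<lambda>x. ?i A (U x) * ?i B (y - U x)"]) auto
    then show "(\<integral>\<^sup>+x. ?i A (U x) * ?i B (y - U x) \<partial>lborel) = (\<integral>\<^sup>+x. ?i A (y - U x) * ?i B (U x) \<partial>lborel)"
      by (simp add: linear_diff[OF lin] V)
  qed
  also have "\<dots> = (\<integral>\<^sup>+x. \<integral>\<^sup>+y. ?i A (y - U x) * ?i B (U x) \<partial>lborel \<partial>lborel)"
    by (rule lborel_pair.Fubini') measurable
  also have "\<dots> = (\<integral>\<^sup>+x. \<integral>\<^sup>+y. ?i A y * ?i B (U x) \<partial>lborel \<partial>lborel)"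
  proof (rule nn_integral_cong)
    fix x
    show "(\<integral>\<^sup>+y. ?i A (y - U x) * ?i B (U x) \<partial>lborel) = (\<integral>\<^sup>+y. ?i A y * ?i B (U x) \<partial>lborel)"
      using shift[of "\<lambda>y. ?i A y * ?i B (U x)" "U x"] by simp
  qed
  also have "\<dots> = emeasure lborel A * ?m B"
    by (simp add: nn_integral_cmult nn_integral_multc)
  also have "?m B = (\<integral>\<^sup>+x. ?i B x \<partial>lborel)"
    by (intro nn_integral_cong) (simp add: B_def indicator_def iso)
  also have "\<dots> = emeasure lborel B" by simp
  finally have *: "?m A * emeasure lborel B = emeasure lborel A * emeasure lborel B" .
  have "\<not> negligible B"
    unfolding B_def by (rule open_not_negligible) auto
  then have "emeasure lborel B \<noteq> 0"
    by (auto simp: negligible_iff_null_sets null_sets_def)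
  moreover have "emeasure lborel B \<noteq> \<infinity>"
    using emeasure_bounded_finite[of B] by (simp add: B_def less_top)
  ultimately have "?m A = emeasure lborel A"
    using * by (metis ennreal_mult_cancel_left infinity_ennreal_def mult.commute)
  then show "emeasure (distr lborel borel U) A = emeasure lborel A"
    using m[OF A] by simp
qed

lemma space_surface [simp]: "space (surface_measure :: (complex ^ 'n::finite) measure) = sphere 0 1"
  by (simp add: surface_measure_def space_scale_measure)

lemma sets_surface [measurable_cong]:
  "sets (surface_measure :: (complex ^ 'n::finite) measure) = sets (restrict_space borel (sphere 0 1))"
  by (simp add: surface_measure_def)

lemma measurable_sgn_cone:
  "sgn \<in> measurable (restrict_space lborel (cball (0::complex ^ 'n::finite) 1 - {0})) (restrict_space borel (sphere 0 1))"
proof (rule measurable_restrict_space2)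
  show "sgn \<in> space (restrict_space lborel (cball (0::complex ^ 'n) 1 - {0})) \<rightarrow> sphere 0 1"
    by (auto simp: space_restrict_space norm_sgn)
  have "continuous_on (cball (0::complex ^ 'n) 1 - {0}) sgn"
    by (auto intro!: continuous_intros simp: sgn_div_norm)
  then show "sgn \<in> borel_measurable (restrict_space lborel (cball (0::complex ^ 'n) 1 - {0}))"
    by (subst measurable_cong_sets[of _ "restrict_space borel (cball (0::complex ^ 'n) 1 - {0})" _ borel])
      (auto simp: sets_restrict_space intro: borel_measurable_continuous_on_restrict)
qed

lemma nn_integral_surface:
  fixes f :: "complex ^ 'n::finite \<Rightarrow> ennreal"
  assumes "f \<in> borel_measurable surface_measure"
  shows "(\<integral>\<^sup>+w. f w \<partial>surface_measure) =
    2 * of_nat CARD('n) * (\<integral>\<^sup>+x. f (sgn x) * indicator (cball 0 1 - {0}) x \<partial>lborel)"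
proof -
  have f: "f \<in> borel_measurable (restrict_space borel (sphere 0 1))"
    using assms measurable_cong_sets[OF sets_surface refl] by blast
  have "(\<integral>\<^sup>+w. f w \<partial>surface_measure) = 2 * of_nat CARD('n) *
      (\<integral>\<^sup>+w. f w \<partial>distr (restrict_space lborel (cball 0 1 - {0})) (restrict_space borel (sphere 0 1)) sgn)"
    unfolding surface_measure_def using f by (auto intro!: nn_integral_scale_measure)
  also have "(\<integral>\<^sup>+w. f w \<partial>distr (restrict_space lborel (cball 0 1 - {0})) (restrict_space borel (sphere 0 1)) sgn)
     = (\<integral>\<^sup>+x. f (sgn x) \<partial>restrict_space lborel (cball 0 1 - {0}))"
    using f by (simp add: nn_integral_distr[OF measurable_sgn_cone])
  also have "\<dots> = (\<integral>\<^sup>+x. f (sgn x) * indicator (cball 0 1 - {0}) x \<partial>lborel)"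
    by (intro nn_integral_restrict_space) auto
  finally show ?thesis .
qed

lemma emeasure_surface_finite: "emeasure (surface_measure :: (complex ^ 'n::finite) measure) (sphere 0 1) < \<infinity>"
proof -
  have "emeasure (surface_measure :: (complex ^ 'n) measure) (sphere 0 1) =
     (\<integral>\<^sup>+w. 1 \<partial>(surface_measure :: (complex ^ 'n) measure))"
    by simp
  also have "\<dots> = 2 * of_nat CARD('n) * emeasure lborel (cball (0::complex ^ 'n) 1 - {0})"
    by (subst nn_integral_surface) auto
  also have "\<dots> < \<infinity>"
    using emeasure_bounded_finite[of "cball (0::complex ^ 'n) 1 - {0}"]
    by (simp add: ennreal_mult_less_top bounded_diff of_nat_less_top)
  finally show ?thesis .
qed

interpretation surface: finite_measure "surface_measure :: (complex ^ 'n::finite) measure"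
  by (rule finite_measureI) (use emeasure_surface_finite in \<open>simp add: less_top\<close>)

lemma surface_distr_isometry:
  fixes U :: "complex ^ 'n::finite \<Rightarrow> complex ^ 'n"
  assumes lin: "linear U" and iso: "\<And>x. norm (U x) = norm x"
  shows "distr surface_measure surface_measure U = surface_measure"
proof (rule measure_eqI)
  have U [measurable]: "U \<in> borel_measurable borel"
    using lin by (intro borel_measurable_continuous_onI linear_continuous_on linear_conv_bounded_linear[THEN iffD1])
  have US: "U \<in> measurable surface_measure surface_measure"
    unfolding measurable_cong_sets[OF sets_surface sets_surface]
    by (intro measurable_restrict_space2 measurable_restrict_space1 U) (auto simp: space_restrict_space iso)
  show "sets (distr surface_measure surface_measure U) = sets (surface_measure :: (complex ^ 'n) measure)" by simp
  fix A assume "A \<in> sets (distr surface_measure surface_measure U)"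
  then have A: "A \<in> sets surface_measure" by simp
  then have A': "A \<in> sets borel" "A \<subseteq> sphere 0 1"
    by (auto simp: sets_surface sets_restrict_space)
  have iA: "(indicator A :: complex ^ 'n \<Rightarrow> ennreal) \<in> borel_measurable surface_measure"
    using A by (rule borel_measurable_indicator)
  have iUA: "(\<lambda>x. indicator A (U x) :: ennreal) \<in> borel_measurable surface_measure"
    by (rule measurable_compose[OF US iA])
  have msgn: "sgn \<in> borel_measurable (borel :: (complex^'n) measure)"
    unfolding sgn_div_norm by measurable
  have "emeasure (distr surface_measure surface_measure U) A = (\<integral>\<^sup>+w. indicator A (U w) \<partial>surface_measure)"
    using nn_integral_distr[OF US, of "indicator A"] iA A by simp
  also have "\<dots> = 2 * of_nat CARD('n) * (\<integral>\<^sup>+x. indicator A (U (sgn x)) * indicator (cball 0 1 - {0}) x \<partial>lborel)"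
    by (rule nn_integral_surface[OF iUA])
  also have "(\<integral>\<^sup>+x. indicator A (U (sgn x)) * indicator (cball 0 1 - {0}) x \<partial>lborel) =
     (\<integral>\<^sup>+x. (indicator A (sgn (U x)) * indicator (cball 0 1 - {0}) (U x) :: ennreal) \<partial>lborel)"
  proof (rule nn_integral_cong)
    fix x
    have "sgn (U x) = U (sgn x)" by (simp add: sgn_div_norm iso linear_cmul[OF lin])
    moreover have "U x \<in> cball 0 1 - {0} \<longleftrightarrow> x \<in> cball 0 1 - {0}"
    proof -
      have "U x = 0 \<longleftrightarrow> x = 0" by (metis iso norm_eq_zero)
      then show ?thesis by (simp add: iso)
    qed
    ultimately show "indicator A (U (sgn x)) * indicator (cball 0 1 - {0}) x =
        (indicator A (sgn (U x)) * indicator (cball 0 1 - {0}) (U x) :: ennreal)"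
      by (simp add: indicator_def)
  qed
  also have "\<dots> = (\<integral>\<^sup>+x. (indicator A (sgn x) * indicator (cball 0 1 - {0}) x :: ennreal) \<partial>distr lborel borel U)"
    using A' msgn U by (subst nn_integral_distr) (auto intro!: borel_measurable_times_ennreal measurable_compose[OF msgn] borel_measurable_indicator)
  also have "distr lborel borel U = lborel"
    by (rule lborel_distr_isometry[OF lin iso])
  also have "2 * of_nat CARD('n) * (\<integral>\<^sup>+x. (indicator A (sgn x) * indicator (cball 0 1 - {0}) x :: ennreal) \<partial>lborel)
     = emeasure surface_measure A"
    using nn_integral_surface[OF iA] A by simp
  finally show "emeasure (distr surface_measure surface_measure U) A = emeasure surface_measure A" .
qed

lemma surface_measurable_continuous:
  fixes f :: "complex ^ 'n::finite \<Rightarrow> 'b::topological_space"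
  assumes "continuous_on (sphere 0 1) f"
  shows "f \<in> borel_measurable surface_measure"
  unfolding measurable_cong_sets[OF sets_surface refl]
  using assms by (rule borel_measurable_continuous_on_restrict)

lemma surface_integrable_continuous:
  fixes f :: "complex ^ 'n::finite \<Rightarrow> 'b::{banach, second_countable_topology}"
  assumes "continuous_on (sphere 0 1) f"
  shows "integrable surface_measure f"
proof -
  have "bounded (f ` sphere 0 1)"
    using assms by (intro compact_imp_bounded compact_continuous_image compact_sphere)
  then obtain B where "\<forall>x\<in>sphere 0 1. norm (f x) \<le> B"
    by (auto simp: bounded_iff)
  then show ?thesis
    by (intro surface.integrable_const_bound[where B = B] surface_measurable_continuous assms) auto
qed

lemma surface_integral_isometry:
  fixes U :: "complex ^ 'n::finite \<Rightarrow> complex ^ 'n" and f :: "complex ^ 'n \<Rightarrow> complex"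
  assumes lin: "linear U" and iso: "\<And>x. norm (U x) = norm x" and f: "continuous_on (sphere 0 1) f"
  shows "(\<integral>w. f (U w) \<partial>surface_measure) = (\<integral>w. f w \<partial>surface_measure)"
proof -
  have U [measurable]: "U \<in> borel_measurable borel"
    using lin by (intro borel_measurable_continuous_onI linear_continuous_on linear_conv_bounded_linear[THEN iffD1])
  have US: "U \<in> measurable surface_measure surface_measure"
    unfolding measurable_cong_sets[OF sets_surface sets_surface]
    by (intro measurable_restrict_space2 measurable_restrict_space1 U) (auto simp: space_restrict_space iso)
  show ?thesis
    using integral_distr[OF US surface_measurable_continuous[OF f]] surface_distr_isometry[OF lin iso] by simp
qed

text \<open>
  The cone over the set where \<open>f\<close> does not vanish is open; if it is a null set, it is empty.
\<close>

lemma surface_AE_zero_continuous: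
  fixes f :: "complex ^ 'n::finite \<Rightarrow> complex"
  assumes f: "continuous_on (sphere 0 1) f" and ae: "AE w in surface_measure. f w = 0" and z: "z \<in> sphere 0 1"
  shows "f z = 0"
proof (rule ccontr)
  assume nz: "f z \<noteq> 0"
  define S where "S = {x \<in> ball 0 1 - {0}. sgn x \<in> {w \<in> sphere 0 1. f w \<noteq> 0}}"
  have mf: "f \<in> borel_measurable surface_measure"
    by (rule surface_measurable_continuous[OF f])
  have mi: "(\<lambda>w. ennreal (norm (f w))) \<in> borel_measurable surface_measure"
    using mf by measurable
  have c: "continuous_on (ball 0 1 - {0}) (\<lambda>x. f (sgn x))"
  proof (rule continuous_on_compose2[OF f])
    show "continuous_on (ball 0 1 - {0}) (sgn :: complex ^ 'n \<Rightarrow> _)"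
      by (auto intro!: continuous_intros simp: sgn_div_norm)
  qed (auto simp: norm_sgn split: if_splits)
  have m: "(\<lambda>x. ennreal (norm (f (sgn x)))) \<in> borel_measurable (restrict_space lborel (cball 0 1 - {0}))"
  proof -
    have "(\<lambda>w. ennreal (norm (f w))) \<in> borel_measurable (restrict_space borel (sphere 0 1))"
      using mi measurable_cong_sets[OF sets_surface refl] by blast
    then show ?thesis by (rule measurable_compose[OF measurable_sgn_cone])
  qed
  have m': "(\<lambda>x. ennreal (norm (f (sgn x))) * indicator (cball 0 1 - {0}) x) \<in> borel_measurable lborel"
    using m by (subst (asm) borel_measurable_restrict_space_iff_ennreal) auto
  have "(\<integral>\<^sup>+w. ennreal (norm (f w)) \<partial>surface_measure) = 0"
    using ae mi by (subst nn_integral_0_iff_AE) auto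
  then have "(\<integral>\<^sup>+x. ennreal (norm (f (sgn x))) * indicator (cball 0 1 - {0}) x \<partial>lborel) = 0"
    using nn_integral_surface[OF mi] by simp
  then have ae': "AE x in lborel. ennreal (norm (f (sgn x))) * indicator (cball 0 1 - {0}) x = 0"
    by (subst (asm) nn_integral_0_iff_AE[OF m'])
  have Sdef: "S = (ball 0 1 - {0}) \<inter> (\<lambda>x. f (sgn x)) -` (- {0})"
    by (auto simp: S_def norm_sgn)
  have "open S"
    unfolding Sdef by (intro continuous_open_preimage c) (auto intro: open_delete)
  moreover have "(1/2) *\<^sub>R z \<in> S"
    using z nz by (auto simp: S_def sgn_div_norm)
  ultimately have "\<not> negligible S" using open_not_negligible by blast
  moreover have "S \<in> null_sets lborel"
  proof -
    have "AE x in lborel. x \<notin> S"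
      using ae' by eventually_elim (auto simp: S_def indicator_def)
    then show ?thesis using \<open>open S\<close> by (simp add: AE_iff_null_sets)
  qed
  ultimately show False
    by (simp add: negligible_iff_null_sets null_sets_completionI)
qed

section \<open>Bihomogeneous polynomials\<close>

text \<open>
  The members of \<open>bihomogeneous m n\<close> (see \<open>bihom_iff\<close>), generated from constants by multiplication
  with coordinates, so that the product rule proves their differential properties by induction.
\<close>

inductive bihom :: "nat \<Rightarrow> nat \<Rightarrow> (complex ^ 'n::finite \<Rightarrow> complex) \<Rightarrow> bool" where
  const: "bihom 0 0 (\<lambda>z. c)"
| mult_z: "bihom m n f \<Longrightarrow> bihom (Suc m) n (\<lambda>z. z $ j * f z)"
| mult_cnj: "bihom m n f \<Longrightarrow> bihom m (Suc n) (\<lambda>z. cnj (z $ j) * f z)"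
| add: "bihom m n f \<Longrightarrow> bihom m n g \<Longrightarrow> bihom m n (\<lambda>z. f z + g z)"

definition zmonom :: "('n::finite \<Rightarrow> nat) \<Rightarrow> ('n \<Rightarrow> nat) \<Rightarrow> complex ^ 'n \<Rightarrow> complex" where
  "zmonom \<alpha> \<beta> z = (\<Prod>j\<in>UNIV. (z $ j) ^ \<alpha> j * cnj (z $ j) ^ \<beta> j)"

lemma finite_multi_index: "finite {\<alpha> :: 'n::finite \<Rightarrow> nat. sum \<alpha> UNIV = m}"
proof (rule finite_subset)
  show "{\<alpha> :: 'n \<Rightarrow> nat. sum \<alpha> UNIV = m} \<subseteq> (\<Pi>\<^sub>E i\<in>UNIV. {..m})"
    by (auto simp: PiE_UNIV_domain intro: member_le_sum)
qed (auto intro: finite_PiE)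

lemma bihom_0: "bihom m n (\<lambda>z. 0)"
proof (induction m)
  case 0
  show ?case
  proof (induction n)
    case (Suc n)
    then show ?case using bihom.mult_cnj[OF Suc.IH, of undefined] by simp
  qed (rule bihom.const)
next
  case (Suc m)
  then show ?case using bihom.mult_z[OF Suc.IH, of undefined] by simp
qed

lemma bihom_cmult: "bihom m n f \<Longrightarrow> bihom m n (\<lambda>z. c * f z)"
proof (induction rule: bihom.induct)
  case (const b)
  show ?case by (rule bihom.const)
next
  case (mult_z m n f j)
  then show ?case using bihom.mult_z[of m n "\<lambda>z. c * f z" j] by (simp add: algebra_simps)
next
  case (mult_cnj m n f j)
  then show ?case using bihom.mult_cnj[of m n "\<lambda>z. c * f z" j] by (simp add: algebra_simps)
next
  case (add m n f g)
  then show ?case using bihom.add[of m n "\<lambda>z. c * f z" "\<lambda>z. c * g z"] by (simp add: algebra_simps)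
qed

lemma bihom_sum: "(\<And>i. i \<in> I \<Longrightarrow> bihom m n (f i)) \<Longrightarrow> bihom m n (\<lambda>z. \<Sum>i\<in>I. f i z)"
  by (induction I rule: infinite_finite_induct) (auto intro: bihom_0 bihom.add)

lemma bihom_diff: "bihom m n f \<Longrightarrow> bihom m n g \<Longrightarrow> bihom m n (\<lambda>z. f z - g z)"
  using bihom.add[of m n f "\<lambda>z. (-1) * g z"] bihom_cmult[of m n g "-1"] by simp

lemma bihom_mult:
  assumes "bihom m n f" "bihom m' n' g"
  shows "bihom (m + m') (n + n') (\<lambda>z. f z * g z)"
  using assms(1)
proof (induction rule: bihom.induct)
  case (const c)
  then show ?case using bihom_cmult[OF assms(2)] by simp
next
  case (mult_z m n f j)
  then show ?case using bihom.mult_z[OF mult_z.IH, of j] by (simp add: mult.assoc)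
next
  case (mult_cnj m n f j)
  then show ?case using bihom.mult_cnj[OF mult_cnj.IH, of j] by (simp add: mult.assoc)
next
  case (add m n f g)
  then show ?case using bihom.add[OF add.IH] by (simp add: algebra_simps)
qed

lemma bihom_cnj: "bihom m n f \<Longrightarrow> bihom n m (\<lambda>z. cnj (f z))"
proof (induction rule: bihom.induct)
  case (const c)
  show ?case by (rule bihom.const)
qed (auto intro: bihom.intros)

lemma bihom_coord: "bihom 1 0 (\<lambda>z. z $ j)" "bihom 0 1 (\<lambda>z. cnj (z $ j))"
  using bihom.mult_z[OF bihom.const[of 1], of j] bihom.mult_cnj[OF bihom.const[of 1], of j] by simp_all

lemma bihom_power: "bihom m n f \<Longrightarrow> bihom (k * m) (k * n) (\<lambda>z. f z ^ k)"
proof (induction k)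
  case 0
  show ?case using bihom.const[of 1] by simp
next
  case (Suc k)
  then show ?case using bihom_mult[of m n f "k * m" "k * n" "\<lambda>z. f z ^ k"] by simp
qed

lemma bihom_monom: "bihom (sum \<alpha> UNIV) (sum \<beta> UNIV) (zmonom \<alpha> \<beta> :: complex ^ 'n::finite \<Rightarrow> complex)"
proof -
  have "bihom (sum \<alpha> J) (sum \<beta> J) (\<lambda>z :: complex ^ 'n. \<Prod>j\<in>J. (z $ j) ^ \<alpha> j * cnj (z $ j) ^ \<beta> j)" if "finite J" for J
    using that
  proof induction
    case empty
    show ?case using bihom.const[of 1] by simp
  next
    case (insert j J)
    have "bihom (\<alpha> j) (\<beta> j) (\<lambda>z :: complex ^ 'n. (z $ j) ^ \<alpha> j * cnj (z $ j) ^ \<beta> j)"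
      using bihom_mult[OF bihom_power[OF bihom_coord(1), of "\<alpha> j" j] bihom_power[OF bihom_coord(2), of "\<beta> j" j]]
      by simp
    from bihom_mult[OF this insert.IH] insert.hyps show ?case by simp
  qed
  from this[of UNIV] show ?thesis by (simp add: zmonom_def[abs_def])
qed

lemma bihomogeneous_monom:
  "(zmonom \<alpha> \<beta> :: complex ^ 'n::finite \<Rightarrow> complex) \<in> bihomogeneous (sum \<alpha> UNIV) (sum \<beta> UNIV)"
  unfolding bihomogeneous_def mem_Collect_eq
proof (intro exI[of _ "\<lambda>a b. if a = \<alpha> then if b = \<beta> then 1 else 0 else 0"] ext)
  fix z :: "complex ^ 'n"
  have "(\<Sum>a | sum a UNIV = sum \<alpha> UNIV. \<Sum>b | sum b UNIV = sum \<beta> UNIV.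
         (if a = \<alpha> then if b = \<beta> then 1 else 0 else 0) * (\<Prod>j\<in>UNIV. (z $ j) ^ a j * cnj (z $ j) ^ b j))
      = (\<Sum>a | sum a UNIV = sum \<alpha> UNIV. if a = \<alpha> then (\<Sum>b | sum b UNIV = sum \<beta> UNIV.
          if b = \<beta> then (\<Prod>j\<in>UNIV. (z $ j) ^ a j * cnj (z $ j) ^ b j) else 0) else 0)"
  proof (rule sum.cong)
    fix a
    show "(\<Sum>b | sum b UNIV = sum \<beta> UNIV.
         (if a = \<alpha> then if b = \<beta> then 1 else 0 else 0) * (\<Prod>j\<in>UNIV. (z $ j) ^ a j * cnj (z $ j) ^ b j))
      = (if a = \<alpha> then (\<Sum>b | sum b UNIV = sum \<beta> UNIV.
          if b = \<beta> then (\<Prod>j\<in>UNIV. (z $ j) ^ a j * cnj (z $ j) ^ b j) else 0) else 0)"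
      by (cases "a = \<alpha>") (auto intro!: sum.cong)
  qed simp
  also have "\<dots> = zmonom \<alpha> \<beta> z"
    by (simp add: sum.delta finite_multi_index zmonom_def)
  finally show "zmonom \<alpha> \<beta> z = (\<Sum>a | sum a UNIV = sum \<alpha> UNIV. \<Sum>b | sum b UNIV = sum \<beta> UNIV.
         (if a = \<alpha> then if b = \<beta> then 1 else 0 else 0) * (\<Prod>j\<in>UNIV. (z $ j) ^ a j * cnj (z $ j) ^ b j))"
    by simp
qed

lemma bihomogeneous_add:
  assumes "f \<in> bihomogeneous m n" "g \<in> bihomogeneous m n"
  shows "(\<lambda>z. f z + g z) \<in> bihomogeneous m n"
proof -
  from assms obtain c c' where
    "f = (\<lambda>z. \<Sum>\<alpha> | (\<Sum>j\<in>UNIV. \<alpha> j) = m. \<Sum>\<beta> | (\<Sum>j\<in>UNIV. \<beta> j) = n. c \<alpha> \<beta> * (\<Prod>j\<in>UNIV. (z $ j) ^ \<alpha> j * cnj (z $ j) ^ \<beta> j))"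
    "g = (\<lambda>z. \<Sum>\<alpha> | (\<Sum>j\<in>UNIV. \<alpha> j) = m. \<Sum>\<beta> | (\<Sum>j\<in>UNIV. \<beta> j) = n. c' \<alpha> \<beta> * (\<Prod>j\<in>UNIV. (z $ j) ^ \<alpha> j * cnj (z $ j) ^ \<beta> j))"
    by (auto simp: bihomogeneous_def)
  then show ?thesis
    unfolding bihomogeneous_def mem_Collect_eq
    by (intro exI[of _ "\<lambda>a b. c a b + c' a b"]) (simp add: sum.distrib distrib_right)
qed

lemma bihomogeneous_cmult:
  assumes "f \<in> bihomogeneous m n"
  shows "(\<lambda>z. b * f z) \<in> bihomogeneous m n"
proof -
  from assms obtain c where
    "f = (\<lambda>z. \<Sum>\<alpha> | (\<Sum>j\<in>UNIV. \<alpha> j) = m. \<Sum>\<beta> | (\<Sum>j\<in>UNIV. \<beta> j) = n. c \<alpha> \<beta> * (\<Prod>j\<in>UNIV. (z $ j) ^ \<alpha> j * cnj (z $ j) ^ \<beta> j))"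
    by (auto simp: bihomogeneous_def)
  then show ?thesis
    unfolding bihomogeneous_def mem_Collect_eq
    by (intro exI[of _ "\<lambda>\<alpha> \<beta>. b * c \<alpha> \<beta>"]) (simp add: sum_distrib_left mult.assoc)
qed

lemma bihomogeneous_0: "(\<lambda>z. 0) \<in> bihomogeneous m n"
  unfolding bihomogeneous_def mem_Collect_eq by (intro exI[of _ "\<lambda>_ _. 0"]) simp

lemma bihomogeneous_sum:
  "(\<And>i. i \<in> I \<Longrightarrow> f i \<in> bihomogeneous m n) \<Longrightarrow> (\<lambda>z. \<Sum>i\<in>I. f i z) \<in> bihomogeneous m n"
  by (induction I rule: infinite_finite_induct) (auto intro: bihomogeneous_0 bihomogeneous_add)

lemma bihomogeneous_expand:
  assumes "f \<in> bihomogeneous m n"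
  obtains c where "f = (\<lambda>z. \<Sum>\<alpha> | sum \<alpha> UNIV = m. \<Sum>\<beta> | sum \<beta> UNIV = n. c \<alpha> \<beta> * zmonom \<alpha> \<beta> z)"
  using assms unfolding bihomogeneous_def zmonom_def by auto

lemma monom_mult_z: "z $ j * zmonom \<alpha> \<beta> z = zmonom (\<alpha>(j := Suc (\<alpha> j))) \<beta> z"
proof -
  have "zmonom (\<alpha>(j := Suc (\<alpha> j))) \<beta> z =
     ((z $ j) ^ Suc (\<alpha> j) * cnj (z $ j) ^ \<beta> j) * (\<Prod>i\<in>UNIV - {j}. (z $ i) ^ \<alpha> i * cnj (z $ i) ^ \<beta> i)"
    unfolding zmonom_def by (subst prod.remove[of _ j]) auto
  moreover have "zmonom \<alpha> \<beta> z =
     ((z $ j) ^ \<alpha> j * cnj (z $ j) ^ \<beta> j) * (\<Prod>i\<in>UNIV - {j}. (z $ i) ^ \<alpha> i * cnj (z $ i) ^ \<beta> i)"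
    unfolding zmonom_def by (subst prod.remove[of _ j]) auto
  ultimately show ?thesis by (simp add: mult.assoc)
qed

lemma monom_cnj: "cnj (zmonom \<alpha> \<beta> z) = zmonom \<beta> \<alpha> z"
  by (simp add: zmonom_def mult.commute)

lemma sum_upd_Suc: "sum (\<alpha>(j := Suc (\<alpha> j))) UNIV = Suc (sum \<alpha> (UNIV :: 'n::finite set))"
  by (subst (1 2) sum.remove[of _ j]) (auto simp: )

lemma bihom_iff: "bihom m n f \<longleftrightarrow> f \<in> bihomogeneous m n"
proof
  assume "f \<in> bihomogeneous m n"
  then obtain c where f: "f = (\<lambda>z. \<Sum>\<alpha> | sum \<alpha> UNIV = m. \<Sum>\<beta> | sum \<beta> UNIV = n. c \<alpha> \<beta> * zmonom \<alpha> \<beta> z)"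
    by (rule bihomogeneous_expand)
  show "bihom m n f"
    unfolding f by (intro bihom_sum bihom_cmult) (use bihom_monom in auto)
next
  assume "bihom m n f"
  then show "f \<in> bihomogeneous m n"
  proof induction
    case (const c)
    have "(\<lambda>z. c * zmonom (\<lambda>_. 0) (\<lambda>_. 0) z) \<in> bihomogeneous 0 0"
      using bihomogeneous_cmult[OF bihomogeneous_monom[of "\<lambda>_. 0" "\<lambda>_. 0"]] by simp
    then show ?case by (simp add: zmonom_def)
  next
    case (mult_z m n f j)
    from mult_z.IH obtain c where f: "f = (\<lambda>z. \<Sum>\<alpha> | sum \<alpha> UNIV = m. \<Sum>\<beta> | sum \<beta> UNIV = n. c \<alpha> \<beta> * zmonom \<alpha> \<beta> z)"
      by (rule bihomogeneous_expand)
    have "(\<lambda>z. z $ j * f z) = (\<lambda>z. \<Sum>\<alpha> | sum \<alpha> UNIV = m. \<Sum>\<beta> | sum \<beta> UNIV = n. c \<alpha> \<beta> * zmonom (\<alpha>(j := Suc (\<alpha> j))) \<beta> z)"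
      by (simp add: f sum_distrib_left mult.left_commute flip: monom_mult_z)
    also have "\<dots> \<in> bihomogeneous (Suc m) n"
      by (intro bihomogeneous_sum bihomogeneous_cmult)
         (metis (mono_tags, lifting) bihomogeneous_monom mem_Collect_eq sum_upd_Suc)
    finally show ?case .
  next
    case (mult_cnj m n f j)
    from mult_cnj.IH obtain c where f: "f = (\<lambda>z. \<Sum>\<alpha> | sum \<alpha> UNIV = m. \<Sum>\<beta> | sum \<beta> UNIV = n. c \<alpha> \<beta> * zmonom \<alpha> \<beta> z)"
      by (rule bihomogeneous_expand)
    have *: "cnj (z $ j) * zmonom \<alpha> \<beta> z = zmonom \<alpha> (\<beta>(j := Suc (\<beta> j))) z" for \<alpha> \<beta> z
      by (metis complex_cnj_cnj complex_cnj_mult monom_cnj monom_mult_z)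
    have "(\<lambda>z. cnj (z $ j) * f z) = (\<lambda>z. \<Sum>\<alpha> | sum \<alpha> UNIV = m. \<Sum>\<beta> | sum \<beta> UNIV = n. c \<alpha> \<beta> * zmonom \<alpha> (\<beta>(j := Suc (\<beta> j))) z)"
      by (simp add: f sum_distrib_left mult.left_commute flip: *)
    also have "\<dots> \<in> bihomogeneous m (Suc n)"
      by (intro bihomogeneous_sum bihomogeneous_cmult)
         (metis (mono_tags, lifting) bihomogeneous_monom mem_Collect_eq sum_upd_Suc)
    finally show ?case .
  next
    case (add m n f g)
    then show ?case by (intro bihomogeneous_add)
  qed
qed

lemma bihom_scale: "bihom m n f \<Longrightarrow> f (c *s z) = c ^ m * cnj c ^ n * f z"
  by (induction rule: bihom.induct) (auto simp: algebra_simps)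

lemma bihom_continuous: "bihom m n f \<Longrightarrow> continuous_on A f"
  by (induction rule: bihom.induct) (auto intro!: continuous_intros)

lemma bihom_linear_comp:
  assumes "bihom m n f" and U: "\<And>j. \<exists>u. \<forall>z. (U z :: complex ^ 'n::finite) $ j = (\<Sum>k\<in>UNIV. u k * (z :: complex ^ 'n) $ k)"
  shows "bihom m n (\<lambda>z. f (U z))"
proof -
  have 1: "bihom 1 0 (\<lambda>z. U z $ j)" for j
  proof -
    obtain u where "\<And>z. U z $ j = (\<Sum>k\<in>UNIV. u k * z $ k)" using U by blast
    then show ?thesis by (simp only:) (intro bihom_sum bihom_cmult bihom_coord)
  qed
  have 2: "bihom 0 1 (\<lambda>z. cnj (U z $ j))" for j
    using bihom_cnj[OF 1] by simp
  show ?thesis using assms(1)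
  proof (induction rule: bihom.induct)
    case (const c)
    show ?case by (rule bihom.const)
  next
    case (mult_z m n f j)
    then show ?case using bihom_mult[OF 1[of j] mult_z.IH] by simp
  next
    case (mult_cnj m n f j)
    then show ?case using bihom_mult[OF 2[of j] mult_cnj.IH] by simp
  next
    case (add m n f g)
    then show ?case by (intro bihom.add)
  qed
qed

section \<open>Wirtinger calculus\<close>

lemma d_z_eq:
  assumes "(f has_derivative D) (at z)"
  shows "d_z j f z = (D (axis j 1) - \<i> * D (axis j \<i>)) / 2"
    "d_zbar j f z = (D (axis j 1) + \<i> * D (axis j \<i>)) / 2"
  using frechet_derivative_at[OF assms] by (simp_all add: d_z_def d_zbar_def)

lemma vec_decompose: "(v :: complex ^ 'n::finite) =
   (\<Sum>k\<in>UNIV. Re (v $ k) *\<^sub>R axis k 1 + Im (v $ k) *\<^sub>R axis k \<i>)"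
proof (subst vec_eq_iff, rule allI)
  fix i
  have "(\<Sum>k\<in>UNIV. Re (v $ k) *\<^sub>R axis k 1 + Im (v $ k) *\<^sub>R axis k \<i> :: complex ^ 'n) $ i
    = (\<Sum>k\<in>UNIV. if k = i then v $ k else 0)"
    unfolding sum_component by (intro sum.cong refl) (auto simp: axis_def complex_eq_iff)
  then show "v $ i = (\<Sum>k\<in>UNIV. Re (v $ k) *\<^sub>R axis k 1 + Im (v $ k) *\<^sub>R axis k \<i> :: complex ^ 'n) $ i"
    by simp
qed

lemma has_derivative_wirtinger:
  assumes "(f has_derivative D) (at z)"
  shows "D v = (\<Sum>k\<in>UNIV. v $ k * d_z k f z + cnj (v $ k) * d_zbar k f z)"
proof -
  have "linear D" using assms has_derivative_linear by blast
  then have "D v = (\<Sum>k\<in>UNIV. Re (v $ k) *\<^sub>R D (axis k 1) + Im (v $ k) *\<^sub>R D (axis k \<i>))"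
    by (subst vec_decompose) (simp add: linear_sum linear_add linear_cmul)
  also have "\<dots> = (\<Sum>k\<in>UNIV. v $ k * d_z k f z + cnj (v $ k) * d_zbar k f z)"
    by (intro sum.cong refl) (auto simp: d_z_eq[OF assms] complex_eq_iff field_simps)
  finally show ?thesis .
qed

lemma d_mult:
  assumes "f differentiable (at z)" "g differentiable (at z)"
  shows "d_z j (\<lambda>z. f z * g z) z = d_z j f z * g z + f z * d_z j g z"
    "d_zbar j (\<lambda>z. f z * g z) z = d_zbar j f z * g z + f z * d_zbar j g z"
proof -
  from assms obtain F G where F: "(f has_derivative F) (at z)" and G: "(g has_derivative G) (at z)"
    by (auto simp: differentiable_def)
  note FG = has_derivative_mult[OF F G]
  show "d_z j (\<lambda>z. f z * g z) z = d_z j f z * g z + f z * d_z j g z"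
    "d_zbar j (\<lambda>z. f z * g z) z = d_zbar j f z * g z + f z * d_zbar j g z"
    by (simp_all add: d_z_eq[OF F] d_z_eq[OF G] d_z_eq[OF FG] field_simps)
qed

lemma d_add:
  assumes "f differentiable (at z)" "g differentiable (at z)"
  shows "d_z j (\<lambda>z. f z + g z) z = d_z j f z + d_z j g z"
    "d_zbar j (\<lambda>z. f z + g z) z = d_zbar j f z + d_zbar j g z"
proof -
  from assms obtain F G where F: "(f has_derivative F) (at z)" and G: "(g has_derivative G) (at z)"
    by (auto simp: differentiable_def)
  note FG = has_derivative_add[OF F G]
  show "d_z j (\<lambda>z. f z + g z) z = d_z j f z + d_z j g z"
    "d_zbar j (\<lambda>z. f z + g z) z = d_zbar j f z + d_zbar j g z"
    by (simp_all add: d_z_eq[OF F] d_z_eq[OF G] d_z_eq[OF FG] field_simps)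
qed

lemma d_cnj:
  assumes "f differentiable (at z)"
  shows "d_z j (\<lambda>z. cnj (f z)) z = cnj (d_zbar j f z)"
    "d_zbar j (\<lambda>z. cnj (f z)) z = cnj (d_z j f z)"
proof -
  from assms obtain F where F: "(f has_derivative F) (at z)"
    by (auto simp: differentiable_def)
  note FG = bounded_linear.has_derivative[OF bounded_linear_cnj F]
  show "d_z j (\<lambda>z. cnj (f z)) z = cnj (d_zbar j f z)"
    "d_zbar j (\<lambda>z. cnj (f z)) z = cnj (d_z j f z)"
    by (simp_all add: d_z_eq[OF F] d_z_eq[OF FG] field_simps)
qed

lemma d_const: "d_z j (\<lambda>z. c) z = 0" "d_zbar j (\<lambda>z. c) z = 0"
  using d_z_eq[OF has_derivative_const] by simp_all

lemma coord_has_derivative: "((\<lambda>z :: complex ^ 'n::finite. z $ k) has_derivative (\<lambda>v. v $ k)) (at z)"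
  by (rule bounded_linear_imp_has_derivative[OF bounded_linear_vec_nth])

lemma coord_differentiable: "(\<lambda>z :: complex ^ 'n::finite. z $ k) differentiable (at z)"
  using coord_has_derivative differentiable_def by blast

lemma coord_cnj_differentiable: "(\<lambda>z :: complex ^ 'n::finite. cnj (z $ k)) differentiable (at z)"
  using bounded_linear.has_derivative[OF bounded_linear_cnj coord_has_derivative] differentiable_def by blast

lemma d_coord: "d_z j (\<lambda>z. z $ k) z = (if j = k then 1 else 0)" "d_zbar j (\<lambda>z. z $ k) z = 0"
  by (auto simp: d_z_eq[OF coord_has_derivative] axis_def)

lemma d_coord_cnj: "d_zbar j (\<lambda>z. cnj (z $ k)) z = (if j = k then 1 else 0)" "d_z j (\<lambda>z. cnj (z $ k)) z = 0"
  by (auto simp: d_cnj[OF coord_differentiable] d_coord)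

lemma bihom_differentiable: "bihom m n f \<Longrightarrow> f differentiable (at z)"
  by (induction rule: bihom.induct)
     (auto intro!: differentiable_mult differentiable_add coord_differentiable coord_cnj_differentiable)

text \<open>
  The clause for \<open>m = 0\<close> carries the induction through the product rule, where the truncated
  \<open>m - 1\<close> would otherwise give one degree too many.
\<close>

lemma bihom_deriv_aux:
  "bihom m n f \<Longrightarrow> bihom (m - 1) n (d_z j f) \<and> (m = 0 \<longrightarrow> d_z j f = (\<lambda>z. 0))"
proof (induction rule: bihom.induct)
  case (const c)
  have "d_z j (\<lambda>z. c) = (\<lambda>z. 0)" using d_const by blast
  then show ?case using bihom_0 by simp
next
  case (mult_z m n f k)
  have "d_z j (\<lambda>z. z $ k * f z) = (\<lambda>z. (if j = k then 1 else 0) * f z + z $ k * d_z j f z)"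
    using d_mult(1)[OF coord_differentiable bihom_differentiable[OF mult_z.hyps]] by (simp add: d_coord fun_eq_iff)
  moreover have "bihom m n (\<lambda>z. (if j = k then 1 else 0) * f z + z $ k * d_z j f z)"
  proof (cases m)
    case 0
    then show ?thesis using mult_z.IH bihom_cmult[OF mult_z.hyps] by simp
  next
    case (Suc m')
    then show ?thesis
      using bihom.mult_z[OF mult_z.IH[THEN conjunct1], of k] by (intro bihom.add bihom_cmult mult_z.hyps) simp
  qed
  ultimately show ?case by simp
next
  case (mult_cnj m n f k)
  have "d_z j (\<lambda>z. cnj (z $ k) * f z) = (\<lambda>z. cnj (z $ k) * d_z j f z)"
    using d_mult(1)[OF coord_cnj_differentiable bihom_differentiable[OF mult_cnj.hyps]] by (simp add: d_coord_cnj fun_eq_iff)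
  then show ?case using bihom.mult_cnj[of "m - 1" n "d_z j f" k] mult_cnj.IH by auto
next
  case (add m n f g)
  have "d_z j (\<lambda>z. f z + g z) = (\<lambda>z. d_z j f z + d_z j g z)"
    using d_add(1)[OF bihom_differentiable bihom_differentiable] add.hyps by blast
  then show ?case using add.IH by (auto intro: bihom.add)
qed

lemma bihom_d_z: "bihom m n f \<Longrightarrow> bihom (m - 1) n (d_z j f)"
  using bihom_deriv_aux by blast

lemma d_zbar_via_cnj: "bihom m n f \<Longrightarrow> d_zbar j f = (\<lambda>z. cnj (d_z j (\<lambda>z. cnj (f z)) z))"
  using d_cnj(1)[OF bihom_differentiable] by fastforce

lemma bihom_d_zbar: "bihom m n f \<Longrightarrow> bihom m (n - 1) (d_zbar j f)"
  by (subst d_zbar_via_cnj, assumption) (intro bihom_cnj bihom_d_z)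

lemma euler_z: "bihom m n f \<Longrightarrow> (\<Sum>j\<in>UNIV. z $ j * d_z j f z) = of_nat m * f z"
proof (induction rule: bihom.induct)
  case (const c)
  then show ?case by (simp add: d_const)
next
  case (mult_z m n f k)
  have "(\<Sum>j\<in>UNIV. z $ j * d_z j (\<lambda>z. z $ k * f z) z)
    = (\<Sum>j\<in>UNIV. (if j = k then z $ j * f z else 0) + z $ k * (z $ j * d_z j f z))"
    by (intro sum.cong refl) (auto simp: d_mult[OF coord_differentiable bihom_differentiable[OF mult_z.hyps]] d_coord distrib_left mult.left_commute)
  also have "\<dots> = z $ k * f z + z $ k * (of_nat m * f z)"
    by (simp add: sum.distrib mult_z.IH flip: sum_distrib_left)
  finally show ?case by (simp add: algebra_simps)
next
  case (mult_cnj m n f k)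
  have "(\<Sum>j\<in>UNIV. z $ j * d_z j (\<lambda>z. cnj (z $ k) * f z) z)
    = (\<Sum>j\<in>UNIV. cnj (z $ k) * (z $ j * d_z j f z))"
    by (intro sum.cong refl) (auto simp: d_mult[OF coord_cnj_differentiable bihom_differentiable[OF mult_cnj.hyps]] d_coord_cnj distrib_left mult.left_commute)
  also have "\<dots> = cnj (z $ k) * (of_nat m * f z)"
    by (simp add: mult_cnj.IH flip: sum_distrib_left)
  finally show ?case by (simp add: algebra_simps)
next
  case (add m n f g)
  have "(\<Sum>j\<in>UNIV. z $ j * d_z j (\<lambda>z. f z + g z) z) = (\<Sum>j\<in>UNIV. z $ j * d_z j f z + z $ j * d_z j g z)"
    by (intro sum.cong refl) (simp add: d_add[OF add.hyps[THEN bihom_differentiable]] algebra_simps)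
  also have "\<dots> = of_nat m * f z + of_nat m * g z"
    by (simp add: sum.distrib add.IH)
  finally show ?case by (simp add: algebra_simps)
qed

lemma euler_zbar:
  assumes "bihom m n f" shows "(\<Sum>j\<in>UNIV. cnj (z $ j) * d_zbar j f z) = of_nat n * f z"
proof -
  have "(\<Sum>j\<in>UNIV. cnj (z $ j) * d_zbar j f z) = cnj (\<Sum>j\<in>UNIV. z $ j * d_z j (\<lambda>z. cnj (f z)) z)"
    by (simp add: d_zbar_via_cnj[OF assms])
  also have "\<dots> = of_nat n * f z" using euler_z[OF bihom_cnj[OF assms]] by simp
  finally show ?thesis .
qed

text \<open>
  This property is what dominates the difference quotients along rotations below.
\<close>

definition lipschitz_bounded :: "(complex ^ 'n::finite \<Rightarrow> complex) \<Rightarrow> bool" where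
  "lipschitz_bounded f \<longleftrightarrow> (\<exists>L\<ge>0. \<exists>M\<ge>0. (\<forall>x\<in>cball 0 1. norm (f x) \<le> M) \<and>
     (\<forall>x\<in>cball 0 1. \<forall>y\<in>cball 0 1. norm (f x - f y) \<le> L * norm (x - y)))"

lemma lipschitz_bounded_mult:
  fixes f g :: "complex ^ 'n::finite \<Rightarrow> complex"
  assumes f: "lipschitz_bounded f"
    and g: "\<And>x. norm (g x) \<le> norm x" "\<And>x y. g x - g y = g (x - y)"
  shows "lipschitz_bounded (\<lambda>z. g z * f z)"
proof -
  obtain L M where *: "L \<ge> 0" "M \<ge> 0" "\<forall>x\<in>cball 0 1. norm (f x) \<le> M"
    "\<forall>x\<in>cball 0 1. \<forall>y\<in>cball 0 1. norm (f x - f y) \<le> L * norm (x - y)"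
    using f unfolding lipschitz_bounded_def by blast
  have lip: "norm (g x * f x - g y * f y) \<le> (M + L) * norm (x - y)" if x: "x \<in> cball 0 1" and y: "y \<in> cball 0 1" for x y
  proof -
    have "g x * f x - g y * f y = g (x - y) * f x + g y * (f x - f y)"
      unfolding g(2)[symmetric] by (simp add: algebra_simps)
    also have "norm \<dots> \<le> norm (g (x - y)) * norm (f x) + norm (g y) * norm (f x - f y)"
      by (metis norm_mult norm_triangle_ineq)
    also have "\<dots> \<le> norm (x - y) * M + 1 * (L * norm (x - y))"
      using * x y g(1)[of "x - y"] order_trans[OF g(1)[of y]] by (intro add_mono mult_mono) auto
    finally show ?thesis by (simp add: algebra_simps)
  qed
  have bound: "norm (g x * f x) \<le> M" if x: "x \<in> cball 0 1" for x
  proof -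
    have "norm (g x * f x) \<le> 1 * M"
      unfolding norm_mult using * x order_trans[OF g(1)[of x]] by (intro mult_mono) auto
    then show ?thesis by simp
  qed
  have "M + L \<ge> 0" using *(1,2) by simp
  then show ?thesis unfolding lipschitz_bounded_def using lip bound *(2) by blast
qed

lemma bihom_lipschitz: "bihom m n f \<Longrightarrow> lipschitz_bounded f"
proof (induction rule: bihom.induct)
  case (const c)
  show ?case unfolding lipschitz_bounded_def by (intro exI[of _ 0] conjI exI[of _ "norm c"]) auto
next
  case (add m n f g)
  then obtain L M L' M' where *: "L \<ge> 0" "M \<ge> 0" "\<forall>x\<in>cball 0 1. norm (f x) \<le> M"
    "\<forall>x\<in>cball 0 1. \<forall>y\<in>cball 0 1. norm (f x - f y) \<le> L * norm (x - y)"
    "L' \<ge> 0" "M' \<ge> 0" "\<forall>x\<in>cball 0 1. norm (g x) \<le> M'"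
    "\<forall>x\<in>cball 0 1. \<forall>y\<in>cball 0 1. norm (g x - g y) \<le> L' * norm (x - y)"
    unfolding lipschitz_bounded_def by blast
  have lip: "norm (f x + g x - (f y + g y)) \<le> (L + L') * norm (x - y)" if x: "x \<in> cball 0 1" and y: "y \<in> cball 0 1" for x y
  proof -
    have "norm (f x + g x - (f y + g y)) \<le> norm (f x - f y) + norm (g x - g y)"
      using norm_triangle_ineq[of "f x - f y" "g x - g y"] by (simp add: algebra_simps)
    also have "\<dots> \<le> (L + L') * norm (x - y)"
      using *(4,8) x y by (auto simp: distrib_right intro!: add_mono)
    finally show ?thesis .
  qed
  have bound: "norm (f x + g x) \<le> M + M'" if "x \<in> cball 0 1" for x
    using * that by (intro norm_triangle_mono) auto
  have "L + L' \<ge> 0" "M + M' \<ge> 0" using *(1,2,5,6) by simp_all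
  then show ?case unfolding lipschitz_bounded_def using lip bound by blast
next
  case (mult_z m n f k)
  then show ?case
    by (intro lipschitz_bounded_mult) (auto simp: Finite_Cartesian_Product.norm_nth_le)
next
  case (mult_cnj m n f k)
  then show ?case
    by (intro lipschitz_bounded_mult) (auto simp: Finite_Cartesian_Product.norm_nth_le)
qed

section \<open>Unitary reflections\<close>

definition cinner :: "complex ^ 'n::finite \<Rightarrow> complex ^ 'n \<Rightarrow> complex" where
  "cinner z v = (\<Sum>j\<in>UNIV. z $ j * cnj (v $ j))"

text \<open>
  For \<open>norm c = norm v = 1\<close> this is the unitary reflection that multiplies \<open>v\<close> by \<open>c\<close> and fixes the
  orthogonal complement of \<open>v\<close>. These maps replace the full unitary group: they act transitively on
  the sphere, and the derivatives of \<open>t \<mapsto> crefl (cis t) v\<close> span its Lie algebra.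
\<close>

definition crefl :: "complex \<Rightarrow> complex ^ 'n::finite \<Rightarrow> complex ^ 'n \<Rightarrow> complex ^ 'n" where
  "crefl c v z = z + ((c - 1) * cinner z v) *s v"

lemma cinner_self: "cinner z z = of_real ((norm z)\<^sup>2)"
proof -
  have "(norm z)\<^sup>2 = (\<Sum>j\<in>UNIV. (norm (z $ j))\<^sup>2)"
    by (simp add: norm_vec_def L2_set_def sum_nonneg)
  then show ?thesis
    by (simp only: cinner_def of_real_sum complex_norm_square)
qed

lemma cinner_add_left: "cinner (x + y) v = cinner x v + cinner y v"
  and cinner_add_right: "cinner v (x + y) = cinner v x + cinner v y"
  and cinner_scale_left: "cinner (c *s x) v = c * cinner x v"
  and cinner_scale_right: "cinner v (c *s x) = cnj c * cinner v x"
  and cinner_cnj: "cnj (cinner v x) = cinner x v"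
  by (simp_all add: cinner_def sum.distrib algebra_simps sum_distrib_left)

lemma norm_crefl:
  assumes c: "norm c = 1" and v: "norm v = 1"
  shows "norm (crefl c v z) = norm z"
proof -
  have cc: "c * cnj c = 1" using c by (metis complex_norm_square mult_1 of_real_1 power_one)
  define w where "w = cinner z v"
  have w': "cinner v z = cnj w" by (simp add: w_def cinner_cnj)
  have vv: "cinner v v = 1" using v by (simp add: cinner_self)
  have "cinner (z + a *s v) (z + a *s v) = cinner z z + cnj a * w + a * cnj w + a * cnj a" for a
    by (simp add: cinner_add_left cinner_add_right cinner_scale_left cinner_scale_right w' vv distrib_left flip: w_def)
  from this[of "(c - 1) * w"]
  have "cinner (crefl c v z) (crefl c v z) = cinner z z + (cnj (c - 1) + (c - 1) + (c - 1) * cnj (c - 1)) * (w * cnj w)"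
    by (simp add: crefl_def algebra_simps flip: w_def)
  also have "cnj (c - 1) + (c - 1) + (c - 1) * cnj (c - 1) = 0"
    using cc by (simp add: algebra_simps)
  finally have "of_real ((norm (crefl c v z))\<^sup>2) = (of_real ((norm z)\<^sup>2) :: complex)"
    by (simp only: cinner_self) simp
  then have "(norm (crefl c v z))\<^sup>2 = (norm z)\<^sup>2" by (simp only: of_real_eq_iff)
  then show ?thesis by simp
qed

lemma linear_crefl: "linear (crefl c v)"
proof (rule linearI)
  show "crefl c v (x + y) = crefl c v x + crefl c v y" for x y
    by (simp add: crefl_def cinner_add_left algebra_simps vec_eq_iff)
  have "cinner (a *\<^sub>R x) v = a *\<^sub>R cinner x v" for a x
    by (simp add: cinner_def scaleR_sum_right)
  then show "crefl c v (a *\<^sub>R x) = a *\<^sub>R crefl c v x" for a x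
    by (simp add: crefl_def vec_eq_iff scaleR_add_right)
qed

lemma crefl_coord: "\<exists>u. \<forall>z. (crefl c v z :: complex ^ 'n::finite) $ j = (\<Sum>k\<in>UNIV. u k * z $ k)"
proof (intro exI allI)
  fix z :: "complex ^ 'n"
  have 1: "(\<Sum>k\<in>UNIV. (if k = j then 1 else 0) * z $ k) = z $ j"
    by (subst sum.cong[OF refl, of _ _ "\<lambda>k. if k = j then z $ k else 0"]) auto
  have 2: "(\<Sum>k\<in>UNIV. (c - 1) * cnj (v $ k) * v $ j * z $ k) = (c - 1) * cinner z v * v $ j"
    by (simp add: cinner_def sum_distrib_left sum_distrib_right mult_ac)
  show "crefl c v z $ j = (\<Sum>k\<in>UNIV. ((if k = j then 1 else 0) + (c - 1) * cnj (v $ k) * v $ j) * z $ k)"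
    by (simp only: distrib_right sum.distrib 1 2) (simp add: crefl_def)
qed

lemma bihom_crefl: "bihom m n f \<Longrightarrow> bihom m n (\<lambda>z. f (crefl c v z))"
  by (rule bihom_linear_comp, assumption, rule crefl_coord)

lemma integral_crefl:
  fixes f :: "complex ^ 'n::finite \<Rightarrow> complex"
  assumes "norm c = 1" "norm v = 1" "continuous_on (sphere 0 1) f"
  shows "(\<integral>w. f (crefl c v w) \<partial>surface_measure) = (\<integral>w. f w \<partial>surface_measure)"
  using surface_integral_isometry[OF linear_crefl norm_crefl[OF assms(1,2)] assms(3)] .

section \<open>Infinitesimal invariance and integration by parts\<close>

lemma cmod_cinner_le:
  fixes z v :: "complex ^ 'n::finite"
  assumes "norm z = 1" "norm v = 1"
  shows "norm (cinner z v) \<le> real CARD('n)"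
proof -
  have "norm (cinner z v) \<le> (\<Sum>j\<in>(UNIV :: 'n set). norm (z $ j * cnj (v $ j)))"
    unfolding cinner_def by (rule norm_sum)
  also have "\<dots> \<le> (\<Sum>j\<in>(UNIV :: 'n set). 1 * 1)"
    using Finite_Cartesian_Product.norm_nth_le[of z] Finite_Cartesian_Product.norm_nth_le[of v] assms
    by (intro sum_mono) (simp add: norm_mult mult_le_one)
  finally show ?thesis by simp
qed

text \<open>
  The integral of \<open>f \<circ> crefl (cis t) v\<close> does not depend on \<open>t\<close>. Its derivative at 0 may be taken
  under the integral sign because polynomials are Lipschitz continuous on the ball.
\<close>

lemma integral_rotation_derivative:
  fixes f :: "complex ^ 'n::finite \<Rightarrow> complex"
  assumes f: "bihom m n f" and v: "norm v = 1"
  shows "(\<integral>z. (\<Sum>k\<in>UNIV. \<i> * cinner z v * v $ k * d_z k f z + cnj (\<i> * cinner z v * v $ k) * d_zbar k f z) \<partial>surface_measure) = 0"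
proof -
  define t :: "nat \<Rightarrow> real" where "t i = 1 / real (Suc i)" for i
  have t: "t i \<noteq> 0" "t i > 0" for i by (auto simp: t_def)
  have t0: "t \<longlonglongrightarrow> 0" unfolding t_def using LIMSEQ_inverse_real_of_nat by (simp add: inverse_eq_divide)
  define q where "q i = (cis (t i) - 1) / of_real (t i)" for i
  have "(cis has_vector_derivative \<i>) (at 0)"
    using has_derivative_cis[of "\<lambda>x. x" "\<lambda>x. x" 0 UNIV]
    by (auto simp: has_vector_derivative_def scaleR_conv_of_real mult.commute has_derivative_ident)
  then have cisd: "(cis has_derivative (\<lambda>h. h *\<^sub>R \<i>)) (at 0)" by (simp add: has_vector_derivative_def)
  have D: "((\<lambda>s. (g s - g 0) /\<^sub>R s) \<longlongrightarrow> D) (at 0)" if "(g has_vector_derivative D) (at 0)" for g :: "real \<Rightarrow> complex" and D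
  proof -
    have "((\<lambda>h. norm (g h - g 0 - h *\<^sub>R D) / norm h) \<longlongrightarrow> 0) (at 0)"
      using that by (simp add: has_vector_derivative_def has_derivative_at)
    then have "((\<lambda>h. norm ((g h - g 0) /\<^sub>R h - D)) \<longlongrightarrow> 0) (at 0)"
    proof (rule Lim_transform_eventually)
      show "\<forall>\<^sub>F h in at 0. norm (g h - g 0 - h *\<^sub>R D) / norm h = norm ((g h - g 0) /\<^sub>R h - D)"
        unfolding eventually_at_filter
      proof (rule always_eventually, intro allI impI)
        fix h :: real assume h: "h \<noteq> 0"
        have "(g h - g 0) /\<^sub>R h - D = (g h - g 0 - h *\<^sub>R D) /\<^sub>R h"
          using h by (simp add: scaleR_diff_right)
        then show "norm (g h - g 0 - h *\<^sub>R D) / norm h = norm ((g h - g 0) /\<^sub>R h - D)"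
          by (simp add: divide_inverse mult.commute)
      qed
    qed
    then show ?thesis by (rule LIM_zero_cancel[OF tendsto_norm_zero_cancel])
  qed
  have tat: "filterlim t (at 0) sequentially"
    using t0 t by (auto simp: filterlim_at)
  have q: "q \<longlonglongrightarrow> \<i>"
  proof -
    have "((\<lambda>s. (cis s - cis 0) /\<^sub>R s) \<longlongrightarrow> \<i>) (at 0)"
      by (rule D) (fact \<open>(cis has_vector_derivative \<i>) (at 0)\<close>)
    from filterlim_compose[OF this tat] show ?thesis
      by (simp add: q_def[abs_def] scaleR_conv_of_real divide_inverse mult.commute)
  qed
  then obtain B where B: "\<And>i. norm (q i) \<le> B"
    using convergent_imp_Bseq[of q] by (auto simp: convergent_def Bseq_def)
  obtain L where L: "L \<ge> 0" "\<And>x y. x \<in> cball 0 1 \<Longrightarrow> y \<in> cball 0 1 \<Longrightarrow> norm (f x - f y) \<le> L * norm (x - y)"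
    using bihom_lipschitz[OF f] unfolding lipschitz_bounded_def by blast
  define u where "u i z = (f (crefl (cis (t i)) v z) - f z) / of_real (t i)" for i z
  let ?D = "\<lambda>z. \<Sum>k\<in>UNIV. \<i> * cinner z v * v $ k * d_z k f z + cnj (\<i> * cinner z v * v $ k) * d_zbar k f z"
  have cont: "continuous_on (sphere 0 1) (\<lambda>z. f (crefl (cis (t i)) v z))" "continuous_on (sphere 0 1) f" for i
    using bihom_continuous[OF bihom_crefl[OF f]] bihom_continuous[OF f] by auto
  have cu: "continuous_on (sphere 0 1) (u i)" for i
    unfolding u_def using t by (intro continuous_intros cont) auto
  have cD: "continuous_on (sphere 0 1) ?D"
    unfolding cinner_def
    by (intro continuous_intros bihom_continuous[OF bihom_d_z[OF f]] bihom_continuous[OF bihom_d_zbar[OF f]])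
  have int0: "(\<integral>z. u i z \<partial>surface_measure) = 0" for i
  proof -
    have "(\<integral>z. u i z \<partial>surface_measure) = ((\<integral>z. f (crefl (cis (t i)) v z) \<partial>surface_measure) - (\<integral>z. f z \<partial>surface_measure)) / of_real (t i)"
      unfolding u_def by (simp add: Bochner_Integration.integral_diff surface_integrable_continuous cont)
    also have "\<dots> = 0" using integral_crefl[OF _ v cont(2), of "cis (t i)"] by simp
    finally show ?thesis .
  qed
  have "(\<lambda>i. \<integral>z. u i z \<partial>surface_measure) \<longlonglongrightarrow> (\<integral>z. ?D z \<partial>surface_measure)"
  proof (rule integral_dominated_convergence[where w = "\<lambda>_. L * (B * real CARD('n))"])
    show "integrable surface_measure (\<lambda>_ :: complex ^ 'n. L * (B * real CARD('n)))" by simp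
    show "AE z in surface_measure. (\<lambda>i. u i z) \<longlonglongrightarrow> ?D z"
    proof (rule AE_I2)
      fix z :: "complex ^ 'n"
      define w where "w = cinner z v *s v"
      obtain F where F: "(f has_derivative F) (at z)"
        using bihom_differentiable[OF f] by (auto simp: differentiable_def)
      have g: "((\<lambda>s. z + (cis s - 1) *s w) has_derivative (\<lambda>h. (h *\<^sub>R \<i>) *s w)) (at 0)"
      proof -
        have bl: "bounded_linear (\<lambda>c. c *s w)"
          by (rule linear_conv_bounded_linear[THEN iffD1], rule linearI)
             (auto simp: vec_eq_iff algebra_simps)
        show ?thesis
          using has_derivative_add[OF has_derivative_const bounded_linear.has_derivative[OF bl has_derivative_diff[OF cisd has_derivative_const]], of z 1]
          by simp
      qed
      have F': "(f has_derivative F) (at (z + (cis 0 - 1) *s w))" using F by simp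
      have "((\<lambda>s. f (z + (cis s - 1) *s w)) has_derivative (\<lambda>h. F ((h *\<^sub>R \<i>) *s w))) (at 0)"
        using diff_chain_at[OF g F'] by (simp add: o_def)
      moreover have "F ((h *\<^sub>R \<i>) *s w) = h *\<^sub>R F (\<i> *s w)" for h
      proof -
        have "(h *\<^sub>R \<i>) *s w = h *\<^sub>R (\<i> *s w)" by (simp add: vec_eq_iff)
        then show ?thesis using has_derivative_linear[OF F] by (simp add: linear_cmul)
      qed
      ultimately have "((\<lambda>s. f (z + (cis s - 1) *s w)) has_vector_derivative F (\<i> *s w)) (at 0)"
        by (simp add: has_vector_derivative_def)
      from filterlim_compose[OF D[OF this] tat]
      have "(\<lambda>i. u i z) \<longlonglongrightarrow> F (\<i> *s w)"
        by (simp add: u_def[abs_def] crefl_def w_def scaleR_conv_of_real divide_inverse mult.commute vector_smult_assoc)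
      also have "F (\<i> *s w) = ?D z"
        unfolding has_derivative_wirtinger[OF F] by (simp only: w_def vector_smult_component mult.assoc)
      finally show "(\<lambda>i. u i z) \<longlonglongrightarrow> ?D z" .
    qed
    show "AE z in surface_measure. norm (u i z) \<le> L * (B * real CARD('n))" for i
    proof (rule AE_I2)
      fix z :: "complex ^ 'n" assume "z \<in> space surface_measure"
      then have z: "norm z = 1" by simp
      have "norm (f (crefl (cis (t i)) v z) - f z) \<le> L * norm (crefl (cis (t i)) v z - z)"
        using z norm_crefl[of "cis (t i)" v z] v by (intro L) auto
      also have "crefl (cis (t i)) v z - z = t i *\<^sub>R ((q i * cinner z v) *s v)"
      proof (subst vec_eq_iff, rule allI)
        fix j
        show "(crefl (cis (t i)) v z - z) $ j = (t i *\<^sub>R ((q i * cinner z v) *s v)) $ j"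
          unfolding vector_scaleR_component using t(1)[of i]
          by (simp add: crefl_def q_def scaleR_conv_of_real)
      qed
      also have "norm \<dots> = t i * (norm (q i) * norm (cinner z v))"
      proof -
        have "norm (c *s v) = norm c" for c
        proof -
          have "cinner (c *s v) (c *s v) = c * cnj c"
            using v by (simp add: cinner_scale_left cinner_scale_right cinner_self[of v])
          then have "of_real ((norm (c *s v))\<^sup>2) = (of_real ((norm c)\<^sup>2) :: complex)"
            by (simp only: cinner_self complex_norm_square)
          then have "(norm (c *s v))\<^sup>2 = (norm c)\<^sup>2" by (simp only: of_real_eq_iff)
          then show ?thesis by simp
        qed
        then show ?thesis using t(2)[of i] by (simp add: norm_mult)
      qed
      finally have "norm (f (crefl (cis (t i)) v z) - f z) \<le> t i * (L * (norm (q i) * norm (cinner z v)))"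
        by (simp add: algebra_simps)
      moreover have "L * (norm (q i) * norm (cinner z v)) \<le> L * (B * real CARD('n))"
        using L(1) B[of i] cmod_cinner_le[OF z v] order_trans[OF norm_ge_zero B[of i]]
        by (intro mult_left_mono mult_mono) auto
      ultimately have "norm (f (crefl (cis (t i)) v z) - f z) \<le> t i * (L * (B * real CARD('n)))"
        using t(2)[of i] by (smt (verit) mult_left_mono)
      then show "norm (u i z) \<le> L * (B * real CARD('n))"
        using t(2)[of i] by (simp add: u_def norm_divide field_simps)
    qed
    show "?D \<in> borel_measurable surface_measure" by (rule surface_measurable_continuous[OF cD])
    show "u i \<in> borel_measurable surface_measure" for i by (rule surface_measurable_continuous[OF cu])
  qed
  then show ?thesis using int0 by (simp add: LIMSEQ_const_iff)
qed

text \<open>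
  The previous lemma says that the sesquilinear form with the matrix of these integrals vanishes on
  the diagonal; by polarization the matrix is zero.
\<close>

lemma integral_generator:
  fixes f :: "complex ^ 'n::finite \<Rightarrow> complex"
  assumes f: "bihom m n f"
  shows "(\<integral>z. z $ l * d_z k f z - cnj (z $ k) * d_zbar l f z \<partial>surface_measure) = 0"
proof -
  define M where "M l k = (\<integral>z. z $ l * d_z k f z - cnj (z $ k) * d_zbar l f z \<partial>surface_measure)" for l k
  have ci: "integrable surface_measure (\<lambda>z. z $ l * d_z k f z)" "integrable surface_measure (\<lambda>z. cnj (z $ l) * d_zbar k f z)" for k l
    by (intro surface_integrable_continuous continuous_intros bihom_continuous[OF bihom_d_z[OF f]] bihom_continuous[OF bihom_d_zbar[OF f]])+
  have Q: "(\<Sum>k\<in>UNIV. \<Sum>l\<in>UNIV. v $ k * cnj (v $ l) * M l k) = 0" if v: "norm v = 1" for v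
  proof -
    have "(\<Sum>k\<in>UNIV. \<i> * cinner z v * v $ k * d_z k f z + cnj (\<i> * cinner z v * v $ k) * d_zbar k f z)
      = (\<Sum>k\<in>UNIV. \<Sum>l\<in>UNIV. \<i> * (v $ k * cnj (v $ l)) * (z $ l * d_z k f z - cnj (z $ k) * d_zbar l f z))" for z
    proof -
      have "(\<Sum>k\<in>UNIV. \<i> * cinner z v * v $ k * d_z k f z + cnj (\<i> * cinner z v * v $ k) * d_zbar k f z)
        = (\<Sum>k\<in>UNIV. \<Sum>l\<in>UNIV. \<i> * (v $ k * cnj (v $ l)) * (z $ l * d_z k f z))
          - (\<Sum>k\<in>UNIV. \<Sum>l\<in>UNIV. \<i> * (v $ l * cnj (v $ k)) * (cnj (z $ l) * d_zbar k f z))"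
        by (simp add: cinner_def sum_distrib_left sum_distrib_right sum.distrib sum_subtractf algebra_simps sum_negf)
      also have "(\<Sum>k\<in>UNIV. \<Sum>l\<in>UNIV. \<i> * (v $ l * cnj (v $ k)) * (cnj (z $ l) * d_zbar k f z))
        = (\<Sum>k\<in>UNIV. \<Sum>l\<in>UNIV. \<i> * (v $ k * cnj (v $ l)) * (cnj (z $ k) * d_zbar l f z))"
        by (rule sum.swap)
      finally show ?thesis by (simp add: right_diff_distrib sum_subtractf)
    qed
    with integral_rotation_derivative[OF f v]
    have "(\<integral>z. (\<Sum>k\<in>UNIV. \<Sum>l\<in>UNIV. \<i> * (v $ k * cnj (v $ l)) * (z $ l * d_z k f z - cnj (z $ k) * d_zbar l f z)) \<partial>surface_measure) = 0"
      by simp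
    also have "(\<integral>z. (\<Sum>k\<in>UNIV. \<Sum>l\<in>UNIV. \<i> * (v $ k * cnj (v $ l)) * (z $ l * d_z k f z - cnj (z $ k) * d_zbar l f z)) \<partial>surface_measure)
       = (\<Sum>k\<in>UNIV. \<Sum>l\<in>UNIV. \<i> * (v $ k * cnj (v $ l)) * M l k)"
      unfolding M_def by (simp add: ci Bochner_Integration.integral_sum del: Bochner_Integration.integral_diff)
    also have "\<dots> = \<i> * (\<Sum>k\<in>UNIV. \<Sum>l\<in>UNIV. v $ k * cnj (v $ l) * M l k)"
      by (simp add: sum_distrib_left mult.assoc)
    finally show ?thesis by simp
  qed
  have diag: "M k k = 0" for k
  proof -
    have "norm (axis k 1 :: complex ^ 'n) = 1" by simp
    from Q[OF this] have "0 = (\<Sum>i\<in>UNIV. \<Sum>l\<in>UNIV. (axis k 1 :: complex ^ 'n) $ i * cnj ((axis k 1 :: complex ^ 'n) $ l) * M l i)"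
      by simp
    also have "\<dots> = (\<Sum>i\<in>UNIV. if i = k then (\<Sum>l\<in>UNIV. if l = k then M k k else 0) else 0)"
    proof (rule sum.cong[OF refl])
      fix i
      show "(\<Sum>l\<in>UNIV. (axis k 1 :: complex ^ 'n) $ i * cnj ((axis k 1 :: complex ^ 'n) $ l) * M l i) =
          (if i = k then (\<Sum>l\<in>UNIV. if l = k then M k k else 0) else 0)"
      proof (cases "i = k")
        case True
        have "(\<Sum>l\<in>UNIV. (axis k 1 :: complex ^ 'n) $ i * cnj ((axis k 1 :: complex ^ 'n) $ l) * M l i) =
          (\<Sum>l\<in>UNIV. if l = k then M k k else 0)"
          by (rule sum.cong[OF refl]) (simp add: axis_def True)
        then show ?thesis using True by simp
      qed (simp add: axis_def)
    qed
    finally show ?thesis by simp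
  qed
  have "M l k = 0"
  proof (cases "k = l")
    case False
    \<comment> \<open>Unit vectors supported on two coordinates: \<open>3/5\<close> and \<open>4/5\<close> are the legs of a right triangle
      with hypotenuse 1. Taking \<open>b\<close> real and imaginary separates the two entries.\<close>
    have *: "cnj b * M l k + b * M k l = 0" if b: "norm b = 4/5" for b
    proof -
      define v :: "complex ^ 'n" where "v = (\<chi> j. (if j = k then 3/5 else 0) + (if j = l then b else 0))"
      have "cinner v v = 1"
      proof -
        have "cinner v v = (\<Sum>j\<in>UNIV. (if j = k then 9/25 else 0) + (if j = l then b * cnj b else 0))"
          unfolding cinner_def v_def using False by (intro sum.cong refl) auto
        also have "\<dots> = 9/25 + b * cnj b" by (simp add: sum.distrib)
        also have "b * cnj b = of_real ((norm b)\<^sup>2)"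
          by (simp only: complex_norm_square)
        also have "\<dots> = 16/25"
          unfolding b by (simp add: power2_eq_square)
        finally show ?thesis by simp
      qed
      then have "norm v = 1" unfolding cinner_self
        by (metis norm_ge_zero of_real_eq_1_iff one_power2 power2_eq_iff_nonneg zero_le_one)
      from Q[OF this]
      have "0 = (\<Sum>i\<in>UNIV. \<Sum>j\<in>UNIV. v $ i * cnj (v $ j) * M j i)" by simp
      also have "\<dots> = (\<Sum>i\<in>UNIV. v $ i * (\<Sum>j\<in>UNIV. (if j = k then 3/5 * M k i else 0) + (if j = l then cnj b * M l i else 0)))"
        unfolding sum_distrib_left by (intro sum.cong refl) (auto simp: v_def algebra_simps)
      also have "\<dots> = (\<Sum>i\<in>UNIV. v $ i * (3/5 * M k i + cnj b * M l i))"
        by (simp add: sum.distrib)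
      also have "\<dots> = (\<Sum>i\<in>UNIV. (if i = k then 3/5 * (3/5 * M k k + cnj b * M l k) else 0) + (if i = l then b * (3/5 * M k l + cnj b * M l l) else 0))"
        by (intro sum.cong refl) (auto simp: v_def algebra_simps)
      also have "\<dots> = 3/5 * (cnj b * M l k + b * M k l)"
        by (simp add: sum.distrib diag algebra_simps)
      finally have "3/5 * (cnj b * M l k + b * M k l) = 0" by (rule sym)
      then show ?thesis by (subst (asm) mult_eq_0_iff) simp
    qed
    from *[of "4/5"] *[of "4/5 * \<i>"] have "M l k + M k l = 0" "M k l - M l k = 0"
      by (simp_all add: norm_mult algebra_simps flip: distrib_left right_diff_distrib)
    then show ?thesis by (simp add: algebra_simps)
  qed (simp add: diag)
  then show ?thesis by (simp add: M_def)
qed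

text \<open>
  Apply the generators of \<open>integral_generator\<close> with \<open>l = i\<close> and \<open>k = j\<close> to \<open>z\<^sub>j F\<close> and
  sum over \<open>j\<close>. Euler's identity evaluates the first terms, and \<open>\<Sum>\<^sub>j \<bar>z\<^sub>j\<bar>\<^sup>2 = 1\<close> the second ones.
\<close>

lemma integral_by_parts_zbar:
  fixes F :: "complex ^ 'n::finite \<Rightarrow> complex"
  assumes F: "bihom a b F"
  shows "(\<integral>z. d_zbar i F z \<partial>surface_measure) = of_nat (a + CARD('n)) * (\<integral>z. z $ i * F z \<partial>surface_measure)"
proof -
  have ci: "integrable surface_measure (\<lambda>z. d_zbar i F z)" "integrable surface_measure (\<lambda>z. z $ i * F z)"
    by (intro surface_integrable_continuous continuous_intros bihom_continuous[OF F] bihom_continuous[OF bihom_d_zbar[OF F]])+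
  have b: "bihom (Suc a) b (\<lambda>z. z $ j * F z)" for j by (rule bihom.mult_z[OF F])
  have ci': "integrable surface_measure (\<lambda>z. z $ i * d_z j (\<lambda>z. z $ j * F z) z)"
     "integrable surface_measure (\<lambda>z. cnj (z $ j) * d_zbar i (\<lambda>z. z $ j * F z) z)" for j
    by (intro surface_integrable_continuous continuous_intros bihom_continuous[OF bihom_d_z[OF b]] bihom_continuous[OF bihom_d_zbar[OF b]])+
  have "0 = (\<Sum>j\<in>UNIV. \<integral>z. z $ i * d_z j (\<lambda>z. z $ j * F z) z - cnj (z $ j) * d_zbar i (\<lambda>z. z $ j * F z) z \<partial>surface_measure)"
    by (simp only: integral_generator[OF b] sum.neutral_const)
  also have "\<dots> = (\<integral>z. (\<Sum>j\<in>UNIV. z $ i * d_z j (\<lambda>z. z $ j * F z) z - cnj (z $ j) * d_zbar i (\<lambda>z. z $ j * F z) z) \<partial>surface_measure)"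
    using ci' by (subst Bochner_Integration.integral_sum) auto
  also have "\<dots> = (\<integral>z. of_nat (a + CARD('n)) * (z $ i * F z) - d_zbar i F z \<partial>surface_measure)"
  proof (rule Bochner_Integration.integral_cong[OF refl])
    fix z :: "complex ^ 'n" assume "z \<in> space surface_measure"
    then have "cinner z z = 1" by (simp add: cinner_self)
    then have z: "(\<Sum>j\<in>UNIV. cnj (z $ j) * z $ j) = 1" by (simp add: cinner_def mult.commute)
    have "(\<Sum>j\<in>UNIV. z $ i * d_z j (\<lambda>z. z $ j * F z) z - cnj (z $ j) * d_zbar i (\<lambda>z. z $ j * F z) z)
      = (\<Sum>j\<in>UNIV. z $ i * F z + z $ i * (z $ j * d_z j F z) - (cnj (z $ j) * z $ j) * d_zbar i F z)"
    proof (rule sum.cong[OF refl])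
      fix j
      have 1: "d_z j (\<lambda>z. z $ j * F z) z = F z + z $ j * d_z j F z"
        "d_zbar i (\<lambda>z. z $ j * F z) z = z $ j * d_zbar i F z"
        by (simp_all add: d_mult[OF coord_differentiable bihom_differentiable[OF F]] d_coord)
      show "z $ i * d_z j (\<lambda>z. z $ j * F z) z - cnj (z $ j) * d_zbar i (\<lambda>z. z $ j * F z) z =
          z $ i * F z + z $ i * (z $ j * d_z j F z) - (cnj (z $ j) * z $ j) * d_zbar i F z"
        by (simp only: 1 distrib_left mult.assoc)
    qed
    also have "\<dots> = of_nat (CARD('n)) * (z $ i * F z) + z $ i * (of_nat a * F z) - d_zbar i F z"
      by (simp add: sum.distrib sum_subtractf euler_z[OF F] z flip: sum_distrib_left sum_distrib_right)
    finally show "(\<Sum>j\<in>UNIV. z $ i * d_z j (\<lambda>z. z $ j * F z) z - cnj (z $ j) * d_zbar i (\<lambda>z. z $ j * F z) z)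
      = of_nat (a + CARD('n)) * (z $ i * F z) - d_zbar i F z"
      by (simp add: algebra_simps)
  qed
  also have "\<dots> = of_nat (a + CARD('n)) * (\<integral>z. z $ i * F z \<partial>surface_measure) - (\<integral>z. d_zbar i F z \<partial>surface_measure)"
    using ci by simp
  finally show ?thesis by simp
qed

section \<open>Inner product on continuous functions on the sphere\<close>

definition sip :: "(complex ^ 'n::finite \<Rightarrow> complex) \<Rightarrow> (complex ^ 'n \<Rightarrow> complex) \<Rightarrow> complex" where
  "sip f g = (\<integral>z. f z * cnj (g z) \<partial>surface_measure)"

text \<open>
  Members vanish off the sphere, so that \<open>sip\<close> is positive definite on this space and equality of
  functions is equality on the sphere.
\<close>

definition sphere_cont :: "(complex ^ 'n::finite \<Rightarrow> complex) set" where
  "sphere_cont = {f. continuous_on (sphere 0 1) f \<and> (\<forall>z. z \<notin> sphere 0 1 \<longrightarrow> f z = 0)}"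

definition orthonormal :: "(complex ^ 'n::finite \<Rightarrow> complex) set \<Rightarrow> bool" where
  "orthonormal E \<longleftrightarrow> E \<subseteq> sphere_cont \<and> (\<forall>e\<in>E. \<forall>e'\<in>E. sip e e' = (if e = e' then 1 else 0))"

lemma subspace_sphere_cont: "cfun.subspace sphere_cont"
  by (rule cfun.subspaceI) (auto simp: sphere_cont_def intro!: continuous_intros)

lemma sphere_contD: "f \<in> sphere_cont \<Longrightarrow> continuous_on (sphere 0 1) f"
  by (simp add: sphere_cont_def)

lemma cont_integrable2:
  fixes f g :: "complex ^ 'n::finite \<Rightarrow> complex"
  shows "continuous_on (sphere 0 1) f \<Longrightarrow> continuous_on (sphere 0 1) g \<Longrightarrow>
     integrable surface_measure (\<lambda>z. f z * cnj (g z))"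
  by (intro surface_integrable_continuous continuous_intros)

lemma sip_cong:
  "(\<And>z. z \<in> sphere 0 1 \<Longrightarrow> f z = f' z) \<Longrightarrow> (\<And>z. z \<in> sphere 0 1 \<Longrightarrow> g z = g' z) \<Longrightarrow> sip f g = sip f' g'"
  unfolding sip_def by (rule Bochner_Integration.integral_cong) auto

lemma sip_cnj: "cnj (sip f g) = sip g f"
  unfolding sip_def by (subst Bochner_Integration.integral_cnj[symmetric]) (simp add: mult.commute)

lemma sip_sum_left:
  assumes "\<And>i. i \<in> I \<Longrightarrow> continuous_on (sphere 0 1) (f i)" "continuous_on (sphere 0 1) g"
  shows "sip (\<lambda>z. \<Sum>i\<in>I. c i * f i z) g = (\<Sum>i\<in>I. c i * sip (f i) g)"
proof -
  have "sip (\<lambda>z. \<Sum>i\<in>I. c i * f i z) g = (\<integral>z. (\<Sum>i\<in>I. c i * (f i z * cnj (g z))) \<partial>surface_measure)"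
    unfolding sip_def by (rule Bochner_Integration.integral_cong) (auto simp: sum_distrib_right mult.assoc)
  also have "\<dots> = (\<Sum>i\<in>I. \<integral>z. c i * (f i z * cnj (g z)) \<partial>surface_measure)"
    by (intro Bochner_Integration.integral_sum integrable_mult_right cont_integrable2 assms)
  finally show ?thesis by (simp add: sip_def)
qed

lemma sip_sum_right:
  assumes "\<And>i. i \<in> I \<Longrightarrow> continuous_on (sphere 0 1) (f i)" "continuous_on (sphere 0 1) g"
  shows "sip g (\<lambda>z. \<Sum>i\<in>I. c i * f i z) = (\<Sum>i\<in>I. cnj (c i) * sip g (f i))"
proof -
  have "cnj (sip (\<lambda>z. \<Sum>i\<in>I. c i * f i z) g) = (\<Sum>i\<in>I. cnj (c i) * cnj (sip (f i) g))"
    using assms by (simp add: sip_sum_left)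
  then show ?thesis by (simp add: sip_cnj)
qed

lemma sip_diff_left:
  assumes "continuous_on (sphere 0 1) f" "continuous_on (sphere 0 1) f'" "continuous_on (sphere 0 1) g"
  shows "sip (\<lambda>z. f z - f' z) g = sip f g - sip f' g"
  unfolding sip_def using assms by (simp add: left_diff_distrib cont_integrable2)

lemma sip_cmult_left: "sip (\<lambda>z. c * f z) g = c * sip f g"
  unfolding sip_def by (simp add: mult.assoc)

lemma sip_cmult_right: "sip g (\<lambda>z. c * f z) = cnj c * sip g f"
  unfolding sip_def by (simp add: mult.left_commute)

lemma sip_self: "sip f f = of_real (\<integral>z. (norm (f z))\<^sup>2 \<partial>surface_measure)"
  unfolding sip_def by (simp only: complex_norm_square[symmetric] integral_complex_of_real)

lemma sip_self_Re: "Re (sip f f) \<ge> 0" "sip f f = of_real (Re (sip f f))"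
  by (simp_all add: sip_self)

lemma sip_eq_0:
  assumes f: "continuous_on (sphere 0 1) f" and "sip f f = 0" and z: "z \<in> sphere 0 1"
  shows "f z = 0"
proof -
  have i: "integrable surface_measure (\<lambda>z. (norm (f z))\<^sup>2)"
    by (intro surface_integrable_continuous continuous_intros f)
  have "(\<integral>z. (norm (f z))\<^sup>2 \<partial>surface_measure) = 0"
    using assms(2) by (simp only: sip_self of_real_eq_0_iff)
  then have "AE z in surface_measure. (norm (f z))\<^sup>2 = 0"
    using i by (subst (asm) integral_nonneg_eq_0_iff_AE) auto
  then have "AE z in surface_measure. f z = 0" by simp
  then show ?thesis using surface_AE_zero_continuous f z by blast
qed

lemma sphere_cont_eq_0: "f \<in> sphere_cont \<Longrightarrow> sip f f = 0 \<Longrightarrow> f = 0"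
  by (rule ext) (use sip_eq_0[of f] in \<open>auto simp: sphere_cont_def\<close>)

lemma sphere_cont_normalize:
  assumes g: "g \<in> sphere_cont" "g \<noteq> 0"
  obtains c where "c \<noteq> 0" "(\<lambda>z. c * g z) \<in> sphere_cont" "sip (\<lambda>z. c * g z) (\<lambda>z. c * g z) = 1"
proof
  define N where "N = sqrt (Re (sip g g))"
  have "sip g g \<noteq> 0" using sphere_cont_eq_0 g by blast
  then have "Re (sip g g) > 0" using sip_self_Re[of g] by (metis less_eq_real_def of_real_0)
  then have N: "N > 0" "of_real (N\<^sup>2) = sip g g" using sip_self_Re(2)[of g] by (auto simp: N_def)
  show "(\<lambda>z. inverse (of_real N) * g z) \<in> sphere_cont"
    by (rule cfun.subspace_scale[OF subspace_sphere_cont g(1)])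
  show "sip (\<lambda>z. inverse (of_real N) * g z) (\<lambda>z. inverse (of_real N) * g z) = 1"
    unfolding sip_cmult_left sip_cmult_right using N by (simp add: field_simps power2_eq_square flip: N(2))
  show "inverse (of_real N) \<noteq> (0 :: complex)" using N(1) by simp
qed

lemma sum_fun_apply: "(\<Sum>i\<in>I. f i) z = (\<Sum>i\<in>I. f i z)"
  by (induction I rule: infinite_finite_induct) auto

lemma cfun_sum_in_span: "(\<And>e. e \<in> E \<Longrightarrow> g e \<in> cfun.span B) \<Longrightarrow> (\<lambda>z. \<Sum>e\<in>E. c e * g e z) \<in> cfun.span B"
proof -
  assume "\<And>e. e \<in> E \<Longrightarrow> g e \<in> cfun.span B"
  then have "(\<Sum>e\<in>E. (\<lambda>z. c e * g e z)) \<in> cfun.span B"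
    by (intro cfun.span_sum cfun.span_scale)
  also have "(\<Sum>e\<in>E. (\<lambda>z. c e * g e z)) = (\<lambda>z. \<Sum>e\<in>E. c e * g e z)"
    by (simp add: fun_eq_iff sum_fun_apply)
  finally show ?thesis .
qed

lemma orthonormalD: "orthonormal E \<Longrightarrow> e \<in> E \<Longrightarrow> continuous_on (sphere 0 1) e"
  by (auto simp: orthonormal_def sphere_cont_def)

lemma orthonormal_sip: "orthonormal E \<Longrightarrow> e \<in> E \<Longrightarrow> e' \<in> E \<Longrightarrow> sip e e' = (if e = e' then 1 else 0)"
  by (auto simp: orthonormal_def)

lemma orthonormal_coeff:
  assumes E: "finite E" "orthonormal E" and e: "e \<in> E"
  shows "sip (\<lambda>z. \<Sum>e\<in>E. c e * e z) e = c e"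
proof -
  have "sip (\<lambda>z. \<Sum>e\<in>E. c e * e z) e = (\<Sum>e'\<in>E. c e' * sip e' e)"
    using orthonormalD[OF E(2)] e by (intro sip_sum_left) auto
  also have "\<dots> = (\<Sum>e'\<in>E. if e' = e then c e else 0)"
    using orthonormal_sip[OF E(2)] e by (intro sum.cong) auto
  finally show ?thesis using E e by simp
qed

lemma orthonormal_span:
  assumes E: "finite E" "orthonormal E"
  shows "f \<in> cfun.span E \<longleftrightarrow> f = (\<lambda>z. \<Sum>e\<in>E. sip f e * e z)"
proof
  assume "f \<in> cfun.span E"
  then obtain c where "f = (\<Sum>e\<in>E. (\<lambda>z. c e * e z))"
    using E by (auto simp: cfun.span_finite)
  then have f: "f = (\<lambda>z. \<Sum>e\<in>E. c e * e z)" by (simp add: fun_eq_iff sum_fun_apply)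
  show "f = (\<lambda>z. \<Sum>e\<in>E. sip f e * e z)"
    unfolding f using orthonormal_coeff[OF E, of _ c] by (intro ext sum.cong) auto
next
  assume "f = (\<lambda>z. \<Sum>e\<in>E. sip f e * e z)"
  then show "f \<in> cfun.span E" using cfun_sum_in_span[of E "\<lambda>e. e" E "sip f"] by (auto simp: cfun.span_base)
qed

lemma orthonormal_independent:
  assumes E: "finite E" "orthonormal E"
  shows "cfun.independent E"
proof (rule cfun.independent_if_scalars_zero[OF E(1)])
  fix c e assume "(\<Sum>x\<in>E. (\<lambda>z. c x * x z)) = 0" and e: "e \<in> E"
  then have "(\<lambda>z. \<Sum>e\<in>E. c e * e z) = (\<lambda>z. 0)" by (simp add: fun_eq_iff sum_fun_apply)
  then have "c e = sip (\<lambda>z. 0) e" using orthonormal_coeff[OF E e, of c] by simp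
  then show "c e = 0" by (simp add: sip_def)
qed

lemma orthonormal_card: "finite E \<Longrightarrow> orthonormal E \<Longrightarrow> card E = cfun.dim (cfun.span E)"
  by (simp add: orthonormal_independent cfun.dim_eq_card_independent)

lemma span_sphere_cont: "E \<subseteq> sphere_cont \<Longrightarrow> cfun.span E \<subseteq> sphere_cont"
  by (rule cfun.span_minimal[OF _ subspace_sphere_cont])

lemma orthonormal_basis_span:
  assumes "finite B" "B \<subseteq> sphere_cont"
  shows "\<exists>E. finite E \<and> orthonormal E \<and> cfun.span E = cfun.span B"
  using assms
proof (induction B rule: finite_induct)
  case empty
  show ?case by (rule exI[of _ "{}"]) (simp add: orthonormal_def)
next
  case (insert b B)
  then obtain E where E: "finite E" "orthonormal E" "cfun.span E = cfun.span B" by auto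
  have b: "b \<in> sphere_cont" "continuous_on (sphere 0 1) b" using insert by (auto simp: sphere_cont_def)
  have spanB: "cfun.span (insert b B) = cfun.span (insert b E)"
    unfolding cfun.span_insert E(3) ..
  show ?case
  proof (cases "b \<in> cfun.span E")
    case True
    then have "cfun.span (insert b B) = cfun.span E"
      unfolding spanB by (rule cfun.span_redundant)
    then show ?thesis using E by blast
  next
    case False
    define p where "p = (\<lambda>z. \<Sum>e\<in>E. sip b e * e z)"
    define g where "g = b - p"
    have p: "p \<in> cfun.span E" unfolding p_def by (intro cfun_sum_in_span cfun.span_base)
    have Esc: "E \<subseteq> sphere_cont" using E(2) by (simp add: orthonormal_def)
    have psc: "p \<in> sphere_cont" using p span_sphere_cont[OF Esc] by blast
    have gsc: "g \<in> sphere_cont" unfolding g_def using cfun.subspace_diff[OF subspace_sphere_cont b(1) psc] .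
    have g0: "sip g e = 0" "sip e g = 0" if e: "e \<in> E" for e
    proof -
      have "g = (\<lambda>z. b z - p z)" by (simp add: g_def fun_eq_iff)
      then have "sip g e = sip b e - sip p e"
        using sip_diff_left[OF b(2) sphere_contD[OF psc] orthonormalD[OF E(2) e]] by simp
      also have "sip p e = sip b e" unfolding p_def by (rule orthonormal_coeff[OF E(1,2) e])
      finally show "sip g e = 0" by simp
      then show "sip e g = 0" using sip_cnj[of g e] by simp
    qed
    have "g \<noteq> 0" using False p by (auto simp: g_def)
    from sphere_cont_normalize[OF gsc this] obtain c where c: "c \<noteq> 0" "(\<lambda>z. c * g z) \<in> sphere_cont"
      "sip (\<lambda>z. c * g z) (\<lambda>z. c * g z) = 1" .
    define u where "u = (\<lambda>z. c * g z)"
    have usc: "u \<in> sphere_cont" and uu: "sip u u = 1" using c by (simp_all add: u_def)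
    have ue: "sip u e = 0" "sip e u = 0" if "e \<in> E" for e
      unfolding u_def sip_cmult_left sip_cmult_right using g0[OF that] by simp_all
    have "orthonormal (insert u E)"
      using E(2) usc uu ue by (fastforce simp: orthonormal_def)
    moreover have "cfun.span (insert u E) = cfun.span (insert b B)"
    proof -
      have "b = (\<lambda>z. inverse c * u z) + p" using c(1) by (simp add: u_def g_def fun_eq_iff)
      moreover have "(\<lambda>z. inverse c * u z) + p \<in> cfun.span (insert u E)"
      proof (intro cfun.span_add)
        show "(\<lambda>z. inverse c * u z) \<in> cfun.span (insert u E)"
          by (intro cfun.span_scale cfun.span_base) simp
        show "p \<in> cfun.span (insert u E)"
          using p cfun.span_mono[of E "insert u E"] by auto
      qed
      ultimately have 1: "insert b E \<subseteq> cfun.span (insert u E)"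
        by (auto intro: cfun.span_base)
      have "u \<in> cfun.span (insert b E)"
        unfolding u_def g_def
      proof (intro cfun.span_scale cfun.span_diff)
        show "b \<in> cfun.span (insert b E)" by (intro cfun.span_base) simp
        show "p \<in> cfun.span (insert b E)"
          using p cfun.span_mono[of E "insert b E"] by auto
      qed
      then have 2: "insert u E \<subseteq> cfun.span (insert b E)" by (auto intro: cfun.span_base)
      show ?thesis unfolding spanB using 1 2 by (metis cfun.span_eq)
    qed
    ultimately show ?thesis using E(1) by blast
  qed
qed

lemma orthonormal_basis_subspace:
  assumes V: "cfun.subspace V" "V \<subseteq> cfun.span B" "finite B" "V \<subseteq> sphere_cont"
  shows "\<exists>E. finite E \<and> orthonormal E \<and> cfun.span E = V"
proof -
  obtain B' where B': "B' \<subseteq> V" "cfun.independent B'" "V \<subseteq> cfun.span B'"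
    using cfun.basis_exists by metis
  have "finite B'"
    using cfun.independent_span_bound[OF V(3) B'(2)] B'(1) V(2) by auto
  moreover have "cfun.span B' = V"
    using B' V(1) by (metis cfun.span_minimal subset_antisym)
  ultimately show ?thesis using orthonormal_basis_span[of B'] B'(1) V(4) by auto
qed

lemma orthonormal_norm_sum:
  assumes E: "finite E" "orthonormal E"
  shows "sip (\<lambda>z. \<Sum>e\<in>E. c e * e z) (\<lambda>z. \<Sum>e\<in>E. b e * e z) = (\<Sum>e\<in>E. c e * cnj (b e))"
proof -
  have "continuous_on (sphere 0 1) (\<lambda>z. \<Sum>e\<in>E. c e * e z)"
    by (intro continuous_intros orthonormalD[OF E(2)])
  then have "sip (\<lambda>z. \<Sum>e\<in>E. c e * e z) (\<lambda>z. \<Sum>e\<in>E. b e * e z) = (\<Sum>e\<in>E. cnj (b e) * sip (\<lambda>z. \<Sum>e\<in>E. c e * e z) e)"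
    using orthonormalD[OF E(2)] by (intro sip_sum_right)
  also have "\<dots> = (\<Sum>e\<in>E. c e * cnj (b e))"
    using orthonormal_coeff[OF E] by (intro sum.cong) auto
  finally show ?thesis .
qed

lemma bessel:
  assumes E: "finite E" "orthonormal E" and g: "continuous_on (sphere 0 1) g"
  shows "(\<Sum>e\<in>E. (norm (sip g e))\<^sup>2) \<le> Re (sip g g)"
proof -
  define p where "p = (\<lambda>z. \<Sum>e\<in>E. sip g e * e z)"
  have p: "continuous_on (sphere 0 1) p"
    unfolding p_def by (intro continuous_intros orthonormalD[OF E(2)])
  define S where "S = (\<Sum>e\<in>E. (norm (sip g e))\<^sup>2)"
  have S: "of_real S = (\<Sum>e\<in>E. sip g e * cnj (sip g e))"
    unfolding S_def of_real_sum complex_norm_square ..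
  have pp: "sip p p = of_real S"
    unfolding p_def S by (rule orthonormal_norm_sum[OF E])
  have gp: "sip g p = of_real S"
    unfolding p_def S using sip_sum_right[OF orthonormalD[OF E(2)] g, of E "\<lambda>e. e" "sip g"] by (simp add: mult.commute)
  have pg: "sip p g = of_real S" using gp sip_cnj[of g p] by simp
  have "sip (\<lambda>z. g z - p z) (\<lambda>z. g z - p z) = sip g (\<lambda>z. g z - p z) - sip p (\<lambda>z. g z - p z)"
    by (intro sip_diff_left continuous_intros g p)
  also have "sip g (\<lambda>z. g z - p z) = cnj (sip (\<lambda>z. g z - p z) g)" by (simp add: sip_cnj)
  also have "\<dots> = sip g g - of_real S"
    using sip_diff_left[OF g p g] by (simp add: pg sip_cnj)
  also have "sip p (\<lambda>z. g z - p z) = cnj (sip (\<lambda>z. g z - p z) p)" by (simp add: sip_cnj)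
  also have "\<dots> = 0" using sip_diff_left[OF g p p] by (simp add: pp gp)
  finally have "Re (sip g g) - S = Re (sip (\<lambda>z. g z - p z) (\<lambda>z. g z - p z))" by simp
  then show ?thesis using sip_self_Re(1)[of "\<lambda>z. g z - p z"] by (simp add: S_def)
qed

section \<open>Underdetermined systems\<close>

lemma underdetermined_solution:
  fixes c :: "'j \<Rightarrow> 'e \<Rightarrow> complex"
  assumes "finite J" "finite E" "card J < card E"
  shows "\<exists>x. (\<exists>e\<in>E. x e \<noteq> 0) \<and> (\<forall>j\<in>J. (\<Sum>e\<in>E. c j e * x e) = 0)"
  using assms
proof (induction J arbitrary: E c rule: finite_induct)
  case empty
  then obtain e where "e \<in> E" by (metis card.empty card_gt_0_iff ex_in_conv)
  then show ?case by (intro exI[of _ "\<lambda>_. 1"]) auto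
next
  case (insert j J)
  show ?case
  proof (cases "\<forall>e\<in>E. c j e = 0")
    case True
    have "card J < card E" using insert by simp
    from insert.IH[OF insert.prems(1) this] obtain x where
      "\<exists>e\<in>E. x e \<noteq> 0" "\<forall>i\<in>J. (\<Sum>e\<in>E. c i e * x e) = 0" by blast
    then show ?thesis using True by (intro exI[of _ x]) auto
  next
    case False
    then obtain a where a: "a \<in> E" "c j a \<noteq> 0" by blast
    \<comment> \<open>Solve the equation \<open>j\<close> for \<open>x a\<close> and eliminate it from the others.\<close>
    have "card J < card (E - {a})" using insert a by simp
    from insert.IH[OF _ this, of "\<lambda>i e. c i e - c i a * c j e / c j a"] insert.prems(1)
    obtain x where x: "\<exists>e\<in>E - {a}. x e \<noteq> 0"
      "\<forall>i\<in>J. (\<Sum>e\<in>E - {a}. (c i e - c i a * c j e / c j a) * x e) = 0" by auto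
    define s where "s = (\<Sum>e\<in>E - {a}. c j e * x e)"
    define y where "y = x(a := - s / c j a)"
    have split: "(\<Sum>e\<in>E. c i e * y e) = c i a * y a + (\<Sum>e\<in>E - {a}. c i e * x e)" for i
    proof -
      have "(\<Sum>e\<in>E. c i e * y e) = c i a * y a + (\<Sum>e\<in>E - {a}. c i e * y e)"
        using insert.prems(1) a(1) by (rule sum.remove)
      also have "(\<Sum>e\<in>E - {a}. c i e * y e) = (\<Sum>e\<in>E - {a}. c i e * x e)"
        by (intro sum.cong) (auto simp: y_def)
      finally show ?thesis .
    qed
    have "(\<Sum>e\<in>E. c j e * y e) = 0"
      using a(2) by (simp add: split flip: s_def) (simp add: y_def)
    moreover have "(\<Sum>e\<in>E. c i e * y e) = 0" if "i \<in> J" for i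
    proof -
      have "0 = (\<Sum>e\<in>E - {a}. c i e * x e) - c i a / c j a * s"
        using x(2) that by (simp add: s_def left_diff_distrib sum_subtractf sum_distrib_left mult.assoc)
      then show ?thesis by (subst split) (simp add: y_def)
    qed
    moreover have "\<exists>e\<in>E. y e \<noteq> 0" using x(1) by (auto simp: y_def)
    ultimately show ?thesis by (intro exI[of _ y]) auto
  qed
qed

text \<open>
  The functions are found one after the other: the linear conditions and orthogonality to those
  already found are fewer than \<open>card E\<close> equations for the coefficients of the next one.
\<close>

lemma orthonormal_in_kernel:
  fixes c :: "'j \<Rightarrow> (complex ^ 'n::finite \<Rightarrow> complex) \<Rightarrow> complex"
  assumes E: "finite E" "orthonormal E" and J: "finite J" and "m + card J \<le> card E"
  shows "\<exists>D. finite D \<and> card D = m \<and> orthonormal D \<and> D \<subseteq> cfun.span E \<and>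
     (\<forall>d\<in>D. \<forall>j\<in>J. (\<Sum>e\<in>E. c j e * sip d e) = 0)"
  using assms(4)
proof (induction m)
  case 0
  show ?case by (rule exI[of _ "{}"]) (simp add: orthonormal_def)
next
  case (Suc m)
  then obtain D where D: "finite D" "card D = m" "orthonormal D" "D \<subseteq> cfun.span E"
     "\<forall>d\<in>D. \<forall>j\<in>J. (\<Sum>e\<in>E. c j e * sip d e) = 0" by auto
  define C where "C k e = (case k of Inl j \<Rightarrow> c j e | Inr d \<Rightarrow> sip e d)" for k e
  have "card (J <+> D) < card E" using Suc.prems D J by (simp add: card_Plus)
  then obtain x where x: "\<exists>e\<in>E. x e \<noteq> 0" "\<forall>k\<in>J <+> D. (\<Sum>e\<in>E. C k e * x e) = 0"
    using underdetermined_solution[of "J <+> D" E C] J D(1) E(1) by auto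
  define g where "g = (\<lambda>z. \<Sum>e\<in>E. x e * e z)"
  have gx: "sip g e = x e" if "e \<in> E" for e
    unfolding g_def by (rule orthonormal_coeff[OF E that])
  have gs: "g \<in> cfun.span E" unfolding g_def by (intro cfun_sum_in_span cfun.span_base)
  have Esc: "E \<subseteq> sphere_cont" using E(2) by (simp add: orthonormal_def)
  have gsc: "g \<in> sphere_cont" using gs span_sphere_cont[OF Esc] by blast
  have gd: "sip g d = 0" "sip d g = 0" if d: "d \<in> D" for d
  proof -
    have "sip g d = (\<Sum>e\<in>E. x e * sip e d)"
      unfolding g_def using orthonormalD[OF E(2)] orthonormalD[OF D(3) d] by (intro sip_sum_left)
    also have "\<dots> = 0" using x(2) d by (force simp: C_def mult.commute)
    finally show "sip g d = 0" .
    then show "sip d g = 0" using sip_cnj[of g d] by simp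
  qed
  have "g \<noteq> 0"
  proof
    assume "g = 0"
    then have "sip g e = 0" for e by (simp add: sip_def)
    then show False using gx x(1) by auto
  qed
  from sphere_cont_normalize[OF gsc this] obtain b where b: "(\<lambda>z. b * g z) \<in> sphere_cont"
    "sip (\<lambda>z. b * g z) (\<lambda>z. b * g z) = 1" by metis
  define u where "u = (\<lambda>z. b * g z)"
  have usc: "u \<in> sphere_cont" and uu: "sip u u = 1" using b by (simp_all add: u_def)
  have ud: "sip u d = 0" "sip d u = 0" if "d \<in> D" for d
    unfolding u_def sip_cmult_left sip_cmult_right using gd[OF that] by simp_all
  have "u \<notin> D" using ud uu by force
  have on: "orthonormal (insert u D)"
    using D(3) usc uu ud by (fastforce simp: orthonormal_def)
  have us: "u \<in> cfun.span E" unfolding u_def by (rule cfun.span_scale[OF gs])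
  have uc: "(\<Sum>e\<in>E. c j e * sip u e) = 0" if "j \<in> J" for j
  proof -
    have "(\<Sum>e\<in>E. c j e * sip u e) = b * (\<Sum>e\<in>E. c j e * x e)"
      unfolding u_def sip_cmult_left sum_distrib_left using gx by (intro sum.cong) auto
    also have "(\<Sum>e\<in>E. c j e * x e) = 0" using x(2) that by (force simp: C_def)
    finally show ?thesis by simp
  qed
  show ?case
    using D \<open>u \<notin> D\<close> on us uc by (intro exI[of _ "insert u D"]) auto
qed

section \<open>Orthogonality of harmonic polynomials and the harmonic decomposition\<close>

definition lap :: "(complex ^ 'n::finite \<Rightarrow> complex) \<Rightarrow> complex ^ 'n \<Rightarrow> complex" where
  "lap f z = (\<Sum>i\<in>UNIV. d_z i (d_zbar i f) z)"

lemma laplacian_lap: "laplacian f z = 4 * lap f z"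
  by (simp add: laplacian_def lap_def)

lemma bihom_lap: "bihom m n f \<Longrightarrow> bihom (m - 1) (n - 1) (lap f)"
  unfolding lap_def[abs_def] by (intro bihom_sum bihom_d_z bihom_d_zbar)

lemma d_zbar_deg_0:
  assumes "bihom m 0 f" shows "d_zbar i f = (\<lambda>z. 0)"
proof -
  have "d_z i (\<lambda>z. cnj (f z)) = (\<lambda>z. 0)"
    using bihom_deriv_aux[OF bihom_cnj[OF assms]] by simp
  then show ?thesis using d_zbar_via_cnj[OF assms, of i] by (simp add: fun_eq_iff)
qed

lemma lap_deg_0:
  assumes "bihom m n f" "m = 0 \<or> n = 0" shows "lap f = (\<lambda>z. 0)"
proof -
  have "d_z i (d_zbar i f) = (\<lambda>z. 0)" for i
  proof (cases "n = 0")
    case True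
    then have "d_zbar i f = (\<lambda>z. 0)" using d_zbar_deg_0[of m f i] assms(1) by blast
    then show ?thesis by (simp only:) (rule ext, rule d_const)
  next
    case False
    then show ?thesis using assms bihom_deriv_aux[OF bihom_d_zbar[OF assms(1)]] by simp
  qed
  then show ?thesis by (simp add: lap_def fun_eq_iff)
qed

lemma integral_bihom_unbalanced:
  fixes F :: "complex ^ 'n::finite \<Rightarrow> complex"
  assumes F: "bihom a b F" and "a \<noteq> b"
  shows "(\<integral>z. F z \<partial>surface_measure) = 0"
proof -
  have ci: "integrable surface_measure (\<lambda>z. z $ k * d_z k F z)" "integrable surface_measure (\<lambda>z. cnj (z $ k) * d_zbar k F z)" for k
    by (intro surface_integrable_continuous continuous_intros bihom_continuous[OF bihom_d_z[OF F]] bihom_continuous[OF bihom_d_zbar[OF F]])+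
  have "0 = (\<Sum>k\<in>UNIV. \<integral>z. z $ k * d_z k F z - cnj (z $ k) * d_zbar k F z \<partial>surface_measure)"
    by (simp only: integral_generator[OF F] sum.neutral_const)
  also have "\<dots> = (\<integral>z. (\<Sum>k\<in>UNIV. z $ k * d_z k F z - cnj (z $ k) * d_zbar k F z) \<partial>surface_measure)"
    using ci by (subst Bochner_Integration.integral_sum) auto
  also have "\<dots> = (\<integral>z. (of_nat a - of_nat b) * F z \<partial>surface_measure)"
    by (simp only: sum_subtractf euler_z[OF F] euler_zbar[OF F] left_diff_distrib)
  also have "\<dots> = (of_nat a - of_nat b) * (\<integral>z. F z \<partial>surface_measure)" by simp
  finally show ?thesis using assms(2) by simp
qed

lemma sip_bihom_unbalanced:
  assumes "bihom m n f" "bihom m' n' g" "m + n' \<noteq> n + m'"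
  shows "sip f g = 0"
  unfolding sip_def using integral_bihom_unbalanced[OF bihom_mult[OF assms(1) bihom_cnj[OF assms(2)]] assms(3)] .

text \<open>
  Integrating by parts once relates the Dirichlet form of \<open>f\<close> and \<open>g\<close> to \<open>sip f (lap g)\<close> and, by
  Euler's identity, to a multiple of \<open>sip f g\<close>. Exchanging \<open>f\<close> and \<open>g\<close> and
  conjugating gives a second expression for the same Dirichlet form; both applications below compare
  the two.
\<close>

lemma green_identity:
  fixes f g :: "complex ^ 'n::finite \<Rightarrow> complex"
  assumes f: "bihom m n f" and g: "bihom m' n' g"
  shows "(\<Sum>i\<in>UNIV. sip (d_zbar i f) (d_zbar i g)) + sip f (lap g) =
     of_nat (m + (n' - 1) + CARD('n)) * of_nat n' * sip f g"
proof -
  let ?c = "of_nat (m + (n' - 1) + CARD('n)) :: complex"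
  note cf = bihom_continuous[OF f] and cg = bihom_continuous[OF g]
  have h: "bihom m' (n' - 1) (d_zbar i g)" for i by (rule bihom_d_zbar[OF g])
  note ch = bihom_continuous[OF h]
  have cdf: "continuous_on A (d_zbar i f)" for i A by (rule bihom_continuous[OF bihom_d_zbar[OF f]])
  have cdh: "continuous_on A (d_z i (d_zbar i g))" for i A by (rule bihom_continuous[OF bihom_d_z[OF h]])
  have eq: "sip (d_zbar i f) (d_zbar i g) + sip f (d_z i (d_zbar i g)) = ?c * sip f (\<lambda>z. cnj (z $ i) * d_zbar i g z)" for i
  proof -
    have "(\<integral>z. d_zbar i (\<lambda>z. f z * cnj (d_zbar i g z)) z \<partial>surface_measure)
       = ?c * (\<integral>z. z $ i * (f z * cnj (d_zbar i g z)) \<partial>surface_measure)"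
      by (rule integral_by_parts_zbar[OF bihom_mult[OF f bihom_cnj[OF h]]])
    also have "(\<integral>z. z $ i * (f z * cnj (d_zbar i g z)) \<partial>surface_measure) = sip f (\<lambda>z. cnj (z $ i) * d_zbar i g z)"
      unfolding sip_def by (rule Bochner_Integration.integral_cong) (auto simp: mult_ac)
    also have "(\<integral>z. d_zbar i (\<lambda>z. f z * cnj (d_zbar i g z)) z \<partial>surface_measure)
       = (\<integral>z. d_zbar i f z * cnj (d_zbar i g z) + f z * cnj (d_z i (d_zbar i g) z) \<partial>surface_measure)"
      using d_mult(2)[OF bihom_differentiable[OF f] bihom_differentiable[OF bihom_cnj[OF h]]]
        d_cnj(2)[OF bihom_differentiable[OF h]] by simp
    also have "\<dots> = sip (d_zbar i f) (d_zbar i g) + sip f (d_z i (d_zbar i g))"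
      unfolding sip_def by (intro Bochner_Integration.integral_add cont_integrable2 cf cdf ch cdh)
    finally show ?thesis .
  qed
  have "lap g = (\<lambda>z. \<Sum>i\<in>UNIV. 1 * d_z i (d_zbar i g) z)" by (simp add: lap_def fun_eq_iff)
  then have "sip f (lap g) = (\<Sum>i\<in>UNIV. sip f (d_z i (d_zbar i g)))"
    by (simp only:) (subst sip_sum_right, auto intro: cdh cf)
  then have "(\<Sum>i\<in>UNIV. sip (d_zbar i f) (d_zbar i g)) + sip f (lap g) = (\<Sum>i\<in>UNIV. ?c * sip f (\<lambda>z. cnj (z $ i) * d_zbar i g z))"
    by (simp only: eq[symmetric] sum.distrib)
  also have "\<dots> = ?c * (\<Sum>i\<in>UNIV. cnj 1 * sip f (\<lambda>z. cnj (z $ i) * d_zbar i g z))"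
    by (simp add: sum_distrib_left)
  also have "\<dots> = ?c * sip f (\<lambda>z. \<Sum>i\<in>UNIV. 1 * (cnj (z $ i) * d_zbar i g z))"
    by (subst sip_sum_right) (auto intro!: continuous_intros ch cf)
  also have "(\<lambda>z. \<Sum>i\<in>UNIV. 1 * (cnj (z $ i) * d_zbar i g z)) = (\<lambda>z. of_nat n' * g z)"
    using euler_zbar[OF g] by simp
  finally show ?thesis by (simp add: sip_cmult_right mult.assoc)
qed

text \<open>
  If \<open>m - n\<close> and \<open>m' - n'\<close> differ, phase rotations make the integral vanish. If they agree, the two
  forms of Green's identity express the same Dirichlet form as different multiples of \<open>sip f g\<close>.
\<close>

lemma harmonic_orthogonal:
  fixes f g :: "complex ^ 'n::finite \<Rightarrow> complex"
  assumes f: "bihom m n f" "lap f = (\<lambda>z. 0)" and g: "bihom m' n' g" "lap g = (\<lambda>z. 0)"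
    and ne: "(m, n) \<noteq> (m', n')"
  shows "sip f g = 0"
proof (cases "m + n' = n + m'")
  case False
  then show ?thesis by (rule sip_bihom_unbalanced[OF f(1) g(1)])
next
  case True
  have z: "sip h (\<lambda>z. 0) = 0" for h :: "complex ^ 'n \<Rightarrow> complex" by (simp add: sip_def)
  have 1: "(\<Sum>i\<in>UNIV. sip (d_zbar i f) (d_zbar i g)) = of_nat (m + (n' - 1) + CARD('n)) * of_nat n' * sip f g"
    using green_identity[OF f(1) g(1)] by (simp add: g(2) z)
  have "(\<Sum>i\<in>UNIV. sip (d_zbar i g) (d_zbar i f)) = of_nat (m' + (n - 1) + CARD('n)) * of_nat n * sip g f"
    using green_identity[OF g(1) f(1)] by (simp add: f(2) z)
  from arg_cong[OF this, of cnj]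
  have 2: "(\<Sum>i\<in>UNIV. sip (d_zbar i f) (d_zbar i g)) = of_nat (m' + (n - 1) + CARD('n)) * of_nat n * sip f g"
    by (simp add: sip_cnj)
  have "of_nat ((m + (n' - 1) + CARD('n)) * n') * sip f g = of_nat ((m' + (n - 1) + CARD('n)) * n) * sip f g"
    using trans[OF 1[symmetric] 2] by (simp only: of_nat_mult)
  moreover have "(m + (n' - 1) + CARD('n)) * n' \<noteq> (m' + (n - 1) + CARD('n)) * n"
  proof (cases "n = 0 \<or> n' = 0")
    case True
    obtain e where "CARD('n) = Suc e" using zero_less_card_finite[where 'a = 'n] gr0_implies_Suc by blast
    with True show ?thesis using ne \<open>m + n' = n + m'\<close> by auto
  next
    case False
    then have "m + (n' - 1) + CARD('n) = m' + (n - 1) + CARD('n)" "n \<noteq> n'" using True ne by auto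
    then show ?thesis by simp
  qed
  ultimately show ?thesis by (metis mult_cancel_right of_nat_eq_iff)
qed

lemma sphere_restrict_simps:
  "sphere_restrict (\<lambda>z. f z + g z) = sphere_restrict f + sphere_restrict g"
  "sphere_restrict (\<lambda>z. c * f z) = (\<lambda>z. c * sphere_restrict f z)"
  "sphere_restrict (\<lambda>z. 0) = 0"
  by (auto simp: sphere_restrict_def fun_eq_iff)

lemma sphere_restrict_cont: "bihom m n f \<Longrightarrow> sphere_restrict f \<in> sphere_cont"
  using bihom_continuous[of m n f "sphere 0 1"] continuous_on_cong[OF refl, of "sphere 0 1" "sphere_restrict f" f]
  by (auto simp: sphere_cont_def sphere_restrict_def)

lemma sip_restrict: "sip (sphere_restrict f) g = sip f g" "sip g (sphere_restrict f) = sip g f"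
  by (auto intro!: sip_cong simp: sphere_restrict_def)

definition poly_space :: "nat \<Rightarrow> (complex ^ 'n::finite \<Rightarrow> complex) set" where
  "poly_space N = cfun.span {sphere_restrict (zmonom \<alpha> \<beta>) | \<alpha> \<beta>. sum \<alpha> UNIV \<le> N \<and> sum \<beta> UNIV \<le> N}"

lemma finite_multi_index_le: "finite {\<alpha> :: 'n::finite \<Rightarrow> nat. sum \<alpha> UNIV \<le> N}"
proof -
  have "{\<alpha> :: 'n \<Rightarrow> nat. sum \<alpha> UNIV \<le> N} = (\<Union>m\<le>N. {\<alpha>. sum \<alpha> UNIV = m})" by auto
  then show ?thesis using finite_multi_index by auto
qed

lemma finite_poly_gens:
  "finite {sphere_restrict (zmonom \<alpha> \<beta>) :: complex ^ 'n::finite \<Rightarrow> complex | \<alpha> \<beta>. sum \<alpha> UNIV \<le> N \<and> sum \<beta> UNIV \<le> N}"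
proof -
  have "{sphere_restrict (zmonom \<alpha> \<beta>) :: complex ^ 'n \<Rightarrow> complex | \<alpha> \<beta>. sum \<alpha> UNIV \<le> N \<and> sum \<beta> UNIV \<le> N}
    = (\<lambda>(\<alpha>, \<beta>). sphere_restrict (zmonom \<alpha> \<beta>)) ` ({\<alpha>. sum \<alpha> UNIV \<le> N} \<times> {\<beta>. sum \<beta> UNIV \<le> N})"
    by auto
  then show ?thesis by (simp only:) (intro finite_imageI finite_cartesian_product finite_multi_index_le)
qed

lemma poly_gens_cont: "{sphere_restrict (zmonom \<alpha> \<beta>) | \<alpha> \<beta>. sum \<alpha> UNIV \<le> N \<and> sum \<beta> UNIV \<le> N} \<subseteq> sphere_cont"
  using sphere_restrict_cont[OF bihom_monom] by auto

lemma poly_space_cont: "poly_space N \<subseteq> sphere_cont"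
  unfolding poly_space_def by (rule span_sphere_cont[OF poly_gens_cont])

lemma subspace_poly_space: "cfun.subspace (poly_space N)"
  unfolding poly_space_def by (rule cfun.subspace_span)

lemma bihom_in_poly_space:
  assumes "bihom m n f" "m \<le> N" "n \<le> N"
  shows "sphere_restrict f \<in> poly_space N"
proof -
  obtain c where f: "f = (\<lambda>z. \<Sum>\<alpha> | sum \<alpha> UNIV = m. \<Sum>\<beta> | sum \<beta> UNIV = n. c \<alpha> \<beta> * zmonom \<alpha> \<beta> z)"
    by (rule bihomogeneous_expand[OF bihom_iff[THEN iffD1, OF assms(1)]])
  have "sphere_restrict f = (\<Sum>\<alpha> | sum \<alpha> UNIV = m. \<Sum>\<beta> | sum \<beta> UNIV = n. (\<lambda>z. c \<alpha> \<beta> * sphere_restrict (zmonom \<alpha> \<beta>) z))"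
    by (auto simp: f fun_eq_iff sum_fun_apply sphere_restrict_def)
  also have "\<dots> \<in> poly_space N"
    unfolding poly_space_def using assms(2,3)
    by (intro cfun.span_sum cfun.span_scale cfun.span_base) auto
  finally show ?thesis .
qed

lemma bihom_zero_if_sphere:
  fixes f :: "complex ^ 'n::finite \<Rightarrow> complex"
  assumes f: "bihom m n f" and z: "\<And>z. z \<in> sphere 0 1 \<Longrightarrow> f z = 0"
  shows "f = (\<lambda>z. 0)"
proof
  fix z :: "complex ^ 'n"
  have "\<exists>c w. norm w = 1 \<and> z = c *s w"
  proof (cases "z = 0")
    case True
    then show ?thesis by (intro exI[of _ 0] exI[of _ "axis undefined 1"]) auto
  next
    case False
    have "z = of_real (norm z) *s (sgn z)"
      unfolding vec_eq_iff sgn_div_norm vector_smult_component vector_scaleR_component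
      using False by (simp add: scaleR_conv_of_real)
    then show ?thesis using False by (metis norm_sgn)
  qed
  then obtain c w where "norm w = 1" "z = c *s w" by blast
  then show "f z = 0" using bihom_scale[OF f, of c w] z[of w] by simp
qed

text \<open>
  Let \<open>q\<close> be the orthogonal projection of \<open>f\<close>, on the sphere, onto the polynomials of bidegree
  \<open>(m, n)\<close>, and \<open>h = f - \<bar>z\<bar>\<^sup>2 q\<close>. Since \<open>h\<close> is orthogonal to all these polynomials, Green's identity
  used twice shows that \<open>lap h\<close>, itself of bidegree \<open>(m, n)\<close>, is orthogonal to itself.
\<close>

lemma bihom_decomposition:
  fixes f :: "complex ^ 'n::finite \<Rightarrow> complex"
  assumes f: "bihom (Suc m) (Suc n) f"
  obtains h q where "bihom (Suc m) (Suc n) h" "lap h = (\<lambda>z. 0)" "bihom m n q"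
    "\<And>z. z \<in> sphere 0 1 \<Longrightarrow> f z = h z + q z"
proof -
  define V :: "(complex ^ 'n \<Rightarrow> complex) set" where "V = {sphere_restrict q | q. bihom m n q}"
  have sub: "cfun.subspace V"
  proof (rule cfun.subspaceI)
    show "0 \<in> V" unfolding V_def using bihom_0[of m n] sphere_restrict_simps(3) by (metis (mono_tags) mem_Collect_eq)
    show "x + y \<in> V" if xy: "x \<in> V" "y \<in> V" for x y
    proof -
      obtain f g where fg: "bihom m n f" "bihom m n g" "x = sphere_restrict f" "y = sphere_restrict g"
        using xy by (auto simp: V_def)
      have "x + y = sphere_restrict (\<lambda>z. f z + g z)" unfolding fg by (rule sphere_restrict_simps(1)[symmetric])
      then show ?thesis unfolding V_def using bihom.add[OF fg(1,2)] by blast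
    qed
    show "(\<lambda>z. c * x z) \<in> V" if x: "x \<in> V" for c x
    proof -
      obtain f where f: "bihom m n f" "x = sphere_restrict f"
        using x by (auto simp: V_def)
      have "(\<lambda>z. c * x z) = sphere_restrict (\<lambda>z. c * f z)" unfolding f by (rule sphere_restrict_simps(2)[symmetric])
      then show ?thesis unfolding V_def using bihom_cmult[OF f(1)] by blast
    qed
  qed
  have "V \<subseteq> poly_space (max m n)" unfolding V_def using bihom_in_poly_space[of m n _ "max m n"] by auto
  then obtain E where E: "finite E" "orthonormal E" "cfun.span E = V"
    using orthonormal_basis_subspace[OF sub, of "{sphere_restrict (zmonom \<alpha> \<beta>) | \<alpha> \<beta>. sum \<alpha> UNIV \<le> max m n \<and> sum \<beta> UNIV \<le> max m n}"]
      finite_poly_gens poly_space_cont[of "max m n"] unfolding poly_space_def by blast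
  define p where "p = (\<lambda>z. \<Sum>e\<in>E. sip f e * e z)"
  have "p \<in> V" unfolding p_def E(3)[symmetric] by (intro cfun_sum_in_span cfun.span_base)
  then obtain q where q: "bihom m n q" "p = sphere_restrict q" by (auto simp: V_def)
  define h where "h = (\<lambda>z. f z - (\<Sum>j\<in>UNIV. z $ j * (cnj (z $ j) * q z)))"
  have h: "bihom (Suc m) (Suc n) h"
    unfolding h_def by (intro bihom_diff f bihom_sum bihom.mult_z bihom.mult_cnj q)
  have norm1: "(\<Sum>j\<in>UNIV. z $ j * (cnj (z $ j) * c)) = c" if "z \<in> sphere 0 1" for z :: "complex ^ 'n" and c
  proof -
    have "cinner z z = 1" using that by (simp add: cinner_self)
    then show ?thesis by (simp add: cinner_def flip: mult.assoc sum_distrib_right)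
  qed
  have hq: "f z = h z + q z" if "z \<in> sphere 0 1" for z
    using norm1[OF that] by (simp add: h_def)
  have cf: "continuous_on A f" "continuous_on A h" "continuous_on A q" for A
    using bihom_continuous f h q(1) by blast+
  have cp: "continuous_on (sphere 0 1) p"
    unfolding q(2) using sphere_contD[OF sphere_restrict_cont[OF q(1)]] .
  have orth: "sip h q' = 0" if q': "bihom m n q'" for q'
  proof -
    have "sphere_restrict q' \<in> cfun.span E" unfolding E(3) V_def using q' by blast
    then have q'E: "sphere_restrict q' = (\<lambda>z. \<Sum>e\<in>E. sip (sphere_restrict q') e * e z)"
      using orthonormal_span[OF E(1,2)] by blast
    have "sip h e = 0" if e: "e \<in> E" for e
    proof -
      have "sip h e = sip (\<lambda>z. f z - p z) e"
        using hq q(2) by (intro sip_cong) (auto simp: sphere_restrict_def)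
      also have "\<dots> = sip f e - sip p e" using sip_diff_left[OF cf(1) cp orthonormalD[OF E(2) e]] .
      also have "sip p e = sip f e" unfolding p_def by (rule orthonormal_coeff[OF E(1,2) e])
      finally show ?thesis by simp
    qed
    then have "sip h (\<lambda>z. \<Sum>e\<in>E. sip (sphere_restrict q') e * e z) = 0"
      using orthonormalD[OF E(2)] cf(2) by (subst sip_sum_right) auto
    then have "sip h (sphere_restrict q') = 0" using q'E by simp
    then show ?thesis by (simp add: sip_restrict)
  qed
  have lap_orth: "sip h (lap q') = 0" if q': "bihom m n q'" for q'
  proof (cases "m = 0 \<or> n = 0")
    case True
    then show ?thesis using lap_deg_0[OF q'] by (simp add: sip_def)
  next
    case False
    then have "bihom m n (\<lambda>z. \<Sum>j\<in>UNIV. z $ j * (cnj (z $ j) * lap q' z))"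
      using bihom.mult_z[OF bihom.mult_cnj[OF bihom_lap[OF q']]] by (intro bihom_sum) simp
    from orth[OF this] show ?thesis
      using norm1 by (subst sip_cong[of h h _ "\<lambda>z. \<Sum>j\<in>UNIV. z $ j * (cnj (z $ j) * lap q' z)"]) auto
  qed
  have "sip (lap h) (lap h) = 0"
  proof -
    have q': "bihom m n (lap h)" using bihom_lap[OF h] by simp
    have "(\<Sum>i\<in>UNIV. sip (d_zbar i h) (d_zbar i (lap h))) = 0"
      using green_identity[OF h q'] by (simp add: orth[OF q'] lap_orth[OF q'])
    from arg_cong[OF this, of cnj] have "(\<Sum>i\<in>UNIV. sip (d_zbar i (lap h)) (d_zbar i h)) = 0"
      by (simp add: sip_cnj)
    moreover have "sip (lap h) h = 0" using orth[OF q'] sip_cnj[of h "lap h"] by simp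
    ultimately show ?thesis using green_identity[OF q' h] by simp
  qed
  then have "lap h z = 0" if "z \<in> sphere 0 1" for z
    using sip_eq_0[OF bihom_continuous[OF bihom_lap[OF h]]] that by blast
  then have "lap h = (\<lambda>z. 0)" by (rule bihom_zero_if_sphere[OF bihom_lap[OF h]])
  from that[OF h this q(1) hq] show ?thesis .
qed

lemma H_alt: "H m n = {sphere_restrict f | f. bihom m n f \<and> lap f = (\<lambda>z. 0)}"
  by (auto simp: H_def bihom_iff laplacian_lap fun_eq_iff)

lemma bihom_in_T:
  assumes "bihom m n f" "m \<le> N" "n \<le> N"
  shows "sphere_restrict f \<in> T N"
  using assms
proof (induction m arbitrary: n f)
  case 0
  then have "sphere_restrict f \<in> H 0 n" using lap_deg_0 by (auto simp: H_alt)
  then show ?case unfolding T_def using 0 by (intro cfun.span_base) auto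
next
  case (Suc m)
  show ?case
  proof (cases n)
    case 0
    then have "sphere_restrict f \<in> H (Suc m) 0" using Suc.prems lap_deg_0 by (auto simp: H_alt)
    then show ?thesis unfolding T_def using Suc.prems by (intro cfun.span_base) auto
  next
    case (Suc n')
    then obtain h q where hq: "bihom (Suc m) (Suc n') h" "lap h = (\<lambda>z. 0)" "bihom m n' q"
       "\<And>z. z \<in> sphere 0 1 \<Longrightarrow> f z = h z + q z"
      using bihom_decomposition Suc.prems(1) by metis
    have "sphere_restrict q \<in> T N" using Suc.IH[OF hq(3)] Suc.prems Suc by simp
    moreover have "sphere_restrict h \<in> T N"
      unfolding T_def using hq(1,2) Suc.prems Suc by (intro cfun.span_base) (force simp: H_alt)
    moreover have "sphere_restrict f = sphere_restrict h + sphere_restrict q"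
      using hq(4) by (auto simp: sphere_restrict_def fun_eq_iff)
    ultimately show ?thesis unfolding T_def by (simp only:) (rule cfun.span_add)
  qed
qed

text \<open>
  Repeated use of \<open>bihom_decomposition\<close> writes a polynomial on the sphere as a sum of harmonic ones.
  Unlike \<open>T N\<close>, the space on the right is visibly invariant under unitary maps and multiplicative.
\<close>

lemma T_eq_poly_space: "T N = poly_space N"
proof
  show "T N \<subseteq> poly_space N"
    unfolding T_def
  proof (rule cfun.span_minimal[OF _ subspace_poly_space])
    show "(\<Union>(m, n)\<in>{(m, n). max m n \<le> N}. H m n) \<subseteq> poly_space N"
      using bihom_in_poly_space by (fastforce simp: H_alt)
  qed
  show "poly_space N \<subseteq> T N"
    unfolding poly_space_def
  proof (rule cfun.span_minimal)
    show "cfun.subspace (T N)" unfolding T_def by (rule cfun.subspace_span)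
    show "{sphere_restrict (zmonom \<alpha> \<beta>) | \<alpha> \<beta>. sum \<alpha> UNIV \<le> N \<and> sum \<beta> UNIV \<le> N} \<subseteq> T N"
      using bihom_in_T[OF bihom_monom] by blast
  qed
qed

lemma poly_space_mult:
  assumes f: "f \<in> poly_space M" and g: "g \<in> poly_space N"
  shows "(\<lambda>z. f z * g z) \<in> poly_space (M + N)"
proof -
  let ?P = "poly_space (M + N) :: (complex ^ 'a \<Rightarrow> complex) set"
  have gen: "(\<lambda>z. sphere_restrict (zmonom \<alpha> \<beta>) z * g z) \<in> poly_space (M + N)"
    if ab: "sum \<alpha> UNIV \<le> M" "sum \<beta> UNIV \<le> M" for \<alpha> \<beta>
    using g unfolding poly_space_def[of N]
  proof (induction rule: cfun.span_induct_alt)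
    case base
    show ?case using cfun.subspace_0[OF subspace_poly_space] by (simp add: zero_fun_def)
  next
    case (step c x y)
    from step obtain a b where x: "x = sphere_restrict (zmonom a b)" "sum a UNIV \<le> N" "sum b UNIV \<le> N" by auto
    have "sphere_restrict (\<lambda>z. zmonom \<alpha> \<beta> z * zmonom a b z) \<in> poly_space (M + N)"
      by (rule bihom_in_poly_space[OF bihom_mult[OF bihom_monom bihom_monom]]) (use ab x in auto)
    moreover have "(\<lambda>z. sphere_restrict (zmonom \<alpha> \<beta>) z * ((\<lambda>z. c * x z) + y) z) =
        (\<lambda>z. c * sphere_restrict (\<lambda>z. zmonom \<alpha> \<beta> z * zmonom a b z) z) + (\<lambda>z. sphere_restrict (zmonom \<alpha> \<beta>) z * y z)"
      by (auto simp: x sphere_restrict_def fun_eq_iff algebra_simps)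
    ultimately show ?case
      using cfun.subspace_add[OF subspace_poly_space cfun.subspace_scale[OF subspace_poly_space] step(2)] by simp
  qed
  show ?thesis
    using f unfolding poly_space_def[of M]
  proof (induction rule: cfun.span_induct_alt)
    case base
    show ?case using cfun.subspace_0[OF subspace_poly_space] by (simp add: zero_fun_def)
  next
    case (step c x y)
    from step obtain a b where x: "x = sphere_restrict (zmonom a b)" "sum a UNIV \<le> M" "sum b UNIV \<le> M" by auto
    have "(\<lambda>z. ((\<lambda>z. c * x z) + y) z * g z) = (\<lambda>z. c * (sphere_restrict (zmonom a b) z * g z)) + (\<lambda>z. y z * g z)"
      by (auto simp: x fun_eq_iff algebra_simps)
    then show ?case
      using cfun.subspace_add[OF subspace_poly_space cfun.subspace_scale[OF subspace_poly_space gen[OF x(2,3)]] step(2)] by simp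
  qed
qed

lemma poly_space_power:
  assumes f: "f \<in> poly_space N" and "k > 0"
  shows "(\<lambda>z. f z ^ k) \<in> poly_space (k * N)"
  using \<open>k > 0\<close>
proof (induction k rule: nat_induct_non_zero)
  case (Suc k)
  then show ?case using poly_space_mult[OF f Suc.IH] by simp
qed (use f in simp)

lemma poly_space_crefl:
  assumes f: "f \<in> poly_space N" and c: "norm c = 1" and v: "norm v = 1"
  shows "(\<lambda>z. f (crefl c v z)) \<in> poly_space N"
  using f unfolding poly_space_def[of N]
proof (induction rule: cfun.span_induct_alt)
  case base
  show ?case using cfun.span_zero by (simp add: zero_fun_def)
next
  case (step b x y)
  from step obtain \<alpha> \<beta> where x: "x = sphere_restrict (zmonom \<alpha> \<beta>)" "sum \<alpha> UNIV \<le> N" "sum \<beta> UNIV \<le> N" by auto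
  have "sphere_restrict (\<lambda>z. zmonom \<alpha> \<beta> (crefl c v z)) \<in> poly_space N"
    using bihom_in_poly_space[OF bihom_crefl[OF bihom_monom]] x by simp
  moreover have "(\<lambda>z. ((\<lambda>z. b * x z) + y) (crefl c v z)) =
      (\<lambda>z. b * sphere_restrict (\<lambda>z. zmonom \<alpha> \<beta> (crefl c v z)) z) + (\<lambda>z. y (crefl c v z))"
    using norm_crefl[OF c v] by (auto simp: x sphere_restrict_def fun_eq_iff algebra_simps)
  ultimately show ?case
    using cfun.span_add[OF cfun.span_scale step(2)] unfolding poly_space_def by simp
qed

section \<open>The dimension of \<open>T N\<close>\<close>

lemma multi_index_induct [case_names zero Suc]:
  fixes \<alpha> :: "'n::finite \<Rightarrow> nat"
  assumes "P (\<lambda>_. 0)" and step: "\<And>\<alpha> j. P \<alpha> \<Longrightarrow> P (\<alpha>(j := Suc (\<alpha> j)))"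
  shows "P \<alpha>"
proof (induction "sum \<alpha> UNIV" arbitrary: \<alpha>)
  case 0
  then have "\<alpha> = (\<lambda>_. 0)" by (simp add: fun_eq_iff)
  then show ?case using assms(1) by simp
next
  case (Suc k)
  then obtain j where j: "\<alpha> j > 0" by (metis gr0I sum.neutral zero_less_Suc less_numeral_extra(3))
  define a where "a = \<alpha>(j := \<alpha> j - 1)"
  have \<alpha>: "\<alpha> = a(j := Suc (a j))" using j by (auto simp: a_def)
  then have "sum \<alpha> UNIV = Suc (sum a UNIV)" by (metis sum_upd_Suc)
  then have "k = sum a UNIV" using Suc by simp
  from Suc(1)[OF this] show ?case using step \<alpha> by metis
qed

lemma d_z_monom: "d_z j (zmonom \<alpha> \<beta>) z = of_nat (\<alpha> j) * zmonom (\<alpha>(j := \<alpha> j - 1)) \<beta> z"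
proof (induction \<alpha> rule: multi_index_induct)
  case zero
  have "bihom 0 (sum \<beta> UNIV) (zmonom (\<lambda>_. 0) \<beta>)" using bihom_monom[of "\<lambda>_. 0" \<beta>] by simp
  then show ?case using bihom_deriv_aux by fastforce
next
  case (Suc \<alpha> i)
  have m: "zmonom (\<alpha>(i := Suc (\<alpha> i))) \<beta> = (\<lambda>z. z $ i * zmonom \<alpha> \<beta> z)"
    by (simp add: fun_eq_iff monom_mult_z)
  have d: "d_z j (zmonom (\<alpha>(i := Suc (\<alpha> i))) \<beta>) z = (if j = i then zmonom \<alpha> \<beta> z else 0) +
     of_nat (\<alpha> j) * (z $ i * zmonom (\<alpha>(j := \<alpha> j - 1)) \<beta> z)"
    unfolding m d_mult[OF coord_differentiable bihom_differentiable[OF bihom_monom]] d_coord Suc.IH by simp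
  show ?case
  proof (cases "i = j")
    case True
    have e: "(\<alpha>(i := Suc (\<alpha> i)))(j := (\<alpha>(i := Suc (\<alpha> i))) j - 1) = \<alpha>" using True by auto
    show ?thesis
    proof (cases "\<alpha> j = 0")
      case False
      then have "(\<alpha>(j := \<alpha> j - 1))(j := Suc ((\<alpha>(j := \<alpha> j - 1)) j)) = \<alpha>" by auto
      then have "z $ j * zmonom (\<alpha>(j := \<alpha> j - 1)) \<beta> z = zmonom \<alpha> \<beta> z"
        unfolding monom_mult_z by simp
      then show ?thesis unfolding d e using True by (simp add: algebra_simps)
    qed (unfold d e, use True in simp)
  next
    case False
    have *: "z $ i * zmonom (\<alpha>(j := \<alpha> j - 1)) \<beta> z = zmonom (\<alpha>(i := Suc (\<alpha> i), j := \<alpha> j - 1)) \<beta> z"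
      unfolding monom_mult_z using False by (simp add: fun_upd_twist)
    have e: "(\<alpha>(i := Suc (\<alpha> i))) j = \<alpha> j" using False by simp
    show ?thesis unfolding d e * using False by (simp add: fun_upd_def)
  qed
qed

text \<open>
  A linear functional that extracts the coefficient of the monomial with exponents \<open>\<alpha>, \<beta>\<close> from
  polynomials of the same bidegree. It is obtained by iterated differentiation, and its existence
  shows that monomials are linearly independent as functions.
\<close>

definition coeff_functional ::
  "('n::finite \<Rightarrow> nat) \<Rightarrow> ('n \<Rightarrow> nat) \<Rightarrow> ((complex ^ 'n \<Rightarrow> complex) \<Rightarrow> complex) \<Rightarrow> bool" where
  "coeff_functional \<alpha> \<beta> L \<longleftrightarrow>
     (\<forall>f g. bihom (sum \<alpha> UNIV) (sum \<beta> UNIV) f \<longrightarrow> bihom (sum \<alpha> UNIV) (sum \<beta> UNIV) g \<longrightarrow> L (\<lambda>z. f z + g z) = L f + L g) \<and>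
     (\<forall>c f. bihom (sum \<alpha> UNIV) (sum \<beta> UNIV) f \<longrightarrow> L (\<lambda>z. c * f z) = c * L f) \<and>
     (\<forall>a b. sum a UNIV = sum \<alpha> UNIV \<longrightarrow> sum b UNIV = sum \<beta> UNIV \<longrightarrow>
        L (zmonom a b) = (if a = \<alpha> \<and> b = \<beta> then 1 else 0))"

lemma coeff_functional_swap:
  assumes "coeff_functional \<alpha> \<beta> L"
  shows "coeff_functional \<beta> \<alpha> (\<lambda>f. cnj (L (\<lambda>z. cnj (f z))))"
proof -
  have [simp]: "(\<lambda>z. cnj (zmonom a b z)) = zmonom b a" for a b :: "'a \<Rightarrow> nat"
    by (simp add: monom_cnj fun_eq_iff)
  note L = assms[unfolded coeff_functional_def]
  show ?thesis
    unfolding coeff_functional_def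
  proof (intro conjI allI impI)
    fix f g :: "complex ^ 'a \<Rightarrow> complex" and c
    assume f: "bihom (sum \<beta> UNIV) (sum \<alpha> UNIV) f"
    have "L (\<lambda>z. cnj c * cnj (f z)) = cnj c * L (\<lambda>z. cnj (f z))"
      using L bihom_cnj[OF f] by blast
    then show "cnj (L (\<lambda>z. cnj (c * f z))) = c * cnj (L (\<lambda>z. cnj (f z)))" by simp
    assume g: "bihom (sum \<beta> UNIV) (sum \<alpha> UNIV) g"
    have "L (\<lambda>z. cnj (f z) + cnj (g z)) = L (\<lambda>z. cnj (f z)) + L (\<lambda>z. cnj (g z))"
      using L bihom_cnj[OF f] bihom_cnj[OF g] by blast
    then show "cnj (L (\<lambda>z. cnj (f z + g z))) = cnj (L (\<lambda>z. cnj (f z))) + cnj (L (\<lambda>z. cnj (g z)))" by simp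
  qed (use L in auto)
qed

lemma coeff_functional_step:
  assumes L: "coeff_functional \<alpha> \<beta> L"
  shows "coeff_functional (\<alpha>(j := Suc (\<alpha> j))) \<beta> (\<lambda>f. L (d_z j f) / of_nat (Suc (\<alpha> j)))"
  unfolding coeff_functional_def sum_upd_Suc
proof (intro conjI allI impI)
  fix f g :: "complex ^ 'a \<Rightarrow> complex" and c
  assume f: "bihom (Suc (sum \<alpha> UNIV)) (sum \<beta> UNIV) f"
  have df: "bihom (sum \<alpha> UNIV) (sum \<beta> UNIV) (d_z j f)" using bihom_d_z[OF f] by simp
  have "d_z j (\<lambda>z. c * f z) = (\<lambda>z. c * d_z j f z)"
    using d_mult(1)[OF _ bihom_differentiable[OF f], of "\<lambda>_. c"] by (simp add: d_const fun_eq_iff)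
  then show "L (d_z j (\<lambda>z. c * f z)) / of_nat (Suc (\<alpha> j)) = c * (L (d_z j f) / of_nat (Suc (\<alpha> j)))"
    using L df by (simp add: coeff_functional_def)
  assume g: "bihom (Suc (sum \<alpha> UNIV)) (sum \<beta> UNIV) g"
  have dg: "bihom (sum \<alpha> UNIV) (sum \<beta> UNIV) (d_z j g)" using bihom_d_z[OF g] by simp
  have "d_z j (\<lambda>z. f z + g z) = (\<lambda>z. d_z j f z + d_z j g z)"
    using d_add(1)[OF bihom_differentiable[OF f] bihom_differentiable[OF g]] by (simp add: fun_eq_iff)
  then show "L (d_z j (\<lambda>z. f z + g z)) / of_nat (Suc (\<alpha> j)) = L (d_z j f) / of_nat (Suc (\<alpha> j)) + L (d_z j g) / of_nat (Suc (\<alpha> j))"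
    using L df dg by (simp add: coeff_functional_def add_divide_distrib)
next
  fix a b :: "'a \<Rightarrow> nat" assume a: "sum a UNIV = Suc (sum \<alpha> UNIV)" and b: "sum b UNIV = sum \<beta> UNIV"
  have d: "d_z j (zmonom a b) = (\<lambda>z. of_nat (a j) * zmonom (a(j := a j - 1)) b z)"
    by (simp add: d_z_monom fun_eq_iff)
  show "L (d_z j (zmonom a b)) / of_nat (Suc (\<alpha> j)) = (if a = \<alpha>(j := Suc (\<alpha> j)) \<and> b = \<beta> then 1 else 0)"
  proof (cases "a j = 0")
    case True
    have "L (\<lambda>z. 0 * 0) = 0 * L (\<lambda>z. 0)"
      using L bihom_0 unfolding coeff_functional_def by blast
    then show ?thesis using True d by auto
  next
    case False
    define a' where "a' = a(j := a j - 1)"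
    have aa: "a = a'(j := Suc (a' j))" using False by (auto simp: a'_def)
    then have "sum a' UNIV = sum \<alpha> UNIV" using a sum_upd_Suc[of a' j] by simp
    then have "L (zmonom a' b) = (if a' = \<alpha> \<and> b = \<beta> then 1 else 0)"
      and "bihom (sum \<alpha> UNIV) (sum \<beta> UNIV) (zmonom a' b)"
      using L b bihom_monom[of a' b] by (auto simp: coeff_functional_def)
    then have "L (d_z j (zmonom a b)) = of_nat (a j) * (if a' = \<alpha> \<and> b = \<beta> then 1 else 0)"
      unfolding d a'_def[symmetric] using L by (simp add: coeff_functional_def)
    moreover have "a' = \<alpha> \<longleftrightarrow> a = \<alpha>(j := Suc (\<alpha> j))"
    proof
      assume "a = \<alpha>(j := Suc (\<alpha> j))" then show "a' = \<alpha>" by (auto simp: a'_def)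
    qed (use aa in simp)
    ultimately have "L (d_z j (zmonom a b)) / of_nat (Suc (\<alpha> j)) =
        of_nat (a j) / of_nat (Suc (\<alpha> j)) * (if a = \<alpha>(j := Suc (\<alpha> j)) \<and> b = \<beta> then 1 else 0)"
      by simp
    then show ?thesis by (cases "a = \<alpha>(j := Suc (\<alpha> j))") (simp_all del: of_nat_Suc)
  qed
qed

lemma coeff_functional_exists: "\<exists>L. coeff_functional \<alpha> \<beta> L"
proof -
  have 0: "coeff_functional (\<lambda>_. 0) (\<lambda>_. 0) (\<lambda>f. f (0 :: complex ^ 'a))"
    by (auto simp: coeff_functional_def zmonom_def fun_eq_iff)
  have 1: "\<exists>L. coeff_functional \<alpha> (\<lambda>_. 0) L" for \<alpha> :: "'a \<Rightarrow> nat"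
    by (induction \<alpha> rule: multi_index_induct) (use 0 coeff_functional_step in blast)+
  show ?thesis
    by (induction \<alpha> rule: multi_index_induct) (use 1 coeff_functional_swap coeff_functional_step in blast)+
qed

lemma monom_coeffs_zero:
  assumes "\<And>z. (\<Sum>(a, b)\<in>I. c a b * zmonom a b z) = 0" and I: "finite I" "\<And>a b. (a, b) \<in> I \<Longrightarrow> sum a UNIV = m \<and> sum b UNIV = n"
    and ab: "(\<alpha>, \<beta>) \<in> I"
  shows "c \<alpha> \<beta> = 0"
proof -
  have mn: "m = sum \<alpha> UNIV" "n = sum \<beta> UNIV" using I ab by auto
  obtain L where L: "coeff_functional \<alpha> \<beta> L" using coeff_functional_exists by blast
  have L0: "L (\<lambda>z. 0) = 0"
  proof -
    have "L (\<lambda>z. 0 * 0) = 0 * L (\<lambda>z. 0)"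
      using L bihom_0 unfolding coeff_functional_def by blast
    then show ?thesis by simp
  qed
  have bc: "bihom m n (\<lambda>z. c a b * zmonom a b z)" if "(a, b) \<in> I" for a b
    using bihom_cmult[OF bihom_monom[of a b]] I(2)[OF that] by simp
  have "bihom m n (\<lambda>z. \<Sum>(a, b)\<in>J. c a b * zmonom a b z) \<and>
    L (\<lambda>z. \<Sum>(a, b)\<in>J. c a b * zmonom a b z) = (\<Sum>(a, b)\<in>J. c a b * L (zmonom a b))" if "J \<subseteq> I" for J
    using finite_subset[OF that I(1)] that
  proof (induction J rule: finite_induct)
    case empty
    then show ?case using L0 bihom_0 by simp
  next
    case (insert x J)
    obtain a b where x: "x = (a, b)" by (cases x)
    have "bihom m n (zmonom a b)" using bihom_monom[of a b] I(2)[of a b] insert.prems x by simp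
    then have "L (\<lambda>z. c a b * zmonom a b z) = c a b * L (zmonom a b)"
      using L mn by (simp add: coeff_functional_def)
    moreover have "L (\<lambda>z. c a b * zmonom a b z + (\<Sum>(a, b)\<in>J. c a b * zmonom a b z)) =
       L (\<lambda>z. c a b * zmonom a b z) + L (\<lambda>z. \<Sum>(a, b)\<in>J. c a b * zmonom a b z)"
      using L mn bc[of a b] insert x by (simp add: coeff_functional_def)
    ultimately show ?case using insert x bc[of a b] by (auto intro: bihom.add)
  qed
  from this[of I] have "0 = (\<Sum>(a, b)\<in>I. c a b * L (zmonom a b))" using assms(1) L0 by simp
  also have "\<dots> = (\<Sum>x\<in>I. if x = (\<alpha>, \<beta>) then c \<alpha> \<beta> else 0)"
    using L I(2) mn by (intro sum.cong) (force simp: coeff_functional_def)+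
  finally show ?thesis using I(1) ab by simp
qed

text \<open>
  On the sphere \<open>\<Sum>\<^sub>j \<bar>z\<^sub>j\<bar>\<^sup>2 = 1\<close>, so a monomial is a sum of monomials with both degrees raised by one.
  Hence the monomials with one degree equal to \<open>N\<close> and the other at most \<open>N\<close> span everything.
\<close>

definition top_indices :: "nat \<Rightarrow> (('n::finite \<Rightarrow> nat) \<times> ('n \<Rightarrow> nat)) set" where
  "top_indices N = {(\<alpha>, \<beta>). max (sum \<alpha> UNIV) (sum \<beta> UNIV) = N}"

definition rmonom :: "('n::finite \<Rightarrow> nat) \<times> ('n \<Rightarrow> nat) \<Rightarrow> complex ^ 'n \<Rightarrow> complex" where
  "rmonom x = sphere_restrict (zmonom (fst x) (snd x))"

lemma top_indices_eq:
  "top_indices N = {\<alpha>. sum \<alpha> UNIV \<le> N} \<times> {\<beta>. sum \<beta> UNIV \<le> N} - {\<alpha>. sum \<alpha> UNIV < N} \<times> {\<beta>. sum \<beta> UNIV < N}"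
  by (auto simp: top_indices_def max_def)

lemma finite_top_indices: "finite (top_indices N)"
  unfolding top_indices_eq by (intro finite_Diff finite_cartesian_product finite_multi_index_le)

lemma monom_mult_cnj: "cnj (z $ j) * zmonom \<alpha> \<beta> z = zmonom \<alpha> (\<beta>(j := Suc (\<beta> j))) z"
  by (metis complex_cnj_cnj complex_cnj_mult monom_cnj monom_mult_z)

lemma poly_space_top: "poly_space N = cfun.span (rmonom ` (top_indices N :: (('n::finite \<Rightarrow> nat) \<times> ('n \<Rightarrow> nat)) set))"
proof
  let ?S = "cfun.span (rmonom ` (top_indices N :: (('n \<Rightarrow> nat) \<times> ('n \<Rightarrow> nat)) set))"
  have step: "rmonom (\<alpha>, \<beta>) \<in> ?S" if "max (sum \<alpha> UNIV) (sum \<beta> UNIV) + k = N" for \<alpha> \<beta> :: "'n \<Rightarrow> nat" and k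
    using that
  proof (induction k arbitrary: \<alpha> \<beta>)
    case 0
    then show ?case by (intro cfun.span_base imageI) (simp add: top_indices_def)
  next
    case (Suc k)
    have "rmonom (\<alpha>, \<beta>) = (\<Sum>j\<in>UNIV. rmonom (\<alpha>(j := Suc (\<alpha> j)), \<beta>(j := Suc (\<beta> j))))"
    proof
      fix z :: "complex ^ 'n"
      show "rmonom (\<alpha>, \<beta>) z = (\<Sum>j\<in>UNIV. rmonom (\<alpha>(j := Suc (\<alpha> j)), \<beta>(j := Suc (\<beta> j)))) z"
      proof (cases "z \<in> sphere 0 1")
        case True
        have *: "zmonom (\<alpha>(j := Suc (\<alpha> j))) (\<beta>(j := Suc (\<beta> j))) z = z $ j * cnj (z $ j) * zmonom \<alpha> \<beta> z" for j
          by (simp add: mult.assoc flip: monom_mult_z monom_mult_cnj)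
        have "cinner z z = 1" using True by (simp add: cinner_self)
        then have "(\<Sum>j\<in>UNIV. zmonom (\<alpha>(j := Suc (\<alpha> j))) (\<beta>(j := Suc (\<beta> j))) z) = zmonom \<alpha> \<beta> z"
          unfolding * by (simp add: cinner_def flip: sum_distrib_right)
        then show ?thesis using True by (simp add: sum_fun_apply rmonom_def sphere_restrict_def)
      qed (simp add: sum_fun_apply rmonom_def sphere_restrict_def)
    qed
    also have "\<dots> \<in> ?S"
    proof (rule cfun.span_sum)
      fix j
      show "rmonom (\<alpha>(j := Suc (\<alpha> j)), \<beta>(j := Suc (\<beta> j))) \<in> ?S"
        by (rule Suc.IH) (use Suc.prems in \<open>unfold sum_upd_Suc, simp\<close>)
    qed
    finally show ?case .
  qed
  show "poly_space N \<subseteq> ?S"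
    unfolding poly_space_def
  proof (rule cfun.span_minimal[OF _ cfun.subspace_span], safe)
    fix \<alpha> \<beta> :: "'n \<Rightarrow> nat" assume "sum \<alpha> UNIV \<le> N" "sum \<beta> UNIV \<le> N"
    then show "sphere_restrict (zmonom \<alpha> \<beta>) \<in> ?S"
      using step[of \<alpha> \<beta> "N - max (sum \<alpha> UNIV) (sum \<beta> UNIV)"] by (simp add: rmonom_def)
  qed
  show "?S \<subseteq> poly_space N"
    unfolding poly_space_def
  proof (rule cfun.span_mono, rule image_subsetI)
    fix x :: "('n \<Rightarrow> nat) \<times> ('n \<Rightarrow> nat)" assume "x \<in> top_indices N"
    then have "sum (fst x) UNIV \<le> N" "sum (snd x) UNIV \<le> N" by (auto simp: top_indices_def)
    then show "rmonom x \<in> {sphere_restrict (zmonom \<alpha> \<beta>) | \<alpha> \<beta>. sum \<alpha> UNIV \<le> N \<and> sum \<beta> UNIV \<le> N}"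
      unfolding rmonom_def by blast
  qed
qed

text \<open>
  The top bidegrees \<open>(a, b)\<close> with \<open>max a b = N\<close> are distinguished by \<open>a - b\<close>, so their parts are
  mutually orthogonal. Each part of a vanishing combination vanishes on the sphere, by homogeneity
  everywhere, and so do its coefficients.
\<close>

lemma top_monoms_independent:
  fixes c :: "('n::finite \<Rightarrow> nat) \<times> ('n \<Rightarrow> nat) \<Rightarrow> complex"
  assumes zero: "\<And>z. z \<in> sphere 0 1 \<Longrightarrow> (\<Sum>x\<in>top_indices N. c x * zmonom (fst x) (snd x) z) = 0"
    and x: "x \<in> top_indices N"
  shows "c x = 0"
proof -
  define a b where "a = sum (fst x) UNIV" and "b = sum (snd x) UNIV"
  define I :: "(('n \<Rightarrow> nat) \<times> ('n \<Rightarrow> nat)) set" where "I = {y \<in> top_indices N. sum (fst y) UNIV = a \<and> sum (snd y) UNIV = b}"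
  have "finite I" by (rule finite_subset[OF _ finite_top_indices]) (auto simp: I_def)
  then have I: "finite I" "x \<in> I" "I \<subseteq> top_indices N"
    using x by (auto simp: I_def a_def b_def)
  define P where "P = (\<lambda>z. \<Sum>y\<in>I. c y * zmonom (fst y) (snd y) z)"
  have deg: "bihom a b (zmonom (fst y) (snd y))" if "y \<in> I" for y
    using that bihom_monom[of "fst y" "snd y"] by (auto simp: I_def)
  have P: "bihom a b P"
    unfolding P_def by (intro bihom_sum bihom_cmult deg)
  have cm: "continuous_on A (zmonom (fst y) (snd y) :: complex ^ 'n \<Rightarrow> complex)" for y A
    by (rule bihom_continuous[OF bihom_monom])
  have "0 = sip (\<lambda>z. \<Sum>y\<in>top_indices N. c y * zmonom (fst y) (snd y) z) P"
  proof -
    have "sip (\<lambda>z. \<Sum>y\<in>top_indices N. c y * zmonom (fst y) (snd y) z) P = sip (\<lambda>z. 0) P"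
      using zero by (intro sip_cong) auto
    then show ?thesis by (simp add: sip_def)
  qed
  also have "\<dots> = (\<Sum>y\<in>top_indices N. c y * sip (zmonom (fst y) (snd y)) P)"
    by (intro sip_sum_left cm bihom_continuous[OF P])
  also have "\<dots> = (\<Sum>y\<in>I. c y * sip (zmonom (fst y) (snd y)) P)"
  proof (rule sum.mono_neutral_right[OF finite_top_indices I(3)], rule ballI)
    fix y assume y: "y \<in> top_indices N - I"
    have "sum (fst y) UNIV + b \<noteq> sum (snd y) UNIV + a"
      using y x unfolding I_def top_indices_def a_def b_def by (auto simp: max_def split: if_splits)
    then show "c y * sip (zmonom (fst y) (snd y)) P = 0"
      using sip_bihom_unbalanced[OF bihom_monom P] by simp
  qed
  also have "\<dots> = sip P P"
    unfolding P_def by (rule sip_sum_left[symmetric]) (auto intro!: continuous_intros cm)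
  finally have "P z = 0" if "z \<in> sphere 0 1" for z
    using sip_eq_0[OF bihom_continuous[OF P]] that by simp
  then have "P = (\<lambda>z. 0)" by (rule bihom_zero_if_sphere[OF P])
  then have "(\<Sum>(\<alpha>, \<beta>)\<in>I. c (\<alpha>, \<beta>) * zmonom \<alpha> \<beta> z) = 0" for z
    by (simp add: P_def case_prod_beta fun_eq_iff)
  from monom_coeffs_zero[OF this I(1), of a b "fst x" "snd x"] I(2)
  show ?thesis by (auto simp: I_def)
qed

lemma inj_rmonom: "inj_on rmonom (top_indices N :: (('n::finite \<Rightarrow> nat) \<times> ('n \<Rightarrow> nat)) set)"
proof (rule inj_onI, rule ccontr)
  fix x y :: "('n \<Rightarrow> nat) \<times> ('n \<Rightarrow> nat)"
  assume x: "x \<in> top_indices N" and y: "y \<in> top_indices N" and eq: "rmonom x = rmonom y" and ne: "x \<noteq> y"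
  define c :: "('n \<Rightarrow> nat) \<times> ('n \<Rightarrow> nat) \<Rightarrow> complex" where "c u = (if u = x then 1 else 0) + (if u = y then -1 else 0)" for u
  have "(\<Sum>u\<in>top_indices N. c u * zmonom (fst u) (snd u) z) = 0" if z: "z \<in> sphere 0 1" for z
  proof -
    have "(\<Sum>u\<in>top_indices N. c u * zmonom (fst u) (snd u) z) =
      (\<Sum>u\<in>top_indices N. (if u = x then zmonom (fst x) (snd x) z else 0) + (if u = y then - zmonom (fst y) (snd y) z else 0))"
      by (intro sum.cong) (auto simp: c_def)
    also have "\<dots> = zmonom (fst x) (snd x) z - zmonom (fst y) (snd y) z"
      using x y by (simp add: sum.distrib finite_top_indices)
    also have "\<dots> = 0" using fun_cong[OF eq, of z] z by (simp add: rmonom_def sphere_restrict_def)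
    finally show ?thesis .
  qed
  from top_monoms_independent[OF this x] show False using ne by (simp add: c_def)
qed

lemma dim_T_card: "cfun.dim (T N :: (complex ^ 'n::finite \<Rightarrow> complex) set) = card (top_indices N :: (('n \<Rightarrow> nat) \<times> ('n \<Rightarrow> nat)) set)"
proof -
  have "cfun.independent (rmonom ` (top_indices N :: (('n \<Rightarrow> nat) \<times> ('n \<Rightarrow> nat)) set))"
  proof (rule cfun.independent_if_scalars_zero)
    fix c f assume s: "(\<Sum>f\<in>rmonom ` (top_indices N :: (('n \<Rightarrow> nat) \<times> ('n \<Rightarrow> nat)) set). (\<lambda>z. c f * f z)) = 0"
      and "f \<in> rmonom ` (top_indices N :: (('n \<Rightarrow> nat) \<times> ('n \<Rightarrow> nat)) set)"
    then obtain x where x: "x \<in> top_indices N" "f = rmonom x" by blast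
    have s': "(\<Sum>x\<in>(top_indices N :: (('n \<Rightarrow> nat) \<times> ('n \<Rightarrow> nat)) set). (\<lambda>z. c (rmonom x) * rmonom x z)) = 0"
      using s by (simp add: sum.reindex[OF inj_rmonom])
    have "(\<Sum>x\<in>top_indices N. c (rmonom x) * zmonom (fst x) (snd x) z) = 0" if "z \<in> sphere 0 1" for z :: "complex ^ 'n"
      using fun_cong[OF s', of z] that by (simp add: sum_fun_apply rmonom_def sphere_restrict_def)
    from top_monoms_independent[OF this x(1)] show "c f = 0" by (simp add: x(2))
  qed (simp add: finite_top_indices)
  then show ?thesis
    unfolding T_eq_poly_space poly_space_top
    by (simp add: cfun.dim_eq_card_independent card_image[OF inj_rmonom])
qed

text \<open>
  Enumerating the coordinates turns multi-indices into the lists counted by stars and bars.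
\<close>

lemma card_multi_index: "card {\<alpha> :: 'n::finite \<Rightarrow> nat. sum \<alpha> UNIV = m} = (m + CARD('n) - 1) choose m"
proof -
  obtain f :: "nat \<Rightarrow> 'n" where f: "bij_betw f {0..<CARD('n)} UNIV"
    using ex_bij_betw_nat_finite[of "UNIV :: 'n set"] by auto
  define g where "g = (\<lambda>\<alpha> :: 'n \<Rightarrow> nat. map (\<lambda>i. \<alpha> (f i)) [0..<CARD('n)])"
  have sum: "sum_list (g \<alpha>) = sum \<alpha> UNIV" for \<alpha>
  proof -
    have "sum_list (g \<alpha>) = (\<Sum>i\<in>{0..<CARD('n)}. \<alpha> (f i))"
      unfolding g_def by (simp add: interv_sum_list_conv_sum_set_nat)
    also have "\<dots> = sum \<alpha> UNIV" by (rule sum.reindex_bij_betw[OF f])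
    finally show ?thesis .
  qed
  have "bij_betw g {\<alpha>. sum \<alpha> UNIV = m} {l. length l = CARD('n) \<and> sum_list l = m}"
  proof (rule bij_betwI')
    fix \<alpha> \<beta> :: "'n \<Rightarrow> nat"
    show "g \<alpha> = g \<beta> \<longleftrightarrow> \<alpha> = \<beta>"
    proof
      assume "g \<alpha> = g \<beta>"
      then have "\<alpha> (f i) = \<beta> (f i)" if "i < CARD('n)" for i
        using that by (auto simp: g_def map_eq_conv)
      moreover have "\<exists>i<CARD('n). j = f i" for j
        using bij_betw_imp_surj_on[OF f] by (metis UNIV_I atLeastLessThan_iff imageE)
      ultimately show "\<alpha> = \<beta>" by (intro ext) metis
    qed simp
  next
    fix \<alpha> :: "'n \<Rightarrow> nat" assume "\<alpha> \<in> {\<alpha>. sum \<alpha> UNIV = m}"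
    then show "g \<alpha> \<in> {l. length l = CARD('n) \<and> sum_list l = m}" using sum by (simp add: g_def)
  next
    fix l :: "nat list" assume l: "l \<in> {l. length l = CARD('n) \<and> sum_list l = m}"
    define \<alpha> where "\<alpha> j = l ! the_inv_into {0..<CARD('n)} f j" for j
    have "g \<alpha> = l"
      using l f by (auto simp: g_def \<alpha>_def intro!: nth_equalityI simp: the_inv_into_f_f[OF bij_betw_imp_inj_on])
    then show "\<exists>\<alpha>\<in>{\<alpha>. sum \<alpha> UNIV = m}. l = g \<alpha>" using l sum by (intro bexI[of _ \<alpha>]) auto
  qed
  from bij_betw_same_card[OF this] show ?thesis by (simp add: card_length_sum_list)
qed

lemma card_multi_index_le: "card {\<alpha> :: 'n::finite \<Rightarrow> nat. sum \<alpha> UNIV \<le> N} = (N + CARD('n)) choose N"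
proof -
  have "{\<alpha> :: 'n \<Rightarrow> nat. sum \<alpha> UNIV \<le> N} = (\<Union>m\<in>{..N}. {\<alpha>. sum \<alpha> UNIV = m})" by auto
  then have "card {\<alpha> :: 'n \<Rightarrow> nat. sum \<alpha> UNIV \<le> N} = (\<Sum>m\<le>N. card {\<alpha> :: 'n \<Rightarrow> nat. sum \<alpha> UNIV = m})"
    by (simp only:) (rule card_UN_disjoint, auto simp: finite_multi_index)
  also have "\<dots> = (\<Sum>m\<le>N. ((CARD('n) - 1) + m) choose m)"
    unfolding card_multi_index by (intro sum.cong refl arg_cong2[where f = binomial]) (auto simp: Suc_leI)
  also have "\<dots> = Suc ((CARD('n) - 1) + N) choose N" by (rule sum_choose_lower)
  also have "Suc ((CARD('n) - 1) + N) = N + CARD('n)" using zero_less_card_finite[where 'a = 'n] by linarith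
  finally show ?thesis .
qed

text \<open>
  The product \<open>(N + 1) (N + 2) \<cdots> (N + d - 1)\<close>.
\<close>

definition rising_quot :: "'n::finite itself \<Rightarrow> nat \<Rightarrow> real" where
  "rising_quot _ N = fact (N + (CARD('n) - 1)) / fact N"

text \<open>
  The top indices form the difference of two squares, of the sets of multi-indices of degree at most
  \<open>N\<close> and of degree less than \<open>N\<close>, which have \<open>(N + d) choose d\<close> and \<open>(N + d - 1) choose d\<close> elements.
\<close>

lemma phi_formula:
  "real (phi TYPE('n::finite) N) * (fact CARD('n) * fact (CARD('n) - 1)) =
     (rising_quot TYPE('n) N)\<^sup>2 * (2 * real N + real CARD('n))"
proof -
  let ?d = "CARD('n)"
  define F where "F = rising_quot TYPE('n) N"
  have d: "?d > 0" by simp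
  then obtain e where e: "?d = Suc e" by (metis Suc_pred)
  have A: "real ((N + ?d) choose N) * fact ?d = F * (N + ?d)"
  proof -
    have "real ((N + ?d) choose N) = fact (N + ?d) / (fact N * fact ?d)" by (simp add: binomial_fact)
    then have "real ((N + ?d) choose N) * fact ?d = fact (N + ?d) / fact N" by simp
    also have "fact (N + ?d) = real (N + ?d) * fact (N + e)" by (simp add: e)
    finally show ?thesis by (simp add: F_def rising_quot_def e)
  qed
  have phiA: "real (phi TYPE('n) N) = (real ((N + ?d) choose N))\<^sup>2 - (if N = 0 then 0 else real ((N - 1 + ?d) choose (N - 1)))\<^sup>2"
  proof -
    have le: "{\<alpha> :: 'n \<Rightarrow> nat. sum \<alpha> UNIV < N} = (if N = 0 then {} else {\<alpha>. sum \<alpha> UNIV \<le> N - 1})" by auto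
    have c: "card {\<alpha> :: 'n \<Rightarrow> nat. sum \<alpha> UNIV < N} = (if N = 0 then 0 else (N - 1 + ?d) choose (N - 1))"
      unfolding le using card_multi_index_le[where 'n = 'n and N = "N - 1"] by simp
    have sub: "{\<alpha> :: 'n \<Rightarrow> nat. sum \<alpha> UNIV < N} \<times> {\<beta> :: 'n \<Rightarrow> nat. sum \<beta> UNIV < N} \<subseteq> {\<alpha>. sum \<alpha> UNIV \<le> N} \<times> {\<beta>. sum \<beta> UNIV \<le> N}" by auto
    have fin: "finite ({\<alpha> :: 'n \<Rightarrow> nat. sum \<alpha> UNIV \<le> N} \<times> {\<beta> :: 'n \<Rightarrow> nat. sum \<beta> UNIV \<le> N})"
      by (intro finite_cartesian_product finite_multi_index_le)
    have "real (phi TYPE('n) N) = real (card ({\<alpha> :: 'n \<Rightarrow> nat. sum \<alpha> UNIV \<le> N} \<times> {\<beta> :: 'n \<Rightarrow> nat. sum \<beta> UNIV \<le> N}))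
        - real (card ({\<alpha> :: 'n \<Rightarrow> nat. sum \<alpha> UNIV < N} \<times> {\<beta> :: 'n \<Rightarrow> nat. sum \<beta> UNIV < N}))"
      unfolding phi_def dim_T_card top_indices_eq
      using card_Diff_subset[OF finite_subset[OF sub fin] sub] card_mono[OF fin sub] by (simp add: of_nat_diff)
    then show ?thesis
      unfolding card_cartesian_product card_multi_index_le c by (simp add: power2_eq_square)
  qed
  have B: "(if N = 0 then 0 else real ((N - 1 + ?d) choose (N - 1))) * fact ?d = F * N"
  proof (cases N)
    case (Suc M)
    have "real ((M + ?d) choose M) = fact (M + ?d) / (fact M * fact ?d)" by (simp add: binomial_fact)
    then have "real ((M + ?d) choose M) * fact ?d = fact (M + ?d) / fact M" by simp
    also have "\<dots> = F * N"
    proof -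
      have 1: "F = fact (N + e) / fact N" by (simp add: F_def rising_quot_def e)
      have 2: "N + e = M + ?d" using Suc e by simp
      have 3: "(fact N :: real) = real N * fact M" using Suc by simp
      have "real N \<noteq> 0" using Suc by simp
      then show ?thesis unfolding 1 2 3 by (simp del: fact_Suc)
    qed
    finally show ?thesis using Suc by simp
  qed simp
  have "real (phi TYPE('n) N) * (fact ?d)\<^sup>2 = (F * (N + ?d))\<^sup>2 - (F * N)\<^sup>2"
    unfolding phiA left_diff_distrib power_mult_distrib[symmetric] A B ..
  also have "\<dots> = F\<^sup>2 * (2 * real N + ?d) * ?d" by (simp add: power2_eq_square algebra_simps)
  finally have "real (phi TYPE('n) N) * (fact ?d * fact (?d - 1)) * ?d = F\<^sup>2 * (2 * real N + ?d) * ?d"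
    by (simp add: e power2_eq_square algebra_simps)
  then show ?thesis using d by (simp add: F_def)
qed

lemma rising_quot_bounds:
  "(real N + 1) ^ (CARD('n) - 1) \<le> rising_quot TYPE('n::finite) N"
  "rising_quot TYPE('n) N \<le> (real N + real CARD('n)) ^ (CARD('n) - 1)"
proof -
  have lo: "fact N * (real N + 1) ^ e \<le> fact (N + e)" for e
  proof (induction e)
    case (Suc e)
    have "fact N * (real N + 1) ^ Suc e = (real N + 1) * (fact N * (real N + 1) ^ e)" by simp
    also have "\<dots> \<le> (real N + 1 + real e) * fact (N + e)"
      using Suc by (intro mult_mono) auto
    finally show ?case by (simp add: algebra_simps)
  qed simp
  have hi: "fact (N + e) \<le> fact N * (M :: real) ^ e" if "real (N + e) \<le> M" for e M
    using that
  proof (induction e)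
    case (Suc e)
    have "fact (N + Suc e) = real (N + Suc e) * fact (N + e)" by simp
    also have "\<dots> \<le> M * (fact N * M ^ e)"
      using Suc by (intro mult_mono) auto
    finally show ?case by (simp add: algebra_simps)
  qed simp
  show "(real N + 1) ^ (CARD('n) - 1) \<le> rising_quot TYPE('n) N"
    using lo[of "CARD('n) - 1"] by (simp add: rising_quot_def field_simps)
  have "real (N + (CARD('n) - 1)) \<le> real N + real CARD('n)" by simp
  from hi[OF this] show "rising_quot TYPE('n) N \<le> (real N + real CARD('n)) ^ (CARD('n) - 1)"
    by (simp add: rising_quot_def field_simps)
qed

text \<open>
  The sharp constant in \<open>R_const\<close>: each of the \<open>2d - 2\<close> factors \<open>N + j\<close> is at least \<open>N + 1\<close>, and so is
  \<open>N + d / 2\<close> because \<open>d \<ge> 2\<close>.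
\<close>

lemma phi_lower:
  assumes "CARD('n::finite) \<ge> 2"
  shows "(real N + 1) ^ (2 * CARD('n) - 1) \<le> real (phi TYPE('n) N) * (fact CARD('n) * fact (CARD('n) - 1) / 2)"
proof -
  let ?d = "CARD('n)"
  have "((real N + 1) ^ (?d - 1))\<^sup>2 * (2 * (real N + 1)) \<le> (rising_quot TYPE('n) N)\<^sup>2 * (2 * real N + ?d)"
    using assms by (intro mult_mono power_mono rising_quot_bounds) auto
  also have "((real N + 1) ^ (?d - 1))\<^sup>2 * (2 * (real N + 1)) = 2 * (real N + 1) ^ (2 * ?d - 1)"
  proof -
    have "2 * ?d - 1 = Suc ((?d - 1) * 2)" using assms by simp
    then show ?thesis by (simp add: power_mult[symmetric])
  qed
  finally show ?thesis using phi_formula[where 'n = 'n and N = N] by simp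
qed

lemma phi_upper:
  obtains C where "C > 0" "\<And>N. real (phi TYPE('n::finite) N) \<le> C * (real N + 1) ^ (2 * CARD('n) - 1)"
proof
  let ?d = "CARD('n)"
  define C where "C = 2 * real ?d ^ (2 * ?d - 1)"
  have d: "?d \<ge> 1" by (simp add: Suc_leI)
  show "C > 0" by (simp add: C_def)
  fix N
  have "real (phi TYPE('n) N) * 1 \<le> real (phi TYPE('n) N) * (fact ?d * fact (?d - 1))"
  proof (rule mult_left_mono)
    show "1 \<le> (fact ?d * fact (?d - 1) :: real)" using mult_mono[of 1 "fact ?d :: real" 1 "fact (?d - 1)"] by (simp add: fact_ge_1)
  qed simp
  also have "\<dots> = (rising_quot TYPE('n) N)\<^sup>2 * (2 * real N + real ?d)" by (rule phi_formula)
  also have "\<dots> \<le> ((real N + ?d) ^ (?d - 1))\<^sup>2 * (2 * (real N + ?d))"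
    by (intro mult_mono power_mono rising_quot_bounds) (auto simp: rising_quot_def)
  also have "\<dots> = 2 * (real N + ?d) ^ (2 * ?d - 1)"
  proof -
    have "2 * ?d - 1 = Suc ((?d - 1) * 2)" using d by linarith
    then show ?thesis by (simp add: power_mult[symmetric])
  qed
  also have "\<dots> \<le> 2 * (?d * (real N + 1)) ^ (2 * ?d - 1)"
  proof -
    have "real N * 1 \<le> real N * real ?d" using d by (intro mult_left_mono) auto
    then have "real N + real ?d \<le> real ?d * (real N + 1)" by (simp add: algebra_simps)
    then show ?thesis by (intro mult_left_mono power_mono) auto
  qed
  also have "\<dots> = C * (real N + 1) ^ (2 * ?d - 1)" by (simp add: C_def power_mult_distrib)
  finally show "real (phi TYPE('n) N) \<le> C * (real N + 1) ^ (2 * ?d - 1)" by simp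
qed

lemma phi_pos: "phi TYPE('n::finite) N > 0"
proof -
  have "rising_quot TYPE('n) N > 0" by (simp add: rising_quot_def)
  then have "(rising_quot TYPE('n) N)\<^sup>2 * (2 * real N + real CARD('n)) > 0"
    by (intro mult_pos_pos add_nonneg_pos) auto
  then show ?thesis unfolding phi_formula[symmetric] by (simp add: zero_less_mult_iff)
qed

lemma phi_0: "phi TYPE('n::finite) 0 = 1"
proof -
  have "real (phi TYPE('n) 0) * (fact CARD('n) * fact (CARD('n) - 1)) = (fact (CARD('n) - 1))\<^sup>2 * real CARD('n)"
    using phi_formula[where 'n = 'n and N = 0] by (simp add: rising_quot_def)
  also have "\<dots> = 1 * (fact CARD('n) * fact (CARD('n) - 1))"
    by (subst fact_reduce[of "CARD('n)"]) (auto simp: power2_eq_square)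
  finally show ?thesis by simp
qed

text \<open>
  The quotient of the dimensions is \<open>((N + d) / (N + 1))\<^sup>2 (2N + 2 + d) / (2N + d)\<close>.
\<close>

lemma phi_Suc_le:
  assumes "CARD('n::finite) \<ge> 2"
  shows "real (phi TYPE('n) (Suc N)) \<le> real (phi TYPE('n) N) * (1 + 2 * (real CARD('n))\<^sup>2 / (real N + 1))"
proof -
  define d where "d = real CARD('n)"
  define x where "x = real N + 1"
  have x: "x \<ge> 1" and d: "d \<ge> 2" using assms by (auto simp: x_def d_def)
  define F where "F = rising_quot TYPE('n) N"
  have F1: "rising_quot TYPE('n) (Suc N) = F * ((x + (d - 1)) / x)"
  proof -
    obtain e where e: "CARD('n) = Suc e" using zero_less_card_finite[where 'a = 'n] gr0_implies_Suc by blast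
    have "rising_quot TYPE('n) (Suc N) = ((x + (d - 1)) * fact (N + e)) / (x * fact N)"
      by (simp add: rising_quot_def x_def d_def e algebra_simps)
    then show ?thesis by (simp add: F_def rising_quot_def e mult_ac)
  qed
  have "(x + (d - 1))\<^sup>2 * (2 * x + d) \<le> x\<^sup>2 * (2 * x + d - 2) * (1 + 2 * d\<^sup>2 / x)"
  proof -
    have a: "(2 * x + d) * x \<le> (2 * x + d - 2) * (x + 1)"
      using d by (simp add: algebra_simps)
    have b: "(x + (d - 1))\<^sup>2 \<le> x * (x + (d\<^sup>2 - 1))"
    proof -
      have "(d - 1)\<^sup>2 * 1 \<le> (d - 1)\<^sup>2 * x" using x by (intro mult_left_mono) auto
      then show ?thesis by (simp add: power2_eq_square algebra_simps)
    qed
    have c: "(x + (d\<^sup>2 - 1)) * (x + 1) \<le> x * (x + 2 * d\<^sup>2)"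
    proof -
      have "d\<^sup>2 - 1 \<le> d\<^sup>2 * x"
      proof -
        have "d\<^sup>2 * 1 \<le> d\<^sup>2 * x" using x by (intro mult_left_mono) auto
        then show ?thesis by simp
      qed
      then show ?thesis by (simp add: algebra_simps)
    qed
    have "(x + (d - 1))\<^sup>2 * ((2 * x + d) * x) \<le> (x * (x + (d\<^sup>2 - 1))) * ((2 * x + d - 2) * (x + 1))"
    proof (rule mult_mono[OF b a])
      have "d\<^sup>2 \<ge> 1" using d by (simp add: one_le_power)
      then show "0 \<le> x * (x + (d\<^sup>2 - 1))" using x by simp
      show "0 \<le> (2 * x + d) * x" using x d by simp
    qed
    also have "\<dots> = (2 * x + d - 2) * x * ((x + (d\<^sup>2 - 1)) * (x + 1))" by (simp add: algebra_simps)
    also have "\<dots> \<le> (2 * x + d - 2) * x * (x * (x + 2 * d\<^sup>2))"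
      using c x d by (intro mult_left_mono) auto
    also have "\<dots> = x * (x\<^sup>2 * (2 * x + d - 2) * (1 + 2 * d\<^sup>2 / x))"
      using x by (simp add: field_simps power2_eq_square)
    finally have "x * ((x + (d - 1))\<^sup>2 * (2 * x + d)) \<le> x * (x\<^sup>2 * (2 * x + d - 2) * (1 + 2 * d\<^sup>2 / x))"
      by (simp only: mult_ac)
    then show ?thesis using x by (simp only: mult_le_cancel_left_pos)
  qed
  then have "F\<^sup>2 / x\<^sup>2 * ((x + (d - 1))\<^sup>2 * (2 * x + d)) \<le> F\<^sup>2 / x\<^sup>2 * (x\<^sup>2 * (2 * x + d - 2) * (1 + 2 * d\<^sup>2 / x))"
    by (intro mult_left_mono) auto
  then have "(rising_quot TYPE('n) (Suc N))\<^sup>2 * (2 * x + d) \<le> F\<^sup>2 * (2 * x + d - 2) * (1 + 2 * d\<^sup>2 / x)"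
    unfolding F1 using x by (simp add: power_divide power_mult_distrib)
  also have "F\<^sup>2 * (2 * x + d - 2) = real (phi TYPE('n) N) * (fact CARD('n) * fact (CARD('n) - 1))"
    unfolding phi_formula F_def by (simp add: x_def d_def)
  also have "(rising_quot TYPE('n) (Suc N))\<^sup>2 * (2 * x + d) = real (phi TYPE('n) (Suc N)) * (fact CARD('n) * fact (CARD('n) - 1))"
    unfolding phi_formula by (simp add: x_def d_def algebra_simps)
  finally have "(fact CARD('n) * fact (CARD('n) - 1)) * real (phi TYPE('n) (Suc N)) \<le>
     (fact CARD('n) * fact (CARD('n) - 1)) * (real (phi TYPE('n) N) * (1 + 2 * d\<^sup>2 / x))"
    by (simp only: mult_ac)
  then show ?thesis by (simp add: d_def x_def mult_le_cancel_left_pos)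
qed

section \<open>Orthonormal bases of harmonic polynomials\<close>

lemma subspace_H: "cfun.subspace (H m n)"
proof (rule cfun.subspaceI)
  have "lap (\<lambda>z. 0) = (\<lambda>z :: complex ^ 'a. 0)" using lap_deg_0[OF bihom_0[of 0 0]] by simp
  then show "0 \<in> (H m n :: (complex ^ 'a \<Rightarrow> complex) set)"
    unfolding H_alt using bihom_0[of m n] sphere_restrict_simps(3) by (metis (mono_tags, lifting) mem_Collect_eq)
next
  fix x y :: "complex ^ 'a \<Rightarrow> complex" assume "x \<in> H m n" "y \<in> H m n"
  then obtain f g where fg: "bihom m n f" "bihom m n g" "lap f = (\<lambda>z. 0)" "lap g = (\<lambda>z. 0)"
    "x = sphere_restrict f" "y = sphere_restrict g" by (auto simp: H_alt)
  have "d_z i (d_zbar i (\<lambda>z. f z + g z)) z = d_z i (d_zbar i f) z + d_z i (d_zbar i g) z" for i z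
  proof -
    have "d_zbar i (\<lambda>z. f z + g z) = (\<lambda>z. d_zbar i f z + d_zbar i g z)"
      using d_add(2)[OF bihom_differentiable[OF fg(1)] bihom_differentiable[OF fg(2)]] by (simp add: fun_eq_iff)
    then show ?thesis
      using d_add(1)[OF bihom_differentiable[OF bihom_d_zbar[OF fg(1)]] bihom_differentiable[OF bihom_d_zbar[OF fg(2)]]] by simp
  qed
  then have "lap (\<lambda>z. f z + g z) = (\<lambda>z. lap f z + lap g z)" by (simp add: lap_def[abs_def] sum.distrib)
  then have "lap (\<lambda>z. f z + g z) = (\<lambda>z. 0)" using fg by simp
  moreover have "x + y = sphere_restrict (\<lambda>z. f z + g z)" unfolding fg by (rule sphere_restrict_simps(1)[symmetric])
  ultimately show "x + y \<in> H m n" unfolding H_alt using bihom.add[OF fg(1,2)] by blast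
next
  fix c and x :: "complex ^ 'a \<Rightarrow> complex" assume "x \<in> H m n"
  then obtain f where f: "bihom m n f" "lap f = (\<lambda>z. 0)" "x = sphere_restrict f" by (auto simp: H_alt)
  have "d_z i (d_zbar i (\<lambda>z. c * f z)) z = c * d_z i (d_zbar i f) z" for i z
  proof -
    have "d_zbar i (\<lambda>z. c * f z) = (\<lambda>z. c * d_zbar i f z)"
      using d_mult(2)[OF _ bihom_differentiable[OF f(1)], of "\<lambda>_. c"] by (simp add: d_const fun_eq_iff)
    then show ?thesis
      using d_mult(1)[OF _ bihom_differentiable[OF bihom_d_zbar[OF f(1)]], of "\<lambda>_. c"] by (simp add: d_const)
  qed
  then have "lap (\<lambda>z. c * f z) = (\<lambda>z. c * lap f z)" by (simp add: lap_def[abs_def] sum_distrib_left)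
  then have "lap (\<lambda>z. c * f z) = (\<lambda>z. 0)" using f by simp
  moreover have "(\<lambda>z. c * x z) = sphere_restrict (\<lambda>z. c * f z)" unfolding f by (rule sphere_restrict_simps(2)[symmetric])
  ultimately show "(\<lambda>z. c * x z) \<in> H m n" unfolding H_alt using bihom_cmult[OF f(1)] by blast
qed

lemma H_subset_poly_space: "H m n \<subseteq> poly_space (max m n)"
  using bihom_in_poly_space[of m n _ "max m n"] by (auto simp: H_alt)

lemma H_cont: "H m n \<subseteq> sphere_cont"
  using H_subset_poly_space poly_space_cont by blast

lemma harmonic_basis_exists:
  "\<exists>E :: (complex ^ 'n::finite \<Rightarrow> complex) set. finite E \<and> orthonormal E \<and> cfun.span E = H m n"
  using orthonormal_basis_subspace[OF subspace_H _ finite_poly_gens H_cont] H_subset_poly_space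
  unfolding poly_space_def by blast

definition hbasis :: "nat \<Rightarrow> nat \<Rightarrow> (complex ^ 'n::finite \<Rightarrow> complex) set" where
  "hbasis m n = (SOME E. finite E \<and> orthonormal E \<and> cfun.span E = H m n)"

lemma hbasis: "finite (hbasis m n)" "orthonormal (hbasis m n)" "cfun.span (hbasis m n) = H m n"
  using someI_ex[OF harmonic_basis_exists] unfolding hbasis_def by auto

lemma hbasis_in_H: "e \<in> hbasis m n \<Longrightarrow> e \<in> H m n"
  using hbasis(3) cfun.span_base by blast

lemma H_orthogonal:
  assumes "f \<in> H m n" "g \<in> H m' n'" "(m, n) \<noteq> (m', n')"
  shows "sip f g = 0"
proof -
  from assms(1,2) obtain f' g' where f: "f = sphere_restrict f'" "bihom m n f'" "lap f' = (\<lambda>z. 0)"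
    and g: "g = sphere_restrict g'" "bihom m' n' g'" "lap g' = (\<lambda>z. 0)"
    by (auto simp: H_alt)
  then show ?thesis using harmonic_orthogonal[OF f(2,3) g(2,3) assms(3)] by (simp add: sip_restrict)
qed

lemma repr_kernel_eq:
  assumes w: "w \<in> sphere 0 1"
  shows "repr_kernel m n w = (\<lambda>v. \<Sum>e\<in>hbasis m n. cnj (e w) * e v)"
proof -
  let ?Z = "\<lambda>v. \<Sum>e\<in>hbasis m n. cnj (e w) * e v"
  have ZH: "?Z \<in> H m n"
    unfolding hbasis(3)[symmetric] by (intro cfun_sum_in_span cfun.span_base)
  have Zrep: "sip f ?Z = f w" if f: "f \<in> H m n" for f
  proof -
    have "f \<in> cfun.span (hbasis m n)" using f hbasis(3) by blast
    then have fe: "f = (\<lambda>z. \<Sum>e\<in>hbasis m n. sip f e * e z)"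
      using orthonormal_span[OF hbasis(1,2)] by blast
    have "sip f ?Z = (\<Sum>e\<in>hbasis m n. cnj (cnj (e w)) * sip f e)"
    proof (intro sip_sum_right)
      show "continuous_on (sphere 0 1) f" using f H_cont sphere_contD by blast
    qed (rule orthonormalD[OF hbasis(2)])
    also have "\<dots> = (\<Sum>e\<in>hbasis m n. sip f e * e w)" by (simp add: mult.commute)
    also have "\<dots> = f w" using fe by metis
    finally show ?thesis .
  qed
  show ?thesis
    unfolding repr_kernel_def
  proof (rule the_equality)
    show "?Z \<in> H m n \<and> (\<forall>f\<in>H m n. f w = (\<integral>v. f v * cnj (?Z v) \<partial>surface_measure))"
      using ZH Zrep by (auto simp: sip_def)
  next
    fix Z assume Z: "Z \<in> H m n \<and> (\<forall>f\<in>H m n. f w = (\<integral>v. f v * cnj (Z v) \<partial>surface_measure))"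
    then have Z': "sip f Z = f w" if "f \<in> H m n" for f using that by (simp add: sip_def)
    have d: "Z - ?Z \<in> H m n" using cfun.subspace_diff[OF subspace_H] Z ZH by blast
    have cs: "continuous_on (sphere 0 1) Z" "continuous_on (sphere 0 1) ?Z" "continuous_on (sphere 0 1) (Z - ?Z)"
      using Z ZH d H_cont sphere_contD by blast+
    have "sip (Z - ?Z) (Z - ?Z) = sip (\<lambda>v. Z v - ?Z v) (Z - ?Z)" by (rule sip_cong) auto
    also have "\<dots> = sip Z (Z - ?Z) - sip ?Z (Z - ?Z)" by (rule sip_diff_left[OF cs])
    also have "\<dots> = cnj (sip (Z - ?Z) Z) - cnj (sip (Z - ?Z) ?Z)" by (simp only: sip_cnj)
    also have "\<dots> = 0" unfolding Z'[OF d] Zrep[OF d] by simp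
    finally have "Z - ?Z = 0" using sphere_cont_eq_0 d H_cont by blast
    then show "Z = ?Z" by simp
  qed
qed

lemma kernel_conv_eq:
  assumes w: "w \<in> sphere 0 1" and f: "continuous_on (sphere 0 1) f"
  shows "kernel_conv f m n w = (\<Sum>e\<in>hbasis m n. e w * sip f e)"
proof -
  have "kernel_conv f m n w = sip f (\<lambda>v. \<Sum>e\<in>hbasis m n. cnj (e w) * e v)"
    unfolding kernel_conv_def repr_kernel_eq[OF w] sip_def ..
  also have "\<dots> = (\<Sum>e\<in>hbasis m n. cnj (cnj (e w)) * sip f e)"
    by (intro sip_sum_right f orthonormalD[OF hbasis(2)])
  finally show ?thesis by simp
qed

definition level_basis :: "nat \<Rightarrow> (complex ^ 'n::finite \<Rightarrow> complex) set" where
  "level_basis l = (\<Union>(m, n)\<in>{(m, n). max m n = l}. hbasis m n)"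

definition tbasis :: "nat \<Rightarrow> (complex ^ 'n::finite \<Rightarrow> complex) set" where
  "tbasis N = (\<Union>l\<le>N. level_basis l)"

definition level :: "(complex ^ 'n::finite \<Rightarrow> complex) \<Rightarrow> nat" where
  "level e = (THE l. e \<in> level_basis l)"

lemma hbasis_disjoint:
  assumes "e \<in> hbasis m n" "e \<in> hbasis m' n'"
  shows "m = m' \<and> n = n'"
proof (rule ccontr)
  assume "\<not> (m = m' \<and> n = n')"
  then have "sip e e = 0" using H_orthogonal[of e m n e m' n'] assms hbasis_in_H by blast
  moreover have "sip e e = 1" using orthonormal_sip[OF hbasis(2) assms(1) assms(1)] by simp
  ultimately show False by simp
qed

lemma level_eq: "e \<in> level_basis l \<Longrightarrow> level e = l"
  unfolding level_def
proof (rule the_equality)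
  fix l' assume "e \<in> level_basis l" "e \<in> level_basis l'"
  then show "l' = l" using hbasis_disjoint by (fastforce simp: level_basis_def)
qed

lemma level_hbasis: "e \<in> hbasis m n \<Longrightarrow> level e = max m n"
  by (rule level_eq) (auto simp: level_basis_def)

lemma hbasis_tbasis:
  assumes "max m n \<le> N" shows "hbasis m n \<subseteq> tbasis N"
proof -
  have "hbasis m n \<subseteq> level_basis (max m n)" by (auto simp: level_basis_def)
  then show ?thesis using assms unfolding tbasis_def by blast
qed

lemma tbasis_alt: "tbasis N = (\<Union>(m, n)\<in>{..N} \<times> {..N}. hbasis m n)"
  by (fastforce simp: tbasis_def level_basis_def)

lemma finite_tbasis: "finite (tbasis N)"
  unfolding tbasis_alt using hbasis(1) by (intro finite_UN_I finite_cartesian_product) auto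

lemma orthonormal_tbasis: "orthonormal (tbasis N)"
  unfolding orthonormal_def
proof (intro conjI ballI)
  show "tbasis N \<subseteq> sphere_cont"
    unfolding tbasis_alt using hbasis_in_H H_cont by fastforce
next
  fix e e' :: "complex ^ 'a \<Rightarrow> complex" assume "e \<in> tbasis N" "e' \<in> tbasis N"
  then obtain m n m' n' where e: "e \<in> hbasis m n" "e' \<in> hbasis m' n'" by (auto simp: tbasis_alt)
  show "sip e e' = (if e = e' then 1 else 0)"
  proof (cases "(m, n) = (m', n')")
    case True
    then show ?thesis using e(2) orthonormal_sip[OF hbasis(2) e(1), of e'] by simp
  next
    case False
    then have "e \<noteq> e'" using hbasis_disjoint e by blast
    then show ?thesis using H_orthogonal[OF hbasis_in_H[OF e(1)] hbasis_in_H[OF e(2)] False] by simp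
  qed
qed

lemma span_tbasis: "cfun.span (tbasis N) = (T N :: (complex ^ 'n::finite \<Rightarrow> complex) set)"
proof
  show "cfun.span (tbasis N) \<subseteq> (T N :: (complex ^ 'n \<Rightarrow> complex) set)"
    unfolding T_def tbasis_alt using hbasis_in_H by (intro cfun.span_mono) fastforce
  show "(T N :: (complex ^ 'n \<Rightarrow> complex) set) \<subseteq> cfun.span (tbasis N)"
    unfolding T_def
  proof (rule cfun.span_minimal[OF _ cfun.subspace_span], rule subsetI)
    fix f :: "complex ^ 'n \<Rightarrow> complex" assume "f \<in> (\<Union>(m, n)\<in>{(m, n). max m n \<le> N}. H m n)"
    then obtain m n where "f \<in> H m n" "max m n \<le> N" by auto
    then show "f \<in> cfun.span (tbasis N)"
      using hbasis(3)[of m n] cfun.span_mono[OF hbasis_tbasis[of m n N]] by blast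
  qed
qed

lemma card_tbasis: "card (tbasis N :: (complex ^ 'n::finite \<Rightarrow> complex) set) = phi TYPE('n) N"
  using orthonormal_card[OF finite_tbasis orthonormal_tbasis] by (simp add: span_tbasis phi_def)

lemma tbasis_Suc: "tbasis (Suc N) = tbasis N \<union> level_basis (Suc N)" "tbasis 0 = level_basis 0"
  by (auto simp: tbasis_def atMost_Suc)

lemma level_tbasis:
  assumes "e \<in> tbasis N" shows "level e \<le> N"
proof -
  from assms obtain l where "l \<le> N" "e \<in> level_basis l" by (auto simp: tbasis_def)
  then show ?thesis using level_eq[of e l] by simp
qed

lemma level_basis_subset: "l \<le> N \<Longrightarrow> level_basis l \<subseteq> tbasis N"
  by (auto simp: tbasis_def)

lemma finite_level_basis: "finite (level_basis l)"
  using finite_subset[OF level_basis_subset[OF order_refl] finite_tbasis] .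

lemma tbasis_level_disjoint: "tbasis N \<inter> level_basis (Suc N) = {}"
  using level_tbasis[of _ N] level_eq[of _ "Suc N"] by fastforce

lemma tbasisI: "e \<in> hbasis m n \<Longrightarrow> max m n \<le> N \<Longrightarrow> e \<in> tbasis N"
  using hbasis_tbasis by blast

lemma sip_tbasis_sum:
  assumes e: "e \<in> hbasis m n"
  shows "sip (\<lambda>z. \<Sum>e\<in>tbasis N. c e * e z) e = (if max m n \<le> N then c e else 0)"
proof (cases "max m n \<le> N")
  case True
  then show ?thesis using orthonormal_coeff[OF finite_tbasis orthonormal_tbasis tbasisI[OF e True]] by simp
next
  case False
  have "sip e' e = 0" if "e' \<in> tbasis N" for e'
  proof -
    from that obtain m' n' where e': "e' \<in> hbasis m' n'" "m' \<le> N" "n' \<le> N" by (auto simp: tbasis_alt)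
    then show ?thesis using False by (intro H_orthogonal[OF hbasis_in_H[OF e'(1)] hbasis_in_H[OF e]]) auto
  qed
  then have "sip (\<lambda>z. \<Sum>e\<in>tbasis N. c e * e z) e = 0"
    using orthonormalD[OF orthonormal_tbasis] orthonormalD[OF hbasis(2) e] by (subst sip_sum_left) auto
  then show ?thesis using False by (simp only: if_False)
qed

lemma tbasis_sum_cont: "continuous_on (sphere 0 1) (\<lambda>z. \<Sum>e\<in>tbasis N. c e * e z)"
  by (intro continuous_intros orthonormalD[OF orthonormal_tbasis])

lemma kernel_conv_multiplier:
  assumes w: "w \<in> sphere 0 1"
  shows "kernel_conv (\<lambda>z. \<Sum>e\<in>tbasis N. (mu (level e) * c e) * e z) m n w =
    mu (max m n) * kernel_conv (\<lambda>z. \<Sum>e\<in>tbasis N. c e * e z) m n w"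
  unfolding kernel_conv_eq[OF w tbasis_sum_cont] sum_distrib_left
  by (intro sum.cong refl) (auto simp: sip_tbasis_sum level_hbasis)

section \<open>The reproducing kernel of \<open>T N\<close> is constant on the diagonal\<close>

text \<open>
  The reflection along \<open>x - y\<close>. With \<open>a = cinner x y\<close>, the requirement that it maps \<open>x\<close> to \<open>y\<close> is
  \<open>(c - 1) (1 - a) = - (norm (x - y))\<^sup>2 = - (1 - a) - (1 - cnj a)\<close>, so \<open>c = - (1 - cnj a) / (1 - a)\<close>, which
  has modulus 1.
\<close>

lemma crefl_transitive:
  assumes x: "norm x = 1" and y: "norm y = 1" and "x \<noteq> y"
  shows "\<exists>c v. norm c = 1 \<and> norm v = 1 \<and> crefl c v x = y"
proof -
  define u where "u = x - y"
  define r where "r = norm u"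
  have r: "r > 0" using assms(3) by (simp add: r_def u_def)
  define v where "v = (1 / r) *\<^sub>R u"
  have v: "norm v = 1" using r by (simp add: v_def r_def)
  define a where "a = cinner x y"
  have cxu: "cinner x u = 1 - a"
  proof -
    have "cinner x x = cinner x (u + y)" by (simp add: u_def)
    then show ?thesis using x by (simp add: cinner_add_right cinner_self a_def algebra_simps)
  qed
  have "of_real (r\<^sup>2) = cinner u u" by (simp add: r_def cinner_self)
  also have "\<dots> = (1 - a) + (1 - cnj a)"
  proof -
    have "cinner x u = cinner (u + y) u" by (simp add: u_def)
    then have "cinner u u = cinner x u - cinner y u" by (simp add: cinner_add_left)
    also have "cinner y u = cnj a - 1"
    proof -
      have "cinner y x = cinner y (u + y)" by (simp add: u_def)
      then show ?thesis using y by (simp add: cinner_add_right cinner_self a_def cinner_cnj algebra_simps)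
    qed
    finally show ?thesis by (simp add: cxu)
  qed
  finally have r2: "of_real (r\<^sup>2) = (1 - a) + (1 - cnj a)" .
  have a1: "1 - a \<noteq> 0"
  proof
    assume "1 - a = 0"
    then have "a = 1" by simp
    then have "of_real (r\<^sup>2) = (0 :: complex)" using r2 by simp
    then show False using r by simp
  qed
  define c where "c = - (1 - cnj a) / (1 - a)"
  have "norm (1 - cnj a) = norm (1 - a)" by (metis complex_cnj_diff complex_cnj_one complex_mod_cnj)
  then have c: "norm c = 1" using a1 by (simp add: c_def norm_divide norm_minus_commute[of "cnj a" 1])
  have cv: "(c - 1) * (1 - a) = - of_real (r\<^sup>2)"
  proof -
    have "c * (1 - a) = - (1 - cnj a)" using a1 by (simp add: c_def)
    moreover have "(c - 1) * (1 - a) = c * (1 - a) - (1 - a)" by (simp only: left_diff_distrib mult_1)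
    ultimately show ?thesis unfolding r2 by simp
  qed
  have vs: "v = of_real (1 / r) *s u" by (simp add: v_def vec_eq_iff scaleR_conv_of_real[where 'a = complex])
  have "crefl c v x = x + ((c - 1) * (of_real (1 / r) * (1 - a)) * of_real (1 / r)) *s u"
    unfolding crefl_def vs cinner_scale_right cxu by (simp add: vector_smult_assoc)
  also have "(c - 1) * (of_real (1 / r) * (1 - a)) * of_real (1 / r) = ((c - 1) * (1 - a)) / of_real (r\<^sup>2)"
  proof -
    have q: "of_real (1 / r) * of_real (1 / r) = (1 :: complex) / of_real (r\<^sup>2)"
      by (simp add: power2_eq_square)
    have "(c - 1) * (of_real (1 / r) * (1 - a)) * of_real (1 / r) = ((c - 1) * (1 - a)) * (of_real (1 / r) * of_real (1 / r))"
      by (simp only: mult_ac)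
    then show ?thesis unfolding q by simp
  qed
  also have "\<dots> = -1" unfolding cv using r by simp
  finally have "crefl c v x = y" by (simp add: u_def vec_eq_iff)
  then show ?thesis using c v by blast
qed

abbreviation sphere_area :: "'n::finite itself \<Rightarrow> real" where
  "sphere_area _ \<equiv> measure (surface_measure :: (complex ^ 'n) measure) (sphere 0 1)"

lemma sphere_area_pos: "sphere_area TYPE('n::finite) > 0"
proof (rule ccontr)
  assume "\<not> ?thesis"
  then have "sphere_area TYPE('n) = 0" using measure_nonneg by (metis less_eq_real_def)
  then have "emeasure (surface_measure :: (complex ^ 'n) measure) (space surface_measure) = 0"
    by (simp add: surface.emeasure_eq_measure)
  then have "AE z in (surface_measure :: (complex ^ 'n) measure). (1 :: complex) = 0"
    by (rule emeasure_0_AE)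
  then have "(1 :: complex) = 0"
    by (rule surface_AE_zero_continuous[rotated, where z = "axis undefined 1"]) auto
  then show False by simp
qed

text \<open>
  At \<open>z\<close> the sum is the squared norm of the representing function of evaluation at \<open>z\<close>, and its value
  at \<open>crefl c v z\<close> is a Bessel sum of that function for the rotated basis, hence not larger. Since
  reflections are transitive, the sum is constant, and its integral is \<open>card E\<close>.
\<close>

lemma kernel_diagonal_constant:
  fixes E :: "(complex ^ 'n::finite \<Rightarrow> complex) set"
  assumes E: "finite E" "orthonormal E"
    and inv: "\<And>e c v. e \<in> E \<Longrightarrow> norm c = 1 \<Longrightarrow> norm v = 1 \<Longrightarrow> (\<lambda>z. e (crefl c v z)) \<in> cfun.span E"
    and z: "z \<in> sphere 0 1"
  shows "(\<Sum>e\<in>E. (norm (e z))\<^sup>2) = real (card E) / sphere_area TYPE('n)"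
proof -
  define K where "K z = (\<Sum>e\<in>E. (norm (e z))\<^sup>2)" for z
  have Esc: "E \<subseteq> sphere_cont" using E(2) by (simp add: orthonormal_def)
  have le: "K (crefl c v z) \<le> K z" if c: "norm c = 1" and v: "norm v = 1" for c v z
  proof -
    define k where "k = (\<lambda>w. \<Sum>e\<in>E. cnj (e z) * e w)"
    have kc: "continuous_on (sphere 0 1) k"
      unfolding k_def by (intro continuous_intros orthonormalD[OF E(2)])
    have rep: "sip g k = g z" if g: "g \<in> cfun.span E" for g
    proof -
      have gc: "continuous_on (sphere 0 1) g" using g span_sphere_cont[OF Esc] sphere_contD by blast
      have "sip g k = (\<Sum>e\<in>E. cnj (cnj (e z)) * sip g e)"
        unfolding k_def by (intro sip_sum_right gc orthonormalD[OF E(2)])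
      also have "\<dots> = (\<Sum>e\<in>E. sip g e * e z)" by (simp add: mult.commute)
      also have "\<dots> = g z" using orthonormal_span[OF E, of g] g by metis
      finally show ?thesis .
    qed
    have kk: "sip k k = of_real (K z)"
      unfolding k_def orthonormal_norm_sum[OF E] K_def of_real_sum complex_norm_square
      by (simp add: mult.commute)
    define r where "r = (\<lambda>(e :: complex ^ 'n \<Rightarrow> complex) w. e (crefl c v w))"
    have rs: "sip (r e) (r e') = sip e e'" if "e \<in> E" "e' \<in> E" for e e'
    proof -
      have "continuous_on (sphere 0 1) (\<lambda>w. e w * cnj (e' w))"
        by (intro continuous_intros orthonormalD[OF E(2)] that)
      from integral_crefl[OF c v this] show ?thesis by (simp add: sip_def r_def)
    qed
    have inj: "inj_on r E"
    proof (rule inj_onI)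
      fix e e' assume e: "e \<in> E" "e' \<in> E" and "r e = r e'"
      then have "sip e e' = sip e e" using rs[of e e'] rs[of e e] by simp
      then show "e = e'" using orthonormal_sip[OF E(2) e] orthonormal_sip[OF E(2) e(1) e(1)] by (auto split: if_splits)
    qed
    have rE: "r e \<in> cfun.span E" if "e \<in> E" for e using inv[OF that c v] by (simp add: r_def)
    have "orthonormal (r ` E)"
      unfolding orthonormal_def
    proof (intro conjI ballI)
      show "r ` E \<subseteq> sphere_cont" using rE span_sphere_cont[OF Esc] by blast
      fix f f' assume "f \<in> r ` E" "f' \<in> r ` E"
      then obtain e e' where e: "e \<in> E" "e' \<in> E" "f = r e" "f' = r e'" by blast
      then show "sip f f' = (if f = f' then 1 else 0)"
        using rs[OF e(1,2)] orthonormal_sip[OF E(2) e(1,2)] inj_onD[OF inj] by auto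
    qed
    then have "(\<Sum>f\<in>r ` E. (norm (sip k f))\<^sup>2) \<le> Re (sip k k)"
      using E(1) kc by (intro bessel) auto
    also have "(\<Sum>f\<in>r ` E. (norm (sip k f))\<^sup>2) = (\<Sum>e\<in>E. (norm (sip k (r e)))\<^sup>2)"
      by (simp add: sum.reindex[OF inj])
    also have "\<dots> = K (crefl c v z)"
      unfolding K_def
    proof (rule sum.cong[OF refl])
      fix e assume "e \<in> E"
      then have "sip (r e) k = e (crefl c v z)" using rep[OF rE] by (simp add: r_def)
      then have "norm (sip k (r e)) = norm (e (crefl c v z))" by (metis complex_mod_cnj sip_cnj)
      then show "(norm (sip k (r e)))\<^sup>2 = (norm (e (crefl c v z)))\<^sup>2" by simp
    qed
    finally show ?thesis by (simp add: kk)
  qed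
  have const: "K x = K y" if x: "x \<in> sphere 0 1" and y: "y \<in> sphere 0 1" for x y
  proof -
    have "K y \<le> K x" if "norm x = 1" "norm y = 1" for x y
      using crefl_transitive[OF that] le by (cases "x = y") fastforce+
    then show ?thesis using x y by (simp add: antisym)
  qed
  have ie: "integrable surface_measure (\<lambda>w. (norm (e w))\<^sup>2)" if "e \<in> E" for e
    using orthonormalD[OF E(2) that] by (intro surface_integrable_continuous continuous_intros)
  have "(\<integral>w. K w \<partial>surface_measure) = (\<Sum>e\<in>E. \<integral>w. (norm (e w))\<^sup>2 \<partial>surface_measure)"
    unfolding K_def using ie by (intro Bochner_Integration.integral_sum) auto
  also have "\<dots> = (\<Sum>e\<in>E. 1)"
  proof (rule sum.cong[OF refl])
    fix e assume "e \<in> E"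
    then have "sip e e = 1" using orthonormal_sip[OF E(2)] by simp
    then show "(\<integral>w. (norm (e w))\<^sup>2 \<partial>surface_measure) = 1" unfolding sip_self by (simp only: of_real_eq_1_iff)
  qed
  finally have "(\<integral>w. K w \<partial>surface_measure) = real (card E)" by simp
  moreover have "(\<integral>w. K w \<partial>surface_measure) = (\<integral>w. K z \<partial>(surface_measure :: (complex ^ 'n) measure))"
  proof (rule Bochner_Integration.integral_cong[OF refl])
    fix w :: "complex ^ 'n" assume "w \<in> space surface_measure"
    then show "K w = K z" using const[of w z] z by simp
  qed
  ultimately have "sphere_area TYPE('n) * K z = real (card E)" by simp
  then show ?thesis using sphere_area_pos[where 'n = 'n] by (simp add: K_def field_simps)
qed

lemma kernel_tbasis:
  assumes z: "z \<in> sphere (0 :: complex ^ 'n::finite) 1"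
  shows "(\<Sum>e\<in>tbasis N. (norm (e z))\<^sup>2) = real (phi TYPE('n) N) / sphere_area TYPE('n)"
proof -
  have inv: "(\<lambda>z. e (crefl c v z)) \<in> cfun.span (tbasis N)" if "e \<in> tbasis N" "norm c = 1" "norm v = 1"
    for e :: "complex ^ 'n \<Rightarrow> complex" and c v
  proof -
    have "e \<in> poly_space N"
      using cfun.span_base[OF that(1)] unfolding span_tbasis T_eq_poly_space .
    from poly_space_crefl[OF this that(2,3)] show ?thesis unfolding span_tbasis T_eq_poly_space .
  qed
  show ?thesis
    unfolding card_tbasis[symmetric]
    by (rule kernel_diagonal_constant[OF finite_tbasis orthonormal_tbasis inv z])
qed

lemma kernel_level_basis:
  assumes z: "z \<in> sphere (0 :: complex ^ 'n::finite) 1"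
  shows "(\<Sum>e\<in>level_basis l. (norm (e z))\<^sup>2) = real (card (level_basis l :: (complex ^ 'n \<Rightarrow> complex) set)) / sphere_area TYPE('n)"
proof (cases l)
  case 0
  then show ?thesis using kernel_tbasis[OF z, of 0] by (simp add: tbasis_Suc card_tbasis[symmetric])
next
  case (Suc N)
  note fl = finite_level_basis[of "Suc N"]
  have "(\<Sum>e\<in>tbasis (Suc N). (norm (e z))\<^sup>2) = (\<Sum>e\<in>tbasis N. (norm (e z))\<^sup>2) + (\<Sum>e\<in>level_basis (Suc N). (norm (e z))\<^sup>2)"
    unfolding tbasis_Suc by (rule sum.union_disjoint[OF finite_tbasis fl tbasis_level_disjoint])
  moreover have "card (tbasis (Suc N) :: (complex ^ 'n \<Rightarrow> complex) set) = card (tbasis N :: (complex ^ 'n \<Rightarrow> complex) set) + card (level_basis (Suc N) :: (complex ^ 'n \<Rightarrow> complex) set)"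
    unfolding tbasis_Suc by (rule card_Un_disjoint[OF finite_tbasis fl tbasis_level_disjoint])
  ultimately show ?thesis
    using kernel_tbasis[OF z, of N] kernel_tbasis[OF z, of "Suc N"] Suc by (simp add: card_tbasis add_divide_distrib)
qed

lemma sum_tbasis_levels:
  fixes F :: "(complex ^ 'n::finite \<Rightarrow> complex) \<Rightarrow> real"
  shows "(\<Sum>e\<in>tbasis N. F e) = (\<Sum>l\<le>N. \<Sum>e\<in>level_basis l. F e)"
proof (induction N)
  case (Suc N)
  note fl = finite_level_basis[of "Suc N"]
  show ?case
    unfolding tbasis_Suc sum.union_disjoint[OF finite_tbasis fl tbasis_level_disjoint] using Suc by simp
qed (simp add: tbasis_Suc)

text \<open>
  On a single level the sum is constant as the difference of the constants for two consecutive
  spaces \<open>T N\<close>. Weights that depend on the level only are therefore harmless. It is essential that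
  this is an identity: estimating by the kernel of \<open>T N\<close> alone would lose a power of \<open>N\<close>.
\<close>

lemma weighted_kernel:
  assumes z: "z \<in> sphere (0 :: complex ^ 'n::finite) 1"
  shows "(\<Sum>e\<in>tbasis N. mu (level e) * (norm (e z))\<^sup>2) =
    (\<Sum>e\<in>(tbasis N :: (complex ^ 'n \<Rightarrow> complex) set). mu (level e)) / sphere_area TYPE('n)"
proof -
  have "(\<Sum>e\<in>tbasis N. mu (level e) * (norm (e z))\<^sup>2) = (\<Sum>l\<le>N. mu l * (\<Sum>e\<in>level_basis l. (norm (e z))\<^sup>2))"
    unfolding sum_tbasis_levels sum_distrib_left by (intro sum.cong refl) (simp add: level_eq)
  also have "\<dots> = (\<Sum>l\<le>N. \<Sum>e\<in>(level_basis l :: (complex ^ 'n \<Rightarrow> complex) set). mu l) / sphere_area TYPE('n)"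
    by (simp add: kernel_level_basis[OF z] sum_divide_distrib mult.commute)
  also have "(\<Sum>l\<le>N. \<Sum>e\<in>(level_basis l :: (complex ^ 'n \<Rightarrow> complex) set). mu l) = (\<Sum>e\<in>(tbasis N :: (complex ^ 'n \<Rightarrow> complex) set). mu (level e))"
    unfolding sum_tbasis_levels by (intro sum.cong refl) (simp add: level_eq)
  finally show ?thesis .
qed

section \<open>Random signs\<close>

text \<open>
  Choices of signs are encoded by the set \<open>A\<close> of indices with sign \<open>+1\<close>; averaging is summation over
  the power set.
\<close>

definition sgn_of :: "'a set \<Rightarrow> 'a \<Rightarrow> real" where
  "sgn_of A t = (if t \<in> A then 1 else -1)"

lemma cosh_le_exp_square: "cosh (x :: real) \<le> exp (x\<^sup>2 / 2)"
proof -
  have "(\<lambda>n. if even n then x ^ n /\<^sub>R fact n else 0) sums cosh x" by (rule cosh_converges)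
  moreover have "(if even n then x ^ n /\<^sub>R fact n else 0) = 0" if "n \<notin> range ((*) 2)" for n
    using that by (auto elim!: evenE)
  ultimately have 1: "(\<lambda>n. x ^ (2 * n) /\<^sub>R fact (2 * n)) sums cosh x"
    using sums_mono_reindex[of "\<lambda>n. 2 * n" "\<lambda>n. if even n then x ^ n /\<^sub>R fact n else 0" "cosh x"]
    by (auto simp: strict_mono_def)
  have 2: "(\<lambda>n. (x\<^sup>2 / 2) ^ n /\<^sub>R fact n) sums exp (x\<^sup>2 / 2)" by (rule exp_converges)
  have fact2: "2 ^ n * fact n \<le> (fact (2 * n) :: real)" for n
  proof (induction n)
    case (Suc n)
    have "2 ^ Suc n * fact (Suc n) = (2 * real n + 2) * (2 ^ n * fact n)" by simp
    also have "\<dots> \<le> ((2 * real n + 2) * (2 * real n + 1)) * fact (2 * n)"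
      using Suc by (intro mult_mono) auto
    also have "\<dots> = fact (2 * Suc n)" by (simp add: algebra_simps)
    finally show ?case .
  qed simp
  show ?thesis
  proof (rule sums_le[OF _ 1 2])
    fix n
    have "(x\<^sup>2) ^ n / fact (2 * n) \<le> (x\<^sup>2) ^ n / (2 ^ n * fact n)"
      by (intro divide_left_mono fact2) auto
    then show "x ^ (2 * n) /\<^sub>R fact (2 * n) \<le> (x\<^sup>2 / 2) ^ n /\<^sub>R fact n"
      unfolding power_mult power_divide by (simp only: real_scaleR_def divide_inverse inverse_mult_distrib mult_ac)
  qed
qed

lemma power_le_cosh: "(y :: real) ^ (2 * l) \<le> fact (2 * l) * cosh y"
proof -
  have s: "(\<lambda>n. if even n then y ^ n /\<^sub>R fact n else 0) sums cosh y" by (rule cosh_converges)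
  have "(\<Sum>n\<in>{2 * l}. if even n then y ^ n /\<^sub>R fact n else 0) \<le> cosh y"
    using s by (intro sum_le_suminf[THEN order_trans, OF _ _ _ eq_refl[OF sums_unique[symmetric]]])
      (auto simp: sums_iff zero_le_even_power)
  then show ?thesis by (simp add: field_simps)
qed

lemma sum_signs_exp:
  fixes x :: "'a \<Rightarrow> real"
  assumes "finite D"
  shows "(\<Sum>A\<in>Pow D. exp (\<Sum>t\<in>D. sgn_of A t * x t)) = 2 ^ card D * (\<Prod>t\<in>D. cosh (x t))"
proof -
  have "2 ^ card D * (\<Prod>t\<in>D. cosh (x t)) = (\<Prod>t\<in>D. 2 * cosh (x t))"
    by (simp add: prod.distrib)
  also have "\<dots> = (\<Prod>t\<in>D. exp (x t) + exp (- x t))"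
    by (intro prod.cong refl) (simp add: cosh_def field_simps)
  also have "\<dots> = (\<Sum>A\<in>Pow D. (\<Prod>t\<in>A. exp (x t)) * (\<Prod>t\<in>D - A. exp (- x t)))"
    by (rule prod_add[OF assms])
  also have "\<dots> = (\<Sum>A\<in>Pow D. exp (\<Sum>t\<in>D. sgn_of A t * x t))"
  proof (rule sum.cong[OF refl])
    fix A assume A: "A \<in> Pow D"
    then have fin: "finite A" "finite (D - A)" "D = A \<union> (D - A)" "A \<inter> (D - A) = {}"
      using assms finite_subset by auto
    have "(\<Sum>t\<in>D. sgn_of A t * x t) = (\<Sum>t\<in>A. sgn_of A t * x t) + (\<Sum>t\<in>D - A. sgn_of A t * x t)"
      using fin by (subst fin(3), intro sum.union_disjoint) auto
    also have "(\<Sum>t\<in>A. sgn_of A t * x t) = (\<Sum>t\<in>A. x t)"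
      by (intro sum.cong) (auto simp: sgn_of_def)
    also have "(\<Sum>t\<in>D - A. sgn_of A t * x t) = (\<Sum>t\<in>D - A. - x t)"
      by (intro sum.cong) (auto simp: sgn_of_def)
    finally show "(\<Prod>t\<in>A. exp (x t)) * (\<Prod>t\<in>D - A. exp (- x t)) = exp (\<Sum>t\<in>D. sgn_of A t * x t)"
      using fin by (simp only: exp_add exp_sum)
  qed
  finally show ?thesis by simp
qed

text \<open>
  Bound even moments by exponential ones through \<open>y\<^sup>2\<^sup>l \<le> (2l)! cosh y\<close> with \<open>y = r X\<close>. The value
  \<open>r\<^sup>2 = 2l / S\<close> balances \<open>r\<^sup>-\<^sup>2\<^sup>l\<close> against \<open>exp (r\<^sup>2 S / 2) = exp l\<close> and gives the growth \<open>l\<^sup>l\<close> of the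
  moments, which the supremum norm estimate relies on.
\<close>

lemma khintchine_real:
  fixes x :: "'a \<Rightarrow> real"
  assumes D: "finite D" and l: "l \<ge> 1" and S: "(\<Sum>t\<in>D. (x t)\<^sup>2) \<le> S" and S0: "S > 0"
  shows "(\<Sum>A\<in>Pow D. (\<Sum>t\<in>D. sgn_of A t * x t) ^ (2 * l)) \<le> 2 ^ card D * (2 * exp 1 * real l * S) ^ l"
proof -
  define r where "r = sqrt (2 * real l / S)"
  have r2: "r\<^sup>2 = 2 * real l / S" and r: "r > 0" using l S0 by (auto simp: r_def)
  define X where "X A = (\<Sum>t\<in>D. sgn_of A t * x t)" for A
  have e: "(\<Sum>A\<in>Pow D. exp (c * X A)) \<le> 2 ^ card D * exp (real l)" if c: "c\<^sup>2 = r\<^sup>2" for c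
  proof -
    have "(\<Sum>A\<in>Pow D. exp (c * X A)) = (\<Sum>A\<in>Pow D. exp (\<Sum>t\<in>D. sgn_of A t * (c * x t)))"
      by (simp add: X_def sum_distrib_left mult.left_commute)
    also have "\<dots> = 2 ^ card D * (\<Prod>t\<in>D. cosh (c * x t))" by (rule sum_signs_exp[OF D])
    also have "\<dots> \<le> 2 ^ card D * (\<Prod>t\<in>D. exp ((c * x t)\<^sup>2 / 2))"
      by (intro mult_left_mono prod_mono conjI cosh_le_exp_square) auto
    also have "(\<Prod>t\<in>D. exp ((c * x t)\<^sup>2 / 2)) = exp (c\<^sup>2 / 2 * (\<Sum>t\<in>D. (x t)\<^sup>2))"
      by (simp add: exp_sum[OF D, symmetric] sum_distrib_left power_mult_distrib)
    also have "c\<^sup>2 / 2 * (\<Sum>t\<in>D. (x t)\<^sup>2) \<le> c\<^sup>2 / 2 * S"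
      using S by (intro mult_left_mono) auto
    also have "c\<^sup>2 / 2 * S = real l" using S0 unfolding c r2 by simp
    finally show ?thesis by simp
  qed
  have "(\<Sum>A\<in>Pow D. (r * X A) ^ (2 * l)) \<le> (\<Sum>A\<in>Pow D. fact (2 * l) * cosh (r * X A))"
    by (intro sum_mono power_le_cosh)
  also have "\<dots> = fact (2 * l) / 2 * ((\<Sum>A\<in>Pow D. exp (r * X A)) + (\<Sum>A\<in>Pow D. exp ((- r) * X A)))"
    unfolding sum.distrib[symmetric] sum_distrib_left by (intro sum.cong refl) (simp add: cosh_def)
  also have "\<dots> \<le> fact (2 * l) / 2 * (2 ^ card D * exp (real l) + 2 ^ card D * exp (real l))"
    by (intro mult_left_mono add_mono e) auto
  also have "\<dots> = fact (2 * l) * (2 ^ card D * exp (real l))" by simp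
  also have "\<dots> \<le> (2 * real l) ^ (2 * l) * (2 ^ card D * exp (real l))"
  proof (rule mult_right_mono)
    have "fact (2 * l) \<le> (real (2 * l)) ^ (2 * l)" using fact_le_power[of "2 * l", where 'a = real] by simp
    then show "fact (2 * l) \<le> (2 * real l) ^ (2 * l)" by simp
  qed simp
  finally have "r ^ (2 * l) * (\<Sum>A\<in>Pow D. X A ^ (2 * l)) \<le> (2 * real l) ^ (2 * l) * (2 ^ card D * exp (real l))"
    by (simp add: power_mult_distrib sum_distrib_left)
  also have "(2 * real l) ^ (2 * l) * (2 ^ card D * exp (real l)) = r ^ (2 * l) * (2 ^ card D * (2 * exp 1 * real l * S) ^ l)"
  proof -
    have "r ^ (2 * l) = (2 * real l / S) ^ l" by (simp add: power_mult r2)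
    moreover have "(2 * real l / S) ^ l * (2 * exp 1 * real l * S) ^ l = ((2 * real l)\<^sup>2 * exp 1) ^ l"
    proof -
      have "(2 * real l / S) * (2 * exp 1 * real l * S) = (2 * real l)\<^sup>2 * exp 1"
        using S0 by (simp add: power2_eq_square)
      then show ?thesis by (simp only: power_mult_distrib[symmetric])
    qed
    moreover have "((2 * real l)\<^sup>2 * exp 1) ^ l = (2 * real l) ^ (2 * l) * exp (real l)"
    proof -
      have "exp (real l) = exp (1 :: real) ^ l" using exp_of_nat_mult[of l "1 :: real"] by (simp only: mult_1_right)
      moreover have "((2 * real l)\<^sup>2 * exp 1) ^ l = ((2 * real l)\<^sup>2) ^ l * exp 1 ^ l" by (rule power_mult_distrib)
      ultimately show ?thesis by (simp only: power_mult)
    qed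
    ultimately show ?thesis by (simp only: mult.left_commute[of _ "2 ^ card D"])
  qed
  finally show ?thesis using r by (simp add: X_def)
qed

lemma khintchine:
  fixes b :: "'a \<Rightarrow> complex"
  assumes D: "finite D" and l: "l \<ge> 1" and S: "(\<Sum>t\<in>D. (norm (b t))\<^sup>2) \<le> S" and S0: "S > 0"
  shows "(\<Sum>A\<in>Pow D. norm (\<Sum>t\<in>D. of_real (sgn_of A t) * b t) ^ (2 * l)) \<le> 2 ^ card D * (8 * exp 1 * real l * S) ^ l"
proof -
  let ?R = "\<lambda>A. \<Sum>t\<in>D. sgn_of A t * Re (b t)" and ?I = "\<lambda>A. \<Sum>t\<in>D. sgn_of A t * Im (b t)"
  let ?K = "(2 * exp 1 * real l * S) ^ l"
  have le: "norm (\<Sum>t\<in>D. of_real (sgn_of A t) * b t) ^ (2 * l) \<le> 2 ^ l * (?R A ^ (2 * l) + ?I A ^ (2 * l))" for A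
  proof -
    have "(norm (\<Sum>t\<in>D. of_real (sgn_of A t) * b t))\<^sup>2 = (?R A)\<^sup>2 + (?I A)\<^sup>2"
      by (simp add: cmod_power2)
    then have "norm (\<Sum>t\<in>D. of_real (sgn_of A t) * b t) ^ (2 * l) = ((?R A)\<^sup>2 + (?I A)\<^sup>2) ^ l"
      by (simp add: power_mult)
    also have "\<dots> \<le> (2 * max ((?R A)\<^sup>2) ((?I A)\<^sup>2)) ^ l"
      by (intro power_mono) auto
    also have "\<dots> = 2 ^ l * max ((?R A)\<^sup>2) ((?I A)\<^sup>2) ^ l" by (rule power_mult_distrib)
    also have "\<dots> \<le> 2 ^ l * (((?R A)\<^sup>2) ^ l + ((?I A)\<^sup>2) ^ l)"
      by (intro mult_left_mono) (auto simp: max_def)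
    finally show ?thesis by (simp add: power_mult)
  qed
  have "(\<Sum>t\<in>D. (Re (b t))\<^sup>2) \<le> S" "(\<Sum>t\<in>D. (Im (b t))\<^sup>2) \<le> S"
    using S by (auto intro!: order_trans[OF sum_mono S] simp: cmod_power2)
  note RI = this[THEN khintchine_real[OF D l _ S0]]
  have R: "(\<Sum>A\<in>Pow D. ?R A ^ (2 * l)) \<le> 2 ^ card D * ?K" and I: "(\<Sum>A\<in>Pow D. ?I A ^ (2 * l)) \<le> 2 ^ card D * ?K"
    using RI by simp_all
  have "(\<Sum>A\<in>Pow D. norm (\<Sum>t\<in>D. of_real (sgn_of A t) * b t) ^ (2 * l)) \<le> (\<Sum>A\<in>Pow D. 2 ^ l * (?R A ^ (2 * l) + ?I A ^ (2 * l)))"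
    by (intro sum_mono le)
  also have "\<dots> = 2 ^ l * ((\<Sum>A\<in>Pow D. ?R A ^ (2 * l)) + (\<Sum>A\<in>Pow D. ?I A ^ (2 * l)))"
    by (simp add: sum_distrib_left sum.distrib distrib_left)
  also have "\<dots> \<le> 2 ^ l * (2 ^ card D * ?K + 2 ^ card D * ?K)"
    using R I by (intro mult_left_mono add_mono) auto
  also have "\<dots> = 2 ^ card D * (2 * (2 ^ l * ?K))" by simp
  also have "\<dots> \<le> 2 ^ card D * (2 ^ l * (2 ^ l * ?K))"
  proof -
    have "(2 :: real) ^ 1 \<le> 2 ^ l" using l by (intro power_increasing) auto
    then show ?thesis using S0 by (intro mult_left_mono mult_right_mono) auto
  qed
  also have "2 ^ l * (2 ^ l * ?K) = (8 * exp 1 * real l * S) ^ l"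
    by (simp add: power_mult_distrib[symmetric] mult.assoc[symmetric])
  finally show ?thesis .
qed

section \<open>A function with small \<open>L\<^sup>t\<close> norm in every subspace of small codimension\<close>

definition comb :: "nat \<Rightarrow> ((complex ^ 'n::finite \<Rightarrow> complex) \<Rightarrow> complex) \<Rightarrow> complex ^ 'n \<Rightarrow> complex" where
  "comb N c = (\<lambda>z. \<Sum>e\<in>tbasis N. c e * e z)"

lemma comb_cont: "continuous_on (sphere 0 1) (comb N c)"
  unfolding comb_def by (rule tbasis_sum_cont)

lemma comb_in_T: "comb N c \<in> T N"
  unfolding comb_def span_tbasis[symmetric] by (intro cfun_sum_in_span cfun.span_base)

text \<open>
  The core of the proof. Here \<open>x\<close> are the coefficients of \<open>\<Lambda> h\<close> and \<open>comb\<close> forms \<open>h\<close> itself. The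
  estimate \<open>bS\<close> is uniform over all orthonormal systems \<open>D\<close> in the kernel because Bessel's inequality
  compares with the whole weighted kernel. Signed sums of \<open>D\<close> all have the same norm, so that it
  is enough to average the moments of \<open>h\<close>.
\<close>

lemma small_moment_in_kernel:
  fixes c :: "'j \<Rightarrow> (complex ^ 'n::finite \<Rightarrow> complex) \<Rightarrow> complex" and lam :: "nat \<Rightarrow> real"
  assumes J: "finite J" "card J < phi TYPE('n) N" and l: "l \<ge> 1" and lam: "\<And>i. lam i > 0"
    and S: "(\<Sum>e\<in>(tbasis N :: (complex ^ 'n \<Rightarrow> complex) set). 1 / (lam (level e))\<^sup>2) \<le> S * real (phi TYPE('n) N - card J)"
  shows "\<exists>x. (\<forall>j\<in>J. (\<Sum>e\<in>tbasis N. c j e * x e) = 0) \<and> (\<Sum>e\<in>tbasis N. (norm (x e))\<^sup>2) = 1 \<and>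
    (\<integral>z. norm (comb N (\<lambda>e. x e / of_real (lam (level e))) z) ^ (2 * l) \<partial>surface_measure)
       \<le> sphere_area TYPE('n) * (8 * exp 1 * real l * (S / sphere_area TYPE('n))) ^ l"
proof -
  define E :: "(complex ^ 'n \<Rightarrow> complex) set" where "E = tbasis N"
  have E: "finite E" "orthonormal E" "card E = phi TYPE('n) N"
    unfolding E_def by (rule finite_tbasis orthonormal_tbasis card_tbasis)+
  define m where "m = phi TYPE('n) N - card J"
  have m: "m + card J \<le> card E" "m \<ge> 1" "real m > 0" using J(2) E by (auto simp: m_def)
  obtain D where D: "finite D" "card D = m" "orthonormal D" "D \<subseteq> cfun.span E"
     "\<forall>d\<in>D. \<forall>j\<in>J. (\<Sum>e\<in>E. c j e * sip d e) = 0"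
    using orthonormal_in_kernel[OF E(1,2) J(1) m(1), of c] by blast
  define a where "a = sphere_area TYPE('n)"
  have a: "a > 0" unfolding a_def by (rule sphere_area_pos)
  define S1 where "S1 = S * real m / a"
  define g where "g A = (\<lambda>z. \<Sum>d\<in>D. of_real (sgn_of A d) * d z)" for A
  define y where "y A e = (\<Sum>d\<in>D. of_real (sgn_of A d) * sip d e)" for A e
  define h where "h A = comb N (\<lambda>e. y A e / of_real (lam (level e)))" for A
  define b where "b d z = (\<Sum>e\<in>E. sip d e / of_real (lam (level e)) * e z)" for d z
  have dc: "continuous_on (sphere 0 1) d" if "d \<in> D" for d using orthonormalD[OF D(3) that] .
  have ec: "continuous_on (sphere 0 1) e" if "e \<in> E" for e using orthonormalD[OF E(2) that] .
  have gy: "sip (g A) e = y A e" if "e \<in> E" for A e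
    unfolding g_def y_def by (intro sip_sum_left dc ec that)
  have gspan: "g A \<in> cfun.span E" for A
    unfolding g_def using D(4) by (intro cfun_sum_in_span) auto
  have ysum: "(\<Sum>e\<in>E. (norm (y A e))\<^sup>2) = real m" for A
  proof -
    have "of_real (\<Sum>e\<in>E. (norm (y A e))\<^sup>2) = (\<Sum>e\<in>E. y A e * cnj (y A e))"
      unfolding of_real_sum complex_norm_square ..
    also have "\<dots> = sip (\<lambda>z. \<Sum>e\<in>E. y A e * e z) (\<lambda>z. \<Sum>e\<in>E. y A e * e z)"
      by (rule orthonormal_norm_sum[OF E(1,2), symmetric])
    also have "(\<lambda>z. \<Sum>e\<in>E. y A e * e z) = g A"
      using orthonormal_span[OF E(1,2), of "g A"] gspan[of A] gy by (simp cong: sum.cong)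
    also have "sip (g A) (g A) = (\<Sum>d\<in>D. of_real (sgn_of A d) * cnj (of_real (sgn_of A d)))"
      unfolding g_def by (rule orthonormal_norm_sum[OF D(1,3)])
    also have "\<dots> = (\<Sum>d\<in>D. 1)" by (intro sum.cong) (auto simp: sgn_of_def)
    also have "\<dots> = of_real (real m)" using D(2) by simp
    finally show ?thesis by (simp only: of_real_eq_iff)
  qed
  have hb: "h A z = (\<Sum>d\<in>D. of_real (sgn_of A d) * b d z)" for A z
  proof -
    have "h A z = (\<Sum>e\<in>E. \<Sum>d\<in>D. of_real (sgn_of A d) * (sip d e / of_real (lam (level e)) * e z))"
      unfolding h_def comb_def y_def E_def by (simp add: sum_divide_distrib sum_distrib_right mult.assoc)
    also have "\<dots> = (\<Sum>d\<in>D. \<Sum>e\<in>E. of_real (sgn_of A d) * (sip d e / of_real (lam (level e)) * e z))"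
      by (rule sum.swap)
    finally show ?thesis unfolding b_def by (simp add: sum_distrib_left)
  qed
  have bS: "(\<Sum>d\<in>D. (norm (b d z))\<^sup>2) \<le> S1" if z: "z \<in> sphere 0 1" for z
  proof -
    \<comment> \<open>\<open>k\<close> represents the functional that sends \<open>d\<close> to the value of \<open>\<Lambda>\<^sup>-\<^sup>1 d\<close> at \<open>z\<close>.\<close>
    define k where "k = (\<lambda>w. \<Sum>e\<in>E. (cnj (e z) / of_real (lam (level e))) * e w)"
    have kc: "continuous_on (sphere 0 1) k" unfolding k_def by (intro continuous_intros ec)
    have "sip d k = b d z" if "d \<in> D" for d
    proof -
      have "sip d k = (\<Sum>e\<in>E. cnj (cnj (e z) / of_real (lam (level e))) * sip d e)"
        unfolding k_def by (intro sip_sum_right ec dc that)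
      then show ?thesis by (simp add: b_def mult.commute)
    qed
    then have "norm (sip k d) = norm (b d z)" if "d \<in> D" for d using that by (metis complex_mod_cnj sip_cnj)
    then have "(\<Sum>d\<in>D. (norm (b d z))\<^sup>2) = (\<Sum>d\<in>D. (norm (sip k d))\<^sup>2)" by simp
    also have "\<dots> \<le> Re (sip k k)" by (rule bessel[OF D(1,3) kc])
    also have "sip k k = (\<Sum>e\<in>E. (cnj (e z) / of_real (lam (level e))) * cnj (cnj (e z) / of_real (lam (level e))))"
      unfolding k_def by (rule orthonormal_norm_sum[OF E(1,2)])
    also have "\<dots> = (\<Sum>e\<in>E. of_real ((norm (cnj (e z) / of_real (lam (level e))))\<^sup>2))"
      by (simp only: complex_norm_square)
    also have "\<dots> = of_real (\<Sum>e\<in>E. 1 / (lam (level e))\<^sup>2 * (norm (e z))\<^sup>2)"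
      by (simp add: norm_divide power_divide)
    also have "(\<Sum>e\<in>E. 1 / (lam (level e))\<^sup>2 * (norm (e z))\<^sup>2) = (\<Sum>e\<in>E. 1 / (lam (level e))\<^sup>2) / a"
      unfolding E_def a_def by (rule weighted_kernel[OF z, where mu = "\<lambda>i. 1 / (lam i)\<^sup>2" and N = N])
    also have "\<dots> \<le> S1"
      using S a unfolding S1_def E_def m_def by (intro divide_right_mono) auto
    finally show ?thesis by simp
  qed
  have S1: "S1 > 0"
  proof -
    have "E \<noteq> {}" using m E by auto
    then have "0 < (\<Sum>e\<in>E. 1 / (lam (level e))\<^sup>2)"
      using E(1) by (intro sum_pos divide_pos_pos zero_less_power lam) auto
    then have "0 < S * real m" unfolding E_def m_def using S by (rule less_le_trans)
    then show ?thesis using a by (simp add: S1_def)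
  qed
  let ?K = "(8 * exp 1 * real l * S1) ^ l"
  have hc: "continuous_on (sphere 0 1) (h A)" for A unfolding h_def by (rule comb_cont)
  have hi: "integrable surface_measure (\<lambda>z. norm (h A z) ^ (2 * l))" for A
    by (intro surface_integrable_continuous continuous_intros hc)
  have avg: "(\<Sum>A\<in>Pow D. \<integral>z. norm (h A z) ^ (2 * l) \<partial>surface_measure) \<le> 2 ^ card D * (a * ?K)"
  proof -
    have "(\<Sum>A\<in>Pow D. \<integral>z. norm (h A z) ^ (2 * l) \<partial>surface_measure) = (\<integral>z. (\<Sum>A\<in>Pow D. norm (h A z) ^ (2 * l)) \<partial>surface_measure)"
      using hi by (intro Bochner_Integration.integral_sum[symmetric]) auto
    also have "\<dots> \<le> (\<integral>z. 2 ^ card D * ?K \<partial>(surface_measure :: (complex ^ 'n) measure))"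
    proof (rule integral_mono)
      fix z :: "complex ^ 'n" assume "z \<in> space surface_measure"
      then have z: "z \<in> sphere 0 1" by simp
      show "(\<Sum>A\<in>Pow D. norm (h A z) ^ (2 * l)) \<le> 2 ^ card D * ?K"
        unfolding hb by (rule khintchine[OF D(1) l bS[OF z] S1])
    qed (use hi in auto)
    also have "\<dots> = 2 ^ card D * (a * ?K)" by (simp add: a_def)
    finally show ?thesis .
  qed
  have "\<exists>A\<in>Pow D. (\<integral>z. norm (h A z) ^ (2 * l) \<partial>surface_measure) \<le> a * ?K"
  proof (rule ccontr)
    assume "\<not> ?thesis"
    then have "(\<Sum>A\<in>Pow D. a * ?K) < (\<Sum>A\<in>Pow D. \<integral>z. norm (h A z) ^ (2 * l) \<partial>surface_measure)"
      using D(1) by (intro sum_strict_mono) (auto simp: not_le)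
    then show False using avg by (simp add: card_Pow[OF D(1)])
  qed
  then obtain A where A: "(\<integral>z. norm (h A z) ^ (2 * l) \<partial>surface_measure) \<le> a * ?K" by blast
  define x where "x e = y A e / of_real (sqrt (real m))" for e
  have sq: "(norm (of_real (sqrt (real m)) :: complex))\<^sup>2 = real m" by simp
  have "comb N (\<lambda>e. x e / of_real (lam (level e))) z = h A z / of_real (sqrt (real m))" for z
    unfolding h_def comb_def x_def by (simp add: sum_divide_distrib mult.commute)
  then have "norm (comb N (\<lambda>e. x e / of_real (lam (level e))) z) ^ (2 * l) = norm (h A z) ^ (2 * l) / real m ^ l" for z
    by (simp add: norm_divide power_divide power_mult)
  then have "(\<integral>z. norm (comb N (\<lambda>e. x e / of_real (lam (level e))) z) ^ (2 * l) \<partial>surface_measure) =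
     (\<integral>z. norm (h A z) ^ (2 * l) \<partial>surface_measure) / real m ^ l"
    by simp
  also have "\<dots> \<le> a * ?K / real m ^ l" using A m(3) by (intro divide_right_mono) auto
  also have "\<dots> = a * (8 * exp 1 * real l * (S / a)) ^ l"
    using m(3) by (simp add: S1_def power_divide power_mult_distrib)
  finally have 1: "(\<integral>z. norm (comb N (\<lambda>e. x e / of_real (lam (level e))) z) ^ (2 * l) \<partial>surface_measure) \<le> a * (8 * exp 1 * real l * (S / a)) ^ l" .
  have 2: "(\<Sum>e\<in>E. (norm (x e))\<^sup>2) = 1"
    using ysum[of A] m(3) by (simp add: x_def norm_divide power_divide sum_divide_distrib[symmetric])
  have 3: "(\<Sum>e\<in>E. c j e * x e) = 0" if "j \<in> J" for j
  proof -
    have "(\<Sum>e\<in>E. c j e * x e) = (\<Sum>e\<in>E. \<Sum>d\<in>D. of_real (sgn_of A d) * (c j e * sip d e)) / of_real (sqrt (real m))"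
      unfolding x_def y_def by (simp add: sum_divide_distrib sum_distrib_left mult.left_commute)
    also have "(\<Sum>e\<in>E. \<Sum>d\<in>D. of_real (sgn_of A d) * (c j e * sip d e)) = (\<Sum>d\<in>D. of_real (sgn_of A d) * (\<Sum>e\<in>E. c j e * sip d e))"
      unfolding sum_distrib_left by (rule sum.swap)
    also have "\<dots> = 0" using D(5) that by simp
    finally show ?thesis by simp
  qed
  show ?thesis using 1 2 3 unfolding E_def a_def by blast
qed

lemma sup_bound_T:
  fixes f :: "complex ^ 'n::finite \<Rightarrow> complex"
  assumes f: "f \<in> T N" and z: "z \<in> sphere 0 1"
  shows "(norm (f z))\<^sup>2 \<le> real (phi TYPE('n) N) / sphere_area TYPE('n) * (\<integral>w. (norm (f w))\<^sup>2 \<partial>surface_measure)"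
proof -
  have fe: "f = (\<lambda>z. \<Sum>e\<in>tbasis N. sip f e * e z)"
    using f orthonormal_span[OF finite_tbasis orthonormal_tbasis, of f N] by (simp add: span_tbasis)
  have "f \<in> sphere_cont" using f poly_space_cont unfolding T_eq_poly_space by blast
  then have fc: "continuous_on (sphere 0 1) f" by (rule sphere_contD)
  have "norm (f z) \<le> (\<Sum>e\<in>tbasis N. norm (sip f e) * norm (e z))"
    by (subst fe) (rule order_trans[OF norm_sum], simp add: norm_mult)
  then have "(norm (f z))\<^sup>2 \<le> (\<Sum>e\<in>tbasis N. norm (sip f e) * norm (e z))\<^sup>2"
    by (intro power_mono) auto
  also have "\<dots> \<le> (\<Sum>e\<in>tbasis N. (norm (sip f e))\<^sup>2) * (\<Sum>e\<in>tbasis N. (norm (e z))\<^sup>2)"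
    by (rule Cauchy_Schwarz_ineq_sum)
  also have "\<dots> \<le> (\<integral>w. (norm (f w))\<^sup>2 \<partial>surface_measure) * (real (phi TYPE('n) N) / sphere_area TYPE('n))"
    unfolding kernel_tbasis[OF z]
    using bessel[OF finite_tbasis orthonormal_tbasis fc, of N] sphere_area_pos[where 'n = 'n]
    by (intro mult_right_mono) (auto simp: sip_self)
  finally show ?thesis by (simp add: mult.commute)
qed

text \<open>
  The power \<open>f\<^sup>l\<close> lies in \<open>T (l N)\<close>, to which the \<open>L\<^sup>2\<close> estimate applies. For \<open>l\<close> of the order of
  \<open>ln N\<close> the \<open>l\<close>-th root of \<open>phi (l N)\<close> is bounded.
\<close>

lemma nikolskii:
  fixes f :: "complex ^ 'n::finite \<Rightarrow> complex"
  assumes f: "f \<in> T N" and z: "z \<in> sphere 0 1" and l: "l \<ge> 1"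
  shows "norm (f z) ^ (2 * l) \<le> real (phi TYPE('n) (l * N)) / sphere_area TYPE('n) * (\<integral>w. norm (f w) ^ (2 * l) \<partial>surface_measure)"
proof -
  have "(\<lambda>z. f z ^ l) \<in> T (l * N)"
    using poly_space_power[of f N l] f l unfolding T_eq_poly_space by simp
  from sup_bound_T[OF this z] show ?thesis
    by (simp add: norm_power power_mult[symmetric] mult.commute[of l 2])
qed

section \<open>Norm estimates\<close>

lemma enn2real_ge_1: "1 \<le> p \<Longrightarrow> p < \<infinity> \<Longrightarrow> 1 \<le> enn2real p"
  using enn2real_mono[of 1 p] by simp

lemma Lp_norm_leI:
  assumes p: "1 \<le> p" "p < \<infinity>" and a: "a \<ge> 0"
    and I: "(\<integral>\<^sup>+ w. ennreal (norm (f w) powr enn2real p) \<partial>surface_measure) \<le> ennreal (a powr enn2real p)"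
  shows "Lp_norm p f \<le> ennreal a"
proof -
  define P where "P = enn2real p"
  have P: "P \<ge> 1" using enn2real_ge_1[OF p] by (simp add: P_def)
  define I where "I = (\<integral>\<^sup>+ w. ennreal (norm (f w) powr P) \<partial>surface_measure)"
  have I: "I \<le> ennreal (a powr P)" using assms(4) by (simp add: I_def P_def)
  then have fin: "I \<noteq> \<infinity>" by (metis ennreal_neq_top infinity_ennreal_def neq_top_trans)
  have "enn2real I \<le> a powr P" using enn2real_mono[OF I] by simp
  then have "enn2real I powr (1 / P) \<le> (a powr P) powr (1 / P)"
    using P by (intro powr_mono2) auto
  also have "\<dots> = a" using P a by (simp add: powr_powr)
  finally show ?thesis
    using p fin unfolding Lp_norm_def Let_def P_def[symmetric] I_def[symmetric] by (auto intro: ennreal_leI)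
qed

lemma Lp_norm_leD:
  assumes p: "1 \<le> p" "p < \<infinity>" and a: "a \<ge> 0" and le: "Lp_norm p f \<le> ennreal a"
  shows "(\<integral>\<^sup>+ w. ennreal (norm (f w) powr enn2real p) \<partial>surface_measure) \<le> ennreal (a powr enn2real p)"
proof -
  define P where "P = enn2real p"
  have P: "P \<ge> 1" using enn2real_ge_1[OF p] by (simp add: P_def)
  define I where "I = (\<integral>\<^sup>+ w. ennreal (norm (f w) powr P) \<partial>surface_measure)"
  have le': "(if I = \<infinity> then \<infinity> else ennreal (enn2real I powr (1 / P))) \<le> ennreal a"
  proof -
    have "Lp_norm p f = (if I = \<infinity> then \<infinity> else ennreal (enn2real I powr (1 / P)))"
      using p(2) by (simp add: Lp_norm_def Let_def P_def I_def)
    then show ?thesis using le by (simp only:)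
  qed
  then have fin: "I \<noteq> \<infinity>" by (auto simp: top_unique)
  then have "enn2real I powr (1 / P) \<le> a" using le' a by (simp add: ennreal_le_iff)
  then have "(enn2real I powr (1 / P)) powr P \<le> a powr P" using P by (intro powr_mono2) auto
  moreover have "(enn2real I powr (1 / P)) powr P = enn2real I" using P by (simp add: powr_powr)
  ultimately have "enn2real I \<le> a powr P" by simp
  then have "ennreal (enn2real I) \<le> ennreal (a powr P)" by (rule ennreal_leI)
  moreover have "ennreal (enn2real I) = I" using fin by (simp add: less_top)
  ultimately show ?thesis by (simp only: I_def P_def)
qed

lemma continuous_in_Lp1:
  assumes f: "continuous_on (sphere 0 1) (f :: complex ^ 'n::finite \<Rightarrow> complex)"
  shows "f \<in> Lp 1"
proof -
  have "integrable surface_measure (\<lambda>w. norm (f w))"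
    by (intro surface_integrable_continuous continuous_intros f)
  then have "(\<integral>\<^sup>+ w. ennreal (norm (f w)) \<partial>surface_measure) = ennreal (\<integral>w. norm (f w) \<partial>surface_measure)"
    by (intro nn_integral_eq_integral) auto
  then show ?thesis
    using surface_measurable_continuous[OF f] by (simp add: Lp_def Lp_norm_def Let_def powr_one')
qed

lemma nn_integral_cont_le:
  fixes F :: "complex ^ 'n::finite \<Rightarrow> real"
  assumes F: "continuous_on (sphere 0 1) F" "\<And>w. w \<in> sphere 0 1 \<Longrightarrow> 0 \<le> F w"
    and G: "\<And>w. w \<in> sphere 0 1 \<Longrightarrow> G w \<le> F w"
  shows "(\<integral>\<^sup>+ w. ennreal (G w) \<partial>surface_measure) \<le> ennreal (\<integral>w. F w \<partial>surface_measure)"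
proof -
  have "(\<integral>\<^sup>+ w. ennreal (G w) \<partial>surface_measure) \<le> (\<integral>\<^sup>+ w. ennreal (F w) \<partial>surface_measure)"
    using G by (intro nn_integral_mono ennreal_leI) simp
  also have "\<dots> = ennreal (\<integral>w. F w \<partial>surface_measure)"
    using F by (intro nn_integral_eq_integral surface_integrable_continuous AE_I2) auto
  finally show ?thesis .
qed

lemma powr_le_1_plus_power:
  assumes "0 \<le> (y :: real)" "P \<le> real t" "P \<ge> 0"
  shows "y powr P \<le> 1 + y ^ t"
proof (cases "y \<le> 1")
  case True
  then have "y powr P \<le> 1 powr P" using assms by (intro powr_mono2) auto
  then show ?thesis using assms by (simp add: add_increasing2)
next
  case False
  then have "y powr P \<le> y powr real t" using assms by (intro powr_mono) auto
  then show ?thesis using False by (simp add: powr_realpow)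
qed

text \<open>
  The comparison of norms on a space of finite measure, with a crude constant that comes from
  \<open>y\<^sup>P \<le> 1 + y\<^sup>t\<close> instead of Jensen's inequality.
\<close>

lemma in_Lp_ball_moment:
  fixes f :: "complex ^ 'n::finite \<Rightarrow> complex"
  assumes p: "1 \<le> p" "p < \<infinity>" "enn2real p \<le> real t" and f: "continuous_on (sphere 0 1) f"
    and b: "b > 0" "(\<integral>w. norm (f w) ^ t \<partial>surface_measure) \<le> b ^ t"
  shows "(\<lambda>w. of_real (1 / ((sphere_area TYPE('n) + 1) * b)) * f w) \<in> Lp_ball p"
proof -
  define P where "P = enn2real p"
  have P: "P \<ge> 1" using enn2real_ge_1[OF p(1,2)] by (simp add: P_def)
  define a where "a = sphere_area TYPE('n)"
  have a: "a > 0" unfolding a_def by (rule sphere_area_pos)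
  define u where "u = (\<lambda>w. of_real (1 / ((a + 1) * b)) * f w)"
  have uc: "continuous_on (sphere 0 1) u" unfolding u_def by (intro continuous_intros f)
  have "(\<integral>\<^sup>+ w. ennreal (norm (u w) powr P) \<partial>surface_measure) \<le>
     ennreal (\<integral>w. (1 + norm (f w) ^ t / b ^ t) / (a + 1) \<partial>surface_measure)"
  proof (rule nn_integral_cont_le)
    show "continuous_on (sphere 0 1) (\<lambda>w. (1 + norm (f w) ^ t / b ^ t) / (a + 1))"
      using a b by (intro continuous_intros f) auto
    fix w :: "complex ^ 'n"
    show "0 \<le> (1 + norm (f w) ^ t / b ^ t) / (a + 1)" using a b by simp
    have "norm (u w) powr P = (norm (f w) / b) powr P * (1 / (a + 1)) powr P"
      using a b by (simp add: u_def norm_mult powr_mult[symmetric] norm_divide mult.commute)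
    also have "\<dots> \<le> (1 + (norm (f w) / b) ^ t) * (1 / (a + 1))"
    proof (intro mult_mono)
      show "(norm (f w) / b) powr P \<le> 1 + (norm (f w) / b) ^ t"
        using b p(3) P by (intro powr_le_1_plus_power) (auto simp: P_def)
      have "(1 / (a + 1)) powr P \<le> (1 / (a + 1)) powr 1" using a P by (intro powr_mono') auto
      then show "(1 / (a + 1)) powr P \<le> 1 / (a + 1)" using a by simp
    qed (use b in auto)
    finally show "norm (u w) powr P \<le> (1 + norm (f w) ^ t / b ^ t) / (a + 1)" by (simp add: power_divide)
  qed
  also have "(\<integral>w. (1 + norm (f w) ^ t / b ^ t) / (a + 1) \<partial>surface_measure) =
      (a + (\<integral>w. norm (f w) ^ t \<partial>surface_measure) / b ^ t) / (a + 1)"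
    using f by (simp add: a_def surface_integrable_continuous continuous_intros)
  also have "\<dots> \<le> (a + 1) / (a + 1)"
    using a b by (intro divide_right_mono add_left_mono) auto
  finally have "(\<integral>\<^sup>+ w. ennreal (norm (u w) powr P) \<partial>surface_measure) \<le> ennreal (1 powr P)"
    using a by (simp add: ennreal_leI)
  then have "Lp_norm p u \<le> ennreal 1" unfolding P_def by (intro Lp_norm_leI p) auto
  then have "Lp_norm p u \<le> 1" by simp
  moreover from this have "Lp_norm p u < \<infinity>" by (rule le_less_trans) simp
  ultimately show ?thesis
    using surface_measurable_continuous[OF uc] by (simp add: Lp_ball_def Lp_def u_def a_def)
qed

lemma in_Lp_ball_sup:
  fixes f :: "complex ^ 'n::finite \<Rightarrow> complex"
  assumes f: "continuous_on (sphere 0 1) f" and b: "b > 0" "\<And>w. w \<in> sphere 0 1 \<Longrightarrow> norm (f w) \<le> b"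
  shows "(\<lambda>w. of_real (1 / ((sphere_area TYPE('n) + 1) * b)) * f w) \<in> Lp_ball \<infinity>"
proof -
  define a where "a = sphere_area TYPE('n)"
  have a: "a > 0" unfolding a_def by (rule sphere_area_pos)
  define u where "u = (\<lambda>w. of_real (1 / ((a + 1) * b)) * f w)"
  have uc: "continuous_on (sphere 0 1) u" unfolding u_def by (intro continuous_intros f)
  have um: "u \<in> borel_measurable surface_measure" by (rule surface_measurable_continuous[OF uc])
  have "norm (u w) \<le> 1" if "w \<in> sphere 0 1" for w
  proof -
    have "norm (f w) \<le> 1 * b" using b(2)[OF that] by simp
    also have "\<dots> \<le> (a + 1) * b" using a b by (intro mult_right_mono) auto
    finally have "norm (f w) \<le> (a + 1) * b" .
    moreover have "norm (u w) = \<bar>1 / ((a + 1) * b)\<bar> * norm (f w)"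
      unfolding u_def norm_mult norm_of_real ..
    moreover have "(a + 1) * b > 0" using a b by simp
    ultimately show ?thesis by (simp add: pos_divide_le_eq)
  qed
  then have "AE w in surface_measure. ennreal (norm (u w)) \<le> 1" by (intro AE_I2) simp
  then have "esssup surface_measure (\<lambda>w. ennreal (norm (u w))) \<le> 1"
    using um by (intro esssup_I) auto
  then have "Lp_norm \<infinity> u \<le> 1" by (simp add: Lp_norm_def)
  moreover from this have "Lp_norm \<infinity> u < \<infinity>" by (rule le_less_trans) simp
  ultimately show ?thesis using um by (simp add: Lp_ball_def Lp_def u_def a_def)
qed

text \<open>
  Hoelder's inequality with \<open>b\<close> in place of the dual norm of \<open>w\<close>, up to a constant. In this form the
  cases of finite \<open>q\<close>, \<open>q = \<infinity>\<close> and \<open>q = 1\<close> can be used alike.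
\<close>

definition dual_bound :: "ennreal \<Rightarrow> (complex ^ 'n::finite \<Rightarrow> complex) \<Rightarrow> real \<Rightarrow> bool" where
  "dual_bound q w b \<longleftrightarrow> (\<forall>u\<in>borel_measurable surface_measure. \<forall>a>0. Lp_norm q u \<le> ennreal a \<longrightarrow>
     (\<integral>\<^sup>+ z. ennreal (norm (u z) * norm (w z)) \<partial>surface_measure) \<le> ennreal ((sphere_area TYPE('n) + 2) * a * b))"

text \<open>
  The condition on \<open>t\<close> says that \<open>t\<close> is at least the exponent dual to \<open>P\<close>. Either \<open>y\<close> is at most
  \<open>x\<^bsup>P-1\<^esup>\<close>, or \<open>x\<close> is less than \<open>y\<^bsup>1/(P-1)\<^esup>\<close>.
\<close>

lemma young_crude:
  assumes x: "0 \<le> (x :: real)" and y: "0 \<le> y" and P: "P > 1" "P \<le> real t * (P - 1)"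
  shows "x * y \<le> 1 + x powr P + y ^ t"
proof (cases "y \<le> x powr (P - 1)")
  case True
  then have "x * y \<le> x * x powr (P - 1)" using x by (intro mult_left_mono)
  also have "\<dots> = x powr P" using x by (cases "x = 0") (auto simp: powr_mult_base)
  finally show ?thesis using y by (simp add: add_increasing2 add_increasing)
next
  case False
  then have xy: "x powr (P - 1) < y" by simp
  then have y0: "y > 0" using powr_ge_zero le_less_trans by blast
  have "x = (x powr (P - 1)) powr (1 / (P - 1))" using x P by (simp add: powr_powr)
  also have "\<dots> \<le> y powr (1 / (P - 1))" using xy P by (intro powr_mono2) auto
  finally have "x * y \<le> y powr (1 / (P - 1)) * y powr 1" using y by (auto intro: mult_right_mono)
  also have "\<dots> = y powr (P / (P - 1))"
    using P by (simp only: powr_add[symmetric]) (simp add: field_simps)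
  also have "\<dots> \<le> 1 + y ^ t"
    using P y by (intro powr_le_1_plus_power) (auto simp: field_simps)
  finally show ?thesis using powr_ge_zero[of x P] by linarith
qed

lemma dual_bound_moment:
  fixes w :: "complex ^ 'n::finite \<Rightarrow> complex"
  assumes q: "1 \<le> q" "q < \<infinity> \<Longrightarrow> 1 < enn2real q \<and> enn2real q \<le> real t * (enn2real q - 1)" and t: "t \<ge> 1"
    and w: "continuous_on (sphere 0 1) w" and b: "b > 0" "(\<integral>z. norm (w z) ^ t \<partial>surface_measure) \<le> b ^ t"
  shows "dual_bound q w b"
  unfolding dual_bound_def
proof (intro ballI allI impI)
  fix u :: "complex ^ 'n \<Rightarrow> complex" and a :: real
  assume u [measurable]: "u \<in> borel_measurable surface_measure" and a: "a > 0" and ua: "Lp_norm q u \<le> ennreal a"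
  have w' [measurable]: "w \<in> borel_measurable surface_measure" by (rule surface_measurable_continuous[OF w])
  define s where "s = sphere_area TYPE('n)"
  have s: "s > 0" unfolding s_def by (rule sphere_area_pos)
  have cF: "continuous_on (sphere 0 1) (\<lambda>z. a * b * (1 + norm (w z) ^ t / b ^ t))"
    using b by (intro continuous_intros w) auto
  have IF: "(\<integral>z. a * b * (1 + norm (w z) ^ t / b ^ t) \<partial>surface_measure) \<le> a * b * (s + 1)"
  proof -
    have "(\<integral>z. a * b * (1 + norm (w z) ^ t / b ^ t) \<partial>surface_measure) = a * b * (s + (\<integral>z. norm (w z) ^ t \<partial>surface_measure) / b ^ t)"
      using w by (simp add: s_def surface_integrable_continuous continuous_intros)
    also have "\<dots> \<le> a * b * (s + 1)"
      using a b by (intro mult_left_mono add_left_mono) auto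
    finally show ?thesis .
  qed
  have IF': "(\<integral>\<^sup>+ z. ennreal (a * b * (1 + norm (w z) ^ t / b ^ t)) \<partial>surface_measure) \<le> ennreal (a * b * (s + 1))"
    using nn_integral_cont_le[OF cF, of "\<lambda>z. a * b * (1 + norm (w z) ^ t / b ^ t)"] a b IF
    by (auto intro: order_trans[OF _ ennreal_leI])
  show "(\<integral>\<^sup>+ z. ennreal (norm (u z) * norm (w z)) \<partial>surface_measure) \<le> ennreal ((sphere_area TYPE('n) + 2) * a * b)"
  proof (cases "q = \<infinity>")
    case True
    have "AE z in surface_measure. ennreal (norm (u z)) \<le> esssup surface_measure (\<lambda>z. ennreal (norm (u z)))"
      by (rule esssup_AE) 
    then have ae: "AE z in surface_measure. norm (u z) \<le> a"
      using ua a True by (auto simp: Lp_norm_def elim!: eventually_mono dest: order_trans)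
    have "(\<integral>\<^sup>+ z. ennreal (norm (u z) * norm (w z)) \<partial>surface_measure) \<le> (\<integral>\<^sup>+ z. ennreal (a * b * (1 + norm (w z) ^ t / b ^ t)) \<partial>surface_measure)"
    proof (rule nn_integral_mono_AE, use ae in eventually_elim)
      fix z assume z: "norm (u z) \<le> a"
      have "norm (w z) / b \<le> 1 + (norm (w z) / b) ^ t"
        using powr_le_1_plus_power[of "norm (w z) / b" 1 t] b t by simp
      then have "norm (w z) \<le> b * (1 + norm (w z) ^ t / b ^ t)"
        using b by (simp add: power_divide field_simps)
      then have "norm (u z) * norm (w z) \<le> a * (b * (1 + norm (w z) ^ t / b ^ t))"
        using z a by (intro mult_mono) auto
      then show "ennreal (norm (u z) * norm (w z)) \<le> ennreal (a * b * (1 + norm (w z) ^ t / b ^ t))"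
        by (intro ennreal_leI) (simp add: mult.assoc)
    qed
    also note IF'
    also have "ennreal (a * b * (s + 1)) \<le> ennreal ((sphere_area TYPE('n) + 2) * a * b)"
      using a b by (intro ennreal_leI) (simp add: s_def algebra_simps)
    finally show ?thesis .
  next
    case False
    then have q': "q < \<infinity>" by (simp add: less_top)
    define P where "P = enn2real q"
    have P: "P > 1" "P \<le> real t * (P - 1)" using q(2)[OF q'] by (auto simp: P_def)
    have I: "(\<integral>\<^sup>+ z. ennreal (norm (u z) powr P) \<partial>surface_measure) \<le> ennreal (a powr P)"
      using Lp_norm_leD[OF q(1) q' _ ua] a by (simp add: P_def)
    have "(\<integral>\<^sup>+ z. ennreal (norm (u z) * norm (w z)) \<partial>surface_measure) \<le>
      (\<integral>\<^sup>+ z. ennreal (a * b / a powr P) * ennreal (norm (u z) powr P) + ennreal (a * b * (1 + norm (w z) ^ t / b ^ t)) \<partial>surface_measure)"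
    proof (rule nn_integral_mono)
      fix z
      have "(norm (u z) / a) * (norm (w z) / b) \<le> 1 + (norm (u z) / a) powr P + (norm (w z) / b) ^ t"
        using a b P by (intro young_crude) auto
      then have "a * b * ((norm (u z) / a) * (norm (w z) / b)) \<le> a * b * (1 + (norm (u z) / a) powr P + (norm (w z) / b) ^ t)"
        using a b by (intro mult_left_mono) auto
      also have "a * b * ((norm (u z) / a) * (norm (w z) / b)) = norm (u z) * norm (w z)"
        using a b by simp
      also have "a * b * (1 + (norm (u z) / a) powr P + (norm (w z) / b) ^ t) =
          a * b / a powr P * norm (u z) powr P + a * b * (1 + norm (w z) ^ t / b ^ t)"
        using a by (simp add: powr_divide power_divide algebra_simps)
      finally have "ennreal (norm (u z) * norm (w z)) \<le> ennreal (a * b / a powr P * norm (u z) powr P + a * b * (1 + norm (w z) ^ t / b ^ t))"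
        by (rule ennreal_leI)
      also have "\<dots> = ennreal (a * b / a powr P) * ennreal (norm (u z) powr P) + ennreal (a * b * (1 + norm (w z) ^ t / b ^ t))"
      proof -
        have "ennreal (a * b / a powr P * norm (u z) powr P) = ennreal (a * b / a powr P) * ennreal (norm (u z) powr P)"
          using a b by (intro ennreal_mult) auto
        moreover have "0 \<le> a * b / a powr P * norm (u z) powr P" "0 \<le> a * b * (1 + norm (w z) ^ t / b ^ t)"
          using a b by simp_all
        ultimately show ?thesis by (simp only: ennreal_plus)
      qed
      finally show "ennreal (norm (u z) * norm (w z)) \<le> \<dots>" .
    qed
    also have "\<dots> = ennreal (a * b / a powr P) * (\<integral>\<^sup>+ z. ennreal (norm (u z) powr P) \<partial>surface_measure) +
        (\<integral>\<^sup>+ z. ennreal (a * b * (1 + norm (w z) ^ t / b ^ t)) \<partial>surface_measure)"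
      by (subst nn_integral_add) (auto simp: nn_integral_cmult)
    also have "\<dots> \<le> ennreal (a * b / a powr P) * ennreal (a powr P) + ennreal (a * b * (s + 1))"
      by (intro add_mono mult_left_mono I IF') auto
    also have "\<dots> = ennreal (a * b + a * b * (s + 1))"
      using a b s by (simp add: ennreal_mult[symmetric])
    also have "\<dots> = ennreal ((sphere_area TYPE('n) + 2) * a * b)"
      by (simp add: s_def algebra_simps)
    finally show ?thesis .
  qed
qed

lemma dual_bound_sup:
  fixes w :: "complex ^ 'n::finite \<Rightarrow> complex"
  assumes w: "continuous_on (sphere 0 1) w" and b: "b > 0" "\<And>z. z \<in> sphere 0 1 \<Longrightarrow> norm (w z) \<le> b"
  shows "dual_bound 1 w b"
  unfolding dual_bound_def
proof (intro ballI allI impI)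
  fix u :: "complex ^ 'n \<Rightarrow> complex" and a :: real
  assume u [measurable]: "u \<in> borel_measurable surface_measure" and a: "a > 0" and ua: "Lp_norm 1 u \<le> ennreal a"
  have I: "(\<integral>\<^sup>+ z. ennreal (norm (u z)) \<partial>surface_measure) \<le> ennreal a"
    using Lp_norm_leD[OF _ _ _ ua] a by (simp add: powr_one')
  have "(\<integral>\<^sup>+ z. ennreal (norm (u z) * norm (w z)) \<partial>surface_measure) \<le> (\<integral>\<^sup>+ z. ennreal b * ennreal (norm (u z)) \<partial>surface_measure)"
  proof (rule nn_integral_mono)
    fix z :: "complex ^ 'n" assume "z \<in> space surface_measure"
    then have "norm (u z) * norm (w z) \<le> norm (u z) * b" using b(2) by (intro mult_left_mono) auto
    then show "ennreal (norm (u z) * norm (w z)) \<le> ennreal b * ennreal (norm (u z))"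
      using b(1) by (simp add: ennreal_mult[symmetric] ennreal_leI mult.commute)
  qed
  also have "\<dots> = ennreal b * (\<integral>\<^sup>+ z. ennreal (norm (u z)) \<partial>surface_measure)"
    by (rule nn_integral_cmult) auto
  also have "\<dots> \<le> ennreal b * ennreal a" by (intro mult_left_mono I) auto
  also have "\<dots> = ennreal (b * a)" using a b by (simp add: ennreal_mult)
  also have "\<dots> \<le> ennreal ((sphere_area TYPE('n) + 2) * a * b)"
  proof (rule ennreal_leI)
    have "1 * (a * b) \<le> (sphere_area TYPE('n) + 2) * (a * b)"
      using a b sphere_area_pos[where 'n = 'n] by (intro mult_right_mono) auto
    then show "b * a \<le> (sphere_area TYPE('n) + 2) * a * b" by (simp add: mult_ac)
  qed
  finally show "(\<integral>\<^sup>+ z. ennreal (norm (u z) * norm (w z)) \<partial>surface_measure) \<le> ennreal ((sphere_area TYPE('n) + 2) * a * b)" .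
qed

lemma Lp_integrable:
  fixes g :: "complex ^ 'n::finite \<Rightarrow> complex"
  assumes q: "1 \<le> q" and g: "g \<in> Lp q"
  shows "integrable surface_measure g"
proof (cases "q = \<infinity>")
  case True
  have gm: "g \<in> borel_measurable surface_measure" using g by (simp add: Lp_def)
  have fin: "esssup surface_measure (\<lambda>z. ennreal (norm (g z))) < \<infinity>" using g True by (simp add: Lp_def Lp_norm_def)
  have "AE z in surface_measure. ennreal (norm (g z)) \<le> esssup surface_measure (\<lambda>z. ennreal (norm (g z)))"
    by (rule esssup_AE)
  then have "AE z in surface_measure. norm (g z) \<le> enn2real (esssup surface_measure (\<lambda>z. ennreal (norm (g z))))"
  proof eventually_elim
    case (elim z)
    from enn2real_mono[OF elim] fin show ?case by simp
  qed
  then show ?thesis by (rule surface.integrable_const_bound) (rule gm)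
next
  case False
  then have q': "q < \<infinity>" by (simp add: less_top)
  define P where "P = enn2real q"
  have P: "P \<ge> 1" using enn2real_ge_1[OF q q'] by (simp add: P_def)
  have gm [measurable]: "g \<in> borel_measurable surface_measure" using g by (simp add: Lp_def)
  have "Lp_norm q g < \<infinity>" using g by (simp add: Lp_def)
  then obtain a where a: "a \<ge> 0" "Lp_norm q g = ennreal a" by (metis ennreal_cases infinity_ennreal_def less_irrefl)
  have I: "(\<integral>\<^sup>+ z. ennreal (norm (g z) powr P) \<partial>surface_measure) \<le> ennreal (a powr P)"
    using Lp_norm_leD[OF q q' a(1), of g] a(2) by (simp add: P_def)
  show ?thesis
  proof (rule integrableI_bounded[OF gm])
    have "(\<integral>\<^sup>+ z. ennreal (norm (g z)) \<partial>surface_measure) \<le> (\<integral>\<^sup>+ z. 1 + ennreal (norm (g z) powr P) \<partial>(surface_measure :: (complex ^ 'n) measure))"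
    proof (rule nn_integral_mono)
      fix z
      have "norm (g z) \<le> 1 + norm (g z) powr P"
      proof (cases "norm (g z) \<le> 1")
        case False
        then have "norm (g z) powr 1 \<le> norm (g z) powr P" using P by (intro powr_mono) auto
        then show ?thesis by simp
      qed (simp add: add_increasing2)
      then have "ennreal (norm (g z)) \<le> ennreal (1 + norm (g z) powr P)" by (rule ennreal_leI)
      then show "ennreal (norm (g z)) \<le> 1 + ennreal (norm (g z) powr P)" by (simp add: ennreal_plus)
    qed
    also have "\<dots> = emeasure (surface_measure :: (complex ^ 'n) measure) (sphere 0 1) + (\<integral>\<^sup>+ z. ennreal (norm (g z) powr P) \<partial>surface_measure)"
      by (subst nn_integral_add) auto
    also have "\<dots> < \<infinity>" using emeasure_surface_finite[where 'n = 'n] le_less_trans[OF I ennreal_less_top] by (simp add: ennreal_add_less_top)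
    finally show "(\<integral>\<^sup>+ z. ennreal (norm (g z)) \<partial>surface_measure) < \<infinity>" .
  qed
qed

lemma integrable_mult_cont:
  fixes g w :: "complex ^ 'n::finite \<Rightarrow> complex"
  assumes g: "integrable surface_measure g" and w: "continuous_on (sphere 0 1) w"
  shows "integrable surface_measure (\<lambda>z. g z * cnj (w z))"
proof -
  have "bounded (w ` sphere 0 1)"
    using w by (intro compact_imp_bounded compact_continuous_image compact_sphere)
  then obtain B where B: "\<forall>x\<in>sphere 0 1. norm (w x) \<le> B" by (auto simp: bounded_iff)
  have wm: "w \<in> borel_measurable surface_measure" by (rule surface_measurable_continuous[OF w])
  have gm: "g \<in> borel_measurable surface_measure" using g by (rule borel_measurable_integrable)
  show ?thesis
  proof (rule Bochner_Integration.integrable_bound[OF integrable_mult_left[OF g, of "of_real B"]])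
    show "(\<lambda>z. g z * cnj (w z)) \<in> borel_measurable surface_measure"
      using gm borel_measurable_continuous_onI[OF continuous_on_cnj[OF continuous_on_id]] measurable_compose[OF wm]
      by (intro borel_measurable_times) auto
    show "AE z in surface_measure. norm (g z * cnj (w z)) \<le> norm (g z * of_real B)"
    proof (rule AE_I2)
      fix z :: "complex ^ 'n" assume "z \<in> space surface_measure"
      then have "norm (w z) \<le> \<bar>B\<bar>" using B by force
      then show "norm (g z * cnj (w z)) \<le> norm (g z * of_real B)"
        by (simp add: norm_mult mult_left_mono)
    qed
  qed
qed

section \<open>Lower bounds for widths by duality\<close>

text \<open>
  Testing \<open>f - g\<close> against a function \<open>w\<close> that annihilates the approximating subspace removes \<open>g\<close>.
\<close>

lemma kolmogorov_width_ge:
  fixes A :: "(complex ^ 'n::finite \<Rightarrow> complex) set"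
  assumes q: "1 \<le> q" and b: "b > 0" and tau: "tau > 0"
    and wit: "\<And>B. B \<subseteq> Lp q \<Longrightarrow> finite B \<Longrightarrow> card B = n \<Longrightarrow>
      \<exists>f\<in>A. \<exists>w. continuous_on (sphere 0 1) f \<and> continuous_on (sphere 0 1) w \<and> dual_bound q w b \<and>
        (\<forall>g\<in>B. (\<integral>z. g z * cnj (w z) \<partial>surface_measure) = 0) \<and> tau \<le> norm (sip f w)"
  shows "ennreal (tau / (2 * (sphere_area TYPE('n) + 2) * b)) \<le> kolmogorov_width n A q"
  unfolding kolmogorov_width_def
proof (rule INF_greatest)
  fix Y :: "(complex ^ 'n \<Rightarrow> complex) set" assume "Y \<in> Lp_subspaces q n"
  then obtain B where B: "Y = cfun.span B" "B \<subseteq> Lp q" "finite B" "card B = n"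
    by (auto simp: Lp_subspaces_def)
  from wit[OF B(2-4)] obtain f w where f: "f \<in> A" "continuous_on (sphere 0 1) f"
    and w: "continuous_on (sphere 0 1) w" "dual_bound q w b"
    and orth: "\<forall>g\<in>B. (\<integral>z. g z * cnj (w z) \<partial>surface_measure) = 0" and t: "tau \<le> norm (sip f w)" by blast
  define s where "s = sphere_area TYPE('n)"
  have s: "s > 0" unfolding s_def by (rule sphere_area_pos)
  define c where "c = tau / (2 * (s + 2) * b)"
  have c: "c > 0" using b tau s by (simp add: c_def)
  have gspan: "integrable surface_measure g \<and> (\<integral>z. g z * cnj (w z) \<partial>surface_measure) = 0" if "g \<in> cfun.span B" for g
    using that
  proof (induction rule: cfun.span_induct_alt)
    case base
    show ?case by simp
  next
    case (step a x y)
    have x: "integrable surface_measure x" using Lp_integrable[OF q] step(1) B(2) by blast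
    have "integrable surface_measure (\<lambda>z. a * x z + y z)" using x step(2) by auto
    moreover have "(\<integral>z. (a * x z + y z) * cnj (w z) \<partial>surface_measure) =
        (\<integral>z. a * (x z * cnj (w z)) + y z * cnj (w z) \<partial>surface_measure)"
      by (simp add: distrib_right mult.assoc)
    moreover have "\<dots> = 0"
      using orth step integrable_mult_cont[OF x w(1)] integrable_mult_cont[OF _ w(1)] by simp
    ultimately show ?case by (simp add: plus_fun_def)
  qed
  have "ennreal c \<le> (INF g\<in>Y. Lp_norm q (f - g))"
  proof (rule INF_greatest, rule ccontr)
    fix g assume "g \<in> Y" and "\<not> ennreal c \<le> Lp_norm q (f - g)"
    then have g: "integrable surface_measure g" "(\<integral>z. g z * cnj (w z) \<partial>surface_measure) = 0" and le: "Lp_norm q (f - g) \<le> ennreal c"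
      using gspan B(1) by auto
    have fi: "integrable surface_measure f" by (rule surface_integrable_continuous[OF f(2)])
    have fgi: "integrable surface_measure (\<lambda>z. f z - g z)" using fi g(1) by simp
    then have "f - g \<in> borel_measurable surface_measure" by (simp add: fun_diff_def borel_measurable_integrable)
    then have I: "(\<integral>\<^sup>+ z. ennreal (norm ((f - g) z) * norm (w z)) \<partial>surface_measure) \<le> ennreal ((s + 2) * c * b)"
      using w(2) c le unfolding dual_bound_def s_def by blast
    have hi: "integrable surface_measure (\<lambda>z. (f z - g z) * cnj (w z))" by (rule integrable_mult_cont[OF fgi w(1)])
    have "sip f w = (\<integral>z. (f z - g z) * cnj (w z) \<partial>surface_measure)"
      using integrable_mult_cont[OF fi w(1)] integrable_mult_cont[OF g(1) w(1)] g(2)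
      by (simp add: sip_def left_diff_distrib)
    then have "ennreal (norm (sip f w)) \<le> (\<integral>\<^sup>+ z. ennreal (norm ((f z - g z) * cnj (w z))) \<partial>surface_measure)"
      using integral_norm_bound_ennreal[OF hi] by simp
    also have "\<dots> \<le> ennreal ((s + 2) * c * b)" using I by (simp add: norm_mult)
    also have "(s + 2) * c * b = tau / 2"
    proof -
      have "(s + 2) * c * b = tau * ((s + 2) * b) / (2 * ((s + 2) * b))" by (simp add: c_def mult_ac)
      also have "\<dots> = tau / 2" using b s by simp
      finally show ?thesis .
    qed
    finally have "norm (sip f w) \<le> tau / 2" using tau by (simp add: ennreal_le_iff)
    then show False using t tau by simp
  qed
  also have "\<dots> \<le> (SUP f\<in>A. INF g\<in>Y. Lp_norm q (f - g))" using f(1) by (rule SUP_upper)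
  finally show "ennreal (tau / (2 * (sphere_area TYPE('n) + 2) * b)) \<le> (SUP f\<in>A. INF g\<in>Y. Lp_norm q (f - g))"
    by (simp add: c_def s_def)
qed

section \<open>Widths of multiplier images\<close>

abbreviation image_of_ball :: "(nat \<Rightarrow> real) \<Rightarrow> ennreal \<Rightarrow> (complex ^ 'n::finite \<Rightarrow> complex) set" where
  "image_of_ball lam p \<equiv> multiplier_image (\<lambda>m n. of_real (lam (max m n))) (Lp_ball p)"

lemma sip_comb: "sip (comb N c) (comb N d) = (\<Sum>e\<in>tbasis N. c e * cnj (d e))"
  unfolding comb_def by (rule orthonormal_norm_sum[OF finite_tbasis orthonormal_tbasis])

lemma integral_mult_comb:
  fixes g :: "complex ^ 'n::finite \<Rightarrow> complex"
  assumes g: "integrable surface_measure g"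
  shows "(\<integral>z. g z * cnj (comb N d z) \<partial>surface_measure) = (\<Sum>e\<in>tbasis N. cnj (d e) * (\<integral>z. g z * cnj (e z) \<partial>surface_measure))"
proof -
  have "(\<integral>z. g z * cnj (comb N d z) \<partial>surface_measure) = (\<integral>z. (\<Sum>e\<in>tbasis N. cnj (d e) * (g z * cnj (e z))) \<partial>surface_measure)"
    by (simp add: comb_def sum_distrib_left mult_ac)
  also have "\<dots> = (\<Sum>e\<in>tbasis N. \<integral>z. cnj (d e) * (g z * cnj (e z)) \<partial>surface_measure)"
    by (intro Bochner_Integration.integral_sum integrable_mult_right integrable_mult_cont[OF g] orthonormalD[OF orthonormal_tbasis])
  finally show ?thesis by simp
qed

lemma comb_scale: "(\<lambda>w. a * comb N c w) = comb N (\<lambda>e. a * c e)"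
  by (simp add: comb_def sum_distrib_left mult.assoc)

lemma comb_multiplier_image:
  fixes c :: "(complex ^ 'n::finite \<Rightarrow> complex) \<Rightarrow> complex"
  assumes "comb N c \<in> Lp_ball p"
  shows "comb N (\<lambda>e. of_real (lam (level e)) * c e) \<in> image_of_ball lam p"
proof -
  have "is_multiplier_value (\<lambda>m n. of_real (lam (max m n))) (comb N c) (comb N (\<lambda>e. of_real (lam (level e)) * c e))"
    unfolding is_multiplier_value_def
  proof (intro conjI allI ballI)
    show "comb N (\<lambda>e. of_real (lam (level e)) * c e) \<in> Lp 1" by (rule continuous_in_Lp1[OF comb_cont])
    fix m n :: nat and w :: "complex ^ 'n" assume "w \<in> sphere 0 1"
    then show "kernel_conv (comb N (\<lambda>e. of_real (lam (level e)) * c e)) m n w = of_real (lam (max m n)) * kernel_conv (comb N c) m n w"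
      unfolding comb_def by (rule kernel_conv_multiplier)
  qed
  then show ?thesis using assms by (auto simp: multiplier_image_def)
qed

lemma norm_comb_square:
  fixes x :: "(complex ^ 'n::finite \<Rightarrow> complex) \<Rightarrow> complex"
  shows "(\<integral>w. norm (comb N x w) ^ 2 \<partial>surface_measure) = (\<Sum>e\<in>tbasis N. (norm (x e))\<^sup>2)"
proof -
  have "of_real (\<integral>w. norm (comb N x w) ^ 2 \<partial>surface_measure) = (\<Sum>e\<in>tbasis N. x e * cnj (x e))"
    using sip_comb[of N x x] by (simp only: sip_self)
  also have "\<dots> = of_real (\<Sum>e\<in>tbasis N. (norm (x e))\<^sup>2)"
    unfolding of_real_sum complex_norm_square ..
  finally show ?thesis by (simp only: of_real_eq_iff)
qed

lemma enn2real_le_2: "p \<le> 2 \<Longrightarrow> enn2real p \<le> 2"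
  using enn2real_mono[of p 2] by simp

text \<open>
  The two factors are the normalization in \<open>in_Lp_ball_moment\<close> and the constant in
  \<open>kolmogorov_width_ge\<close>.
\<close>

definition width_factor :: "'n::finite itself \<Rightarrow> real" where
  "width_factor _ = 1 / (2 * (sphere_area TYPE('n) + 1) * (sphere_area TYPE('n) + 2))"

lemma width_factor_pos: "width_factor TYPE('n::finite) > 0"
  using sphere_area_pos[where 'n = 'n] by (simp add: width_factor_def)

text \<open>
  The case \<open>p \<le> 2\<close>: the multiple \<open>\<delta> \<Lambda> h\<close> lies in the ball because it is small in \<open>L\<^sup>2\<close>, and its image
  \<open>\<delta> \<Lambda>\<^sup>2 h\<close> is paired with \<open>h\<close>, which gives \<open>\<delta>\<close> times the squared norm of \<open>\<Lambda> h\<close>.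
\<close>

lemma width_ge_small_p:
  fixes lam :: "nat \<Rightarrow> real"
  assumes p: "1 \<le> p" "p \<le> 2" and q: "1 \<le> q" and n: "n < phi TYPE('n::finite) N" and l: "l \<ge> 1"
    and lam: "\<And>i. lam i > 0" and b: "b > 0"
    and S: "(\<Sum>e\<in>(tbasis N :: (complex ^ 'n \<Rightarrow> complex) set). 1 / (lam (level e))\<^sup>2) \<le> S * real (phi TYPE('n) N - n)"
    and db: "\<And>h :: complex ^ 'n \<Rightarrow> complex. h \<in> T N \<Longrightarrow> continuous_on (sphere 0 1) h \<Longrightarrow>
      (\<integral>z. norm (h z) ^ (2 * l) \<partial>surface_measure) \<le> sphere_area TYPE('n) * (8 * exp 1 * real l * (S / sphere_area TYPE('n))) ^ l \<Longrightarrow>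
      dual_bound q h b"
  shows "ennreal (width_factor TYPE('n) / b) \<le>
    kolmogorov_width n (image_of_ball lam p :: (complex ^ 'n \<Rightarrow> complex) set) q"
proof -
  let ?A = "image_of_ball lam p :: (complex ^ 'n \<Rightarrow> complex) set"
  define s where "s = sphere_area TYPE('n)"
  have s: "s > 0" unfolding s_def by (rule sphere_area_pos)
  define \<delta> where "\<delta> = 1 / ((s + 1) * 1)"
  have \<delta>: "\<delta> > 0" using s by (simp add: \<delta>_def)
  have "ennreal (\<delta> / (2 * (sphere_area TYPE('n) + 2) * b)) \<le> kolmogorov_width n ?A q"
  proof (rule kolmogorov_width_ge[OF q b \<delta>])
    fix B :: "(complex ^ 'n \<Rightarrow> complex) set" assume B: "B \<subseteq> Lp q" "finite B" "card B = n"
    define c where "c g e = cnj (\<integral>z. g z * cnj (e z) \<partial>surface_measure) / of_real (lam (level e))"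
      for g e :: "complex ^ 'n \<Rightarrow> complex"
    obtain x where x: "\<forall>g\<in>B. (\<Sum>e\<in>tbasis N. c g e * x e) = 0" "(\<Sum>e\<in>tbasis N. (norm (x e))\<^sup>2) = 1"
      "(\<integral>z. norm (comb N (\<lambda>e. x e / of_real (lam (level e))) z) ^ (2 * l) \<partial>surface_measure)
         \<le> sphere_area TYPE('n) * (8 * exp 1 * real l * (S / sphere_area TYPE('n))) ^ l"
      using small_moment_in_kernel[of B N l lam S c] B n l lam S by blast
    define h where "h = comb N (\<lambda>e. x e / of_real (lam (level e)))"
    define f where "f = comb N (\<lambda>e. of_real (lam (level e)) * (of_real \<delta> * x e))"
    have "dual_bound q h b" unfolding h_def by (rule db[OF comb_in_T comb_cont x(3)])
    moreover have "f \<in> ?A"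
    proof -
      have "(\<integral>w. norm (comb N x w) ^ 2 \<partial>surface_measure) \<le> 1 ^ 2" unfolding norm_comb_square x(2) by simp
      then have "(\<lambda>w. of_real \<delta> * comb N x w) \<in> Lp_ball p"
        unfolding \<delta>_def s_def using p enn2real_le_2[OF p(2)]
        by (intro in_Lp_ball_moment[where t = 2] comb_cont) (auto intro: le_less_trans)
      then show ?thesis unfolding f_def comb_scale by (rule comb_multiplier_image)
    qed
    moreover have "(\<integral>z. g z * cnj (h z) \<partial>surface_measure) = 0" if g: "g \<in> B" for g
    proof -
      have "integrable surface_measure g" using Lp_integrable[OF q] g B(1) by blast
      then have "(\<integral>z. g z * cnj (h z) \<partial>surface_measure) = (\<Sum>e\<in>tbasis N. cnj (x e / of_real (lam (level e))) * (\<integral>z. g z * cnj (e z) \<partial>surface_measure))"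
        unfolding h_def by (rule integral_mult_comb)
      also have "\<dots> = cnj (\<Sum>e\<in>tbasis N. c g e * x e)" by (simp add: c_def mult.commute)
      also have "\<dots> = 0" using x(1) g by simp
      finally show ?thesis .
    qed
    moreover have "sip f h = of_real \<delta>"
    proof -
      have "sip f h = (\<Sum>e\<in>tbasis N. of_real \<delta> * (x e * cnj (x e)))"
        unfolding f_def h_def sip_comb
      proof (rule sum.cong[OF refl])
        fix e
        show "of_real (lam (level e)) * (of_real \<delta> * x e) * cnj (x e / of_real (lam (level e))) = of_real \<delta> * (x e * cnj (x e))"
          using lam[of "level e"] by simp
      qed
      also have "\<dots> = of_real \<delta> * of_real (\<Sum>e\<in>tbasis N. (norm (x e))\<^sup>2)"
        unfolding of_real_sum complex_norm_square sum_distrib_left ..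
      finally show ?thesis by (simp add: x(2))
    qed
    then have "\<delta> \<le> norm (sip f h)" using \<delta> by simp
    moreover have "continuous_on (sphere 0 1) f" "continuous_on (sphere 0 1) h"
      unfolding f_def h_def by (rule comb_cont)+
    ultimately show "\<exists>f\<in>?A. \<exists>w. continuous_on (sphere 0 1) f \<and> continuous_on (sphere 0 1) w \<and> dual_bound q w b \<and>
        (\<forall>g\<in>B. (\<integral>z. g z * cnj (w z) \<partial>surface_measure) = 0) \<and> \<delta> \<le> norm (sip f w)" by blast
  qed
  also have "\<delta> / (2 * (sphere_area TYPE('n) + 2) * b) = width_factor TYPE('n) / b"
    by (simp add: \<delta>_def s_def width_factor_def algebra_simps)
  finally show ?thesis .
qed

text \<open>
  The case \<open>q \<ge> 2\<close>: a multiple of \<open>h\<close> lies in the ball, and its image is paired with \<open>\<Lambda> h\<close>, whose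
  \<open>L\<^sup>2\<close> norm controls the pairing on \<open>L\<^sup>q\<close>.
\<close>

lemma width_ge_large_q:
  fixes lam :: "nat \<Rightarrow> real"
  assumes q: "2 \<le> q" and n: "n < phi TYPE('n::finite) N" and l: "l \<ge> 1"
    and lam: "\<And>i. lam i > 0" and b: "b > 0"
    and S: "(\<Sum>e\<in>(tbasis N :: (complex ^ 'n \<Rightarrow> complex) set). 1 / (lam (level e))\<^sup>2) \<le> S * real (phi TYPE('n) N - n)"
    and ball: "\<And>h :: complex ^ 'n \<Rightarrow> complex. h \<in> T N \<Longrightarrow> continuous_on (sphere 0 1) h \<Longrightarrow>
      (\<integral>z. norm (h z) ^ (2 * l) \<partial>surface_measure) \<le> sphere_area TYPE('n) * (8 * exp 1 * real l * (S / sphere_area TYPE('n))) ^ l \<Longrightarrow>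
      (\<lambda>w. of_real (1 / ((sphere_area TYPE('n) + 1) * b)) * h w) \<in> Lp_ball p"
  shows "ennreal (width_factor TYPE('n) / b) \<le>
    kolmogorov_width n (image_of_ball lam p :: (complex ^ 'n \<Rightarrow> complex) set) q"
proof -
  let ?A = "image_of_ball lam p :: (complex ^ 'n \<Rightarrow> complex) set"
  define s where "s = sphere_area TYPE('n)"
  have s: "s > 0" unfolding s_def by (rule sphere_area_pos)
  define \<delta> where "\<delta> = 1 / ((s + 1) * b)"
  have \<delta>: "\<delta> > 0" using s b by (simp add: \<delta>_def)
  have q1: "1 \<le> q" using q by (rule order_trans[rotated]) simp
  have q2: "1 < enn2real q \<and> enn2real q \<le> real 2 * (enn2real q - 1)" if "q < \<infinity>"
  proof -
    have "2 \<le> enn2real q" using enn2real_mono[of 2 q] q that by simp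
    moreover have "2 \<le> x \<Longrightarrow> 1 < x \<and> x \<le> real 2 * (x - 1)" for x :: real by auto
    ultimately show ?thesis by blast
  qed
  have "ennreal (\<delta> / (2 * (sphere_area TYPE('n) + 2) * 1)) \<le> kolmogorov_width n ?A q"
  proof (rule kolmogorov_width_ge[OF q1 _ \<delta>])
    fix B :: "(complex ^ 'n \<Rightarrow> complex) set" assume B: "B \<subseteq> Lp q" "finite B" "card B = n"
    define c where "c g e = cnj (\<integral>z. g z * cnj (e z) \<partial>surface_measure)"
      for g e :: "complex ^ 'n \<Rightarrow> complex"
    obtain x where x: "\<forall>g\<in>B. (\<Sum>e\<in>tbasis N. c g e * x e) = 0" "(\<Sum>e\<in>tbasis N. (norm (x e))\<^sup>2) = 1"
      "(\<integral>z. norm (comb N (\<lambda>e. x e / of_real (lam (level e))) z) ^ (2 * l) \<partial>surface_measure)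
         \<le> sphere_area TYPE('n) * (8 * exp 1 * real l * (S / sphere_area TYPE('n))) ^ l"
      using small_moment_in_kernel[of B N l lam S c] B n l lam S by blast
    define w where "w = comb N x"
    define f where "f = comb N (\<lambda>e. of_real (lam (level e)) * (of_real \<delta> * (x e / of_real (lam (level e)))))"
    have "dual_bound q w 1" unfolding w_def
    proof (rule dual_bound_moment[OF q1 q2])
      show "(\<integral>z. norm (comb N x z) ^ 2 \<partial>surface_measure) \<le> 1 ^ 2" unfolding norm_comb_square x(2) by simp
    qed (auto intro: comb_cont)
    moreover have "f \<in> ?A"
    proof -
      have "(\<lambda>w. of_real \<delta> * comb N (\<lambda>e. x e / of_real (lam (level e))) w) \<in> Lp_ball p"
        unfolding \<delta>_def s_def by (rule ball[OF comb_in_T comb_cont x(3)])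
      then show ?thesis unfolding f_def comb_scale by (rule comb_multiplier_image)
    qed
    moreover have "(\<integral>z. g z * cnj (w z) \<partial>surface_measure) = 0" if g: "g \<in> B" for g
    proof -
      have "integrable surface_measure g" using Lp_integrable[OF q1] g B(1) by blast
      then have "(\<integral>z. g z * cnj (w z) \<partial>surface_measure) = (\<Sum>e\<in>tbasis N. cnj (x e) * (\<integral>z. g z * cnj (e z) \<partial>surface_measure))"
        unfolding w_def by (rule integral_mult_comb)
      also have "\<dots> = cnj (\<Sum>e\<in>tbasis N. c g e * x e)" by (simp add: c_def mult.commute)
      also have "\<dots> = 0" using x(1) g by simp
      finally show ?thesis .
    qed
    moreover have "sip f w = of_real \<delta>"
    proof -
      have "sip f w = (\<Sum>e\<in>tbasis N. of_real \<delta> * (x e * cnj (x e)))"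
        unfolding f_def w_def sip_comb
      proof (rule sum.cong[OF refl])
        fix e
        show "of_real (lam (level e)) * (of_real \<delta> * (x e / of_real (lam (level e)))) * cnj (x e) = of_real \<delta> * (x e * cnj (x e))"
          using lam[of "level e"] by simp
      qed
      also have "\<dots> = of_real \<delta> * of_real (\<Sum>e\<in>tbasis N. (norm (x e))\<^sup>2)"
        unfolding of_real_sum complex_norm_square sum_distrib_left ..
      finally show ?thesis by (simp add: x(2))
    qed
    then have "\<delta> \<le> norm (sip f w)" using \<delta> by simp
    moreover have "continuous_on (sphere 0 1) f" "continuous_on (sphere 0 1) w"
      unfolding f_def w_def by (rule comb_cont)+
    ultimately show "\<exists>f\<in>?A. \<exists>w. continuous_on (sphere 0 1) f \<and> continuous_on (sphere 0 1) w \<and> dual_bound q w 1 \<and>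
        (\<forall>g\<in>B. (\<integral>z. g z * cnj (w z) \<partial>surface_measure) = 0) \<and> \<delta> \<le> norm (sip f w)" by blast
  qed simp
  also have "\<delta> / (2 * (sphere_area TYPE('n) + 2) * 1) = width_factor TYPE('n) / b"
    by (simp add: \<delta>_def s_def width_factor_def algebra_simps)
  finally show ?thesis .
qed

lemma width_ge_one_range:
  fixes lam :: "nat \<Rightarrow> real"
  assumes pq: "kappa_one_range p q" and lam: "\<And>i. lam i > 0"
  shows "\<exists>c>0. \<forall>n N S. S > 0 \<longrightarrow> n < phi TYPE('n::finite) N \<longrightarrow>
     (\<Sum>e\<in>(tbasis N :: (complex ^ 'n \<Rightarrow> complex) set). 1 / (lam (level e))\<^sup>2) \<le> S * real (phi TYPE('n) N - n) \<longrightarrow>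
     ennreal (c / sqrt S) \<le>
    kolmogorov_width n (image_of_ball lam p :: (complex ^ 'n \<Rightarrow> complex) set) q"
proof -
  define s where "s = sphere_area TYPE('n)"
  have s: "s > 0" unfolding s_def by (rule sphere_area_pos)
  define D where "D l = max 1 s * (8 * exp 1 * real l / s)" for l
  have D: "D l > 0" if "l \<ge> 1" for l using s that by (simp add: D_def)
  have mom: "M \<le> sqrt (D l * S) ^ (2 * l)"
    if M: "M \<le> sphere_area TYPE('n) * (8 * exp 1 * real l * (S / sphere_area TYPE('n))) ^ l" and l: "l \<ge> 1" and S: "S > 0" for M S l
  proof -
    have "s \<le> max 1 s ^ 1" by simp
    also have "\<dots> \<le> max 1 s ^ l" using l by (intro power_increasing) auto
    finally have sl: "s \<le> max 1 s ^ l" .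
    have "M \<le> s * (8 * exp 1 * real l * (S / s)) ^ l" using M by (simp add: s_def)
    also have "\<dots> \<le> max 1 s ^ l * (8 * exp 1 * real l * (S / s)) ^ l"
      using sl s S by (intro mult_right_mono) auto
    also have "\<dots> = (D l * S) ^ l" unfolding D_def power_mult_distrib[symmetric] by (simp add: mult_ac)
    also have "\<dots> = sqrt (D l * S) ^ (2 * l)"
      using D[OF l] S by (simp add: power_mult)
    finally show ?thesis .
  qed
  have conv: "width_factor TYPE('n) / sqrt (D l * S) = (width_factor TYPE('n) / sqrt (D l)) / sqrt S" for l S
    by (simp add: real_sqrt_mult)
  show ?thesis
  proof (cases "2 \<le> q")
    case True
    then have p: "1 \<le> p" "p < \<infinity>"
      using pq unfolding kappa_one_range_def by (auto intro: order_trans[of 1 2 p] le_less_trans)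
    obtain l0 :: nat where l0: "enn2real p \<le> real l0" using real_arch_simple by blast
    define l where "l = Suc l0"
    have l: "l \<ge> 1" "enn2real p \<le> real (2 * l)" using l0 by (auto simp: l_def)
    show ?thesis
    proof (intro exI[of _ "width_factor TYPE('n) / sqrt (D l)"] conjI allI impI)
      show "width_factor TYPE('n) / sqrt (D l) > 0" using width_factor_pos[where 'n = 'n] D[OF l(1)] by simp
      fix n N S assume S: "S > (0 :: real)" and n: "n < phi TYPE('n) N"
        and sum: "(\<Sum>e\<in>(tbasis N :: (complex ^ 'n \<Rightarrow> complex) set). 1 / (lam (level e))\<^sup>2) \<le> S * real (phi TYPE('n) N - n)"
      have b: "sqrt (D l * S) > 0" using D[OF l(1)] S by simp
      show "ennreal (width_factor TYPE('n) / sqrt (D l) / sqrt S) \<le>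
        kolmogorov_width n (image_of_ball lam p :: (complex ^ 'n \<Rightarrow> complex) set) q"
        unfolding conv[symmetric]
        by (rule width_ge_large_q[OF True n l(1) lam b sum], rule in_Lp_ball_moment[OF p l(2) _ b mom[OF _ l(1) S]])
    qed
  next
    case False
    then have pq': "1 \<le> p" "p \<le> 2" "1 < q" "q < \<infinity>"
      using pq unfolding kappa_one_range_def by (auto intro: le_less_trans)
    define Q where "Q = enn2real q"
    have Q: "Q > 1"
    proof -
      have "q = ennreal Q" using pq'(4) by (simp add: Q_def)
      then have "ennreal 1 < ennreal Q" using pq'(3) by simp
      then show ?thesis by (simp add: ennreal_less_iff)
    qed
    obtain l0 :: nat where l0: "Q / (Q - 1) \<le> real l0" using real_arch_simple by blast
    define l where "l = Suc l0"
    have l: "l \<ge> 1" by (simp add: l_def)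
    have "Q / (Q - 1) \<le> real (2 * l)" using l0 by (simp add: l_def)
    then have lQ: "Q \<le> real (2 * l) * (Q - 1)" using Q by (simp add: field_simps)
    have q1: "1 \<le> q" using pq'(3) by simp
    show ?thesis
    proof (intro exI[of _ "width_factor TYPE('n) / sqrt (D l)"] conjI allI impI)
      show "width_factor TYPE('n) / sqrt (D l) > 0" using width_factor_pos[where 'n = 'n] D[OF l(1)] by simp
      fix n N S assume S: "S > (0 :: real)" and n: "n < phi TYPE('n) N"
        and sum: "(\<Sum>e\<in>(tbasis N :: (complex ^ 'n \<Rightarrow> complex) set). 1 / (lam (level e))\<^sup>2) \<le> S * real (phi TYPE('n) N - n)"
      have b: "sqrt (D l * S) > 0" using D[OF l(1)] S by simp
      have db: "dual_bound q h (sqrt (D l * S))"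
        if "continuous_on (sphere 0 1) h" and "(\<integral>z. norm (h z) ^ (2 * l) \<partial>surface_measure) \<le> sphere_area TYPE('n) * (8 * exp 1 * real l * (S / sphere_area TYPE('n))) ^ l"
        for h :: "complex ^ 'n \<Rightarrow> complex"
        by (rule dual_bound_moment[OF q1 _ _ that(1) b mom[OF that(2) l S]]) (use Q lQ l in \<open>auto simp: Q_def\<close>)
      show "ennreal (width_factor TYPE('n) / sqrt (D l) / sqrt S) \<le>
        kolmogorov_width n (image_of_ball lam p :: (complex ^ 'n \<Rightarrow> complex) set) q"
        unfolding conv[symmetric] by (rule width_ge_small_p[OF pq'(1,2) q1 n l lam b sum db])
    qed
  qed
qed

lemma width_ge_log_range:
  fixes lam :: "nat \<Rightarrow> real"
  assumes pq: "kappa_log_range p q" and lam: "\<And>i. lam i > 0" and G: "G > 0"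
  shows "\<exists>c>0. \<forall>n N S l. S > 0 \<longrightarrow> l \<ge> 1 \<longrightarrow> real (phi TYPE('n::finite) (l * N)) \<le> G ^ l \<longrightarrow> n < phi TYPE('n) N \<longrightarrow>
     (\<Sum>e\<in>(tbasis N :: (complex ^ 'n \<Rightarrow> complex) set). 1 / (lam (level e))\<^sup>2) \<le> S * real (phi TYPE('n) N - n) \<longrightarrow>
     ennreal (c / sqrt (real l * S)) \<le>
    kolmogorov_width n (image_of_ball lam p :: (complex ^ 'n \<Rightarrow> complex) set) q"
proof -
  define s where "s = sphere_area TYPE('n)"
  have s: "s > 0" unfolding s_def by (rule sphere_area_pos)
  define D where "D = G * (8 * exp 1 / s)"
  have D: "D > 0" using s G by (simp add: D_def)
  have sup: "norm (h z) \<le> sqrt (D * (real l * S))"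
    if h: "h \<in> T N" and M: "(\<integral>z. norm (h z) ^ (2 * l) \<partial>surface_measure) \<le> sphere_area TYPE('n) * (8 * exp 1 * real l * (S / sphere_area TYPE('n))) ^ l"
      and l: "l \<ge> 1" and S: "S > 0" and phiG: "real (phi TYPE('n) (l * N)) \<le> G ^ l" and z: "z \<in> sphere 0 1"
    for h :: "complex ^ 'n \<Rightarrow> complex" and z S l N
  proof -
    have "norm (h z) ^ (2 * l) \<le> real (phi TYPE('n) (l * N)) / s * (\<integral>z. norm (h z) ^ (2 * l) \<partial>surface_measure)"
      unfolding s_def by (rule nikolskii[OF h z l])
    also have "\<dots> \<le> G ^ l / s * (s * (8 * exp 1 * real l * (S / s)) ^ l)"
      using M phiG s G by (intro mult_mono divide_right_mono) (auto simp: s_def intro!: integral_nonneg_AE)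
    also have "\<dots> = G ^ l * (8 * exp 1 * real l * (S / s)) ^ l" using s by simp
    also have "\<dots> = (D * (real l * S)) ^ l"
      unfolding power_mult_distrib[symmetric] by (simp add: D_def mult_ac)
    also have "\<dots> = sqrt (D * (real l * S)) ^ (2 * l)"
      using D S by (simp add: power_mult)
    finally show ?thesis
      using l by (intro power_le_imp_le_base[of "norm (h z)" "2 * l - 1"]) (use D S in auto)
  qed
  have conv: "width_factor TYPE('n) / sqrt (D * S) = (width_factor TYPE('n) / sqrt D) / sqrt S" for S
    by (simp add: real_sqrt_mult)
  show ?thesis
  proof (intro exI[of _ "width_factor TYPE('n) / sqrt D"] conjI allI impI)
    show "width_factor TYPE('n) / sqrt D > 0" using width_factor_pos[where 'n = 'n] D by simp
    fix n N S and l :: nat assume S: "S > (0 :: real)" and l: "l \<ge> 1" and phiG: "real (phi TYPE('n) (l * N)) \<le> G ^ l" and n: "n < phi TYPE('n) N"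
      and sum: "(\<Sum>e\<in>(tbasis N :: (complex ^ 'n \<Rightarrow> complex) set). 1 / (lam (level e))\<^sup>2) \<le> S * real (phi TYPE('n) N - n)"
    have b: "sqrt (D * (real l * S)) > 0" using D S l by simp
    show "ennreal (width_factor TYPE('n) / sqrt D / sqrt (real l * S)) \<le>
      kolmogorov_width n (image_of_ball lam p :: (complex ^ 'n \<Rightarrow> complex) set) q"
    proof (cases "q = 1")
      case True
      have "\<not> 2 \<le> q" using True by simp
      then have p: "1 \<le> p" "p \<le> 2" using pq by (auto simp: kappa_log_range_def)
      have db: "dual_bound q h (sqrt (D * (real l * S)))"
        if "h \<in> T N" "continuous_on (sphere 0 1) h" and "(\<integral>z. norm (h z) ^ (2 * l) \<partial>surface_measure) \<le> sphere_area TYPE('n) * (8 * exp 1 * real l * (S / sphere_area TYPE('n))) ^ l"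
        for h :: "complex ^ 'n \<Rightarrow> complex"
        unfolding True by (rule dual_bound_sup[OF that(2) b sup[OF that(1,3) l S phiG]])
      show ?thesis
        unfolding conv[symmetric] by (rule width_ge_small_p[OF p _ n l lam b sum db]) (simp_all add: True)
    next
      case False
      then have p: "p = \<infinity>" "2 \<le> q" using pq by (auto simp: kappa_log_range_def)
      show ?thesis
        unfolding conv[symmetric] p(1)
        by (rule width_ge_large_q[OF p(2) n l lam b sum], rule in_Lp_ball_sup[OF _ b sup[OF _ _ l S phiG]])
    qed
  qed
qed

section \<open>Exponential sums\<close>

lemma sum_exp_geometric:
  assumes x: "(x :: real) > 0"
  shows "(\<Sum>j<N. exp (- x * (real N - real j))) \<le> 1 / x"
proof (induction N)
  case (Suc N)
  have "(\<Sum>j<Suc N. exp (- x * (real (Suc N) - real j))) = exp (- x) * (1 + (\<Sum>j<N. exp (- x * (real N - real j))))"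
  proof -
    have "exp (- x * (real (Suc N) - real j)) = exp (- x) * exp (- x * (real N - real j))" for j
      by (simp add: exp_add[symmetric] algebra_simps)
    then show ?thesis by (simp add: distrib_left sum_distrib_left)
  qed
  also have "\<dots> \<le> exp (- x) * (1 + 1 / x)" using Suc by (intro mult_left_mono add_left_mono) auto
  also have "\<dots> = exp (- x) * (1 + x) / x" using x by (simp add: field_simps)
  also have "\<dots> \<le> exp (- x) * exp x / x"
    using x exp_ge_add_one_self[of x] by (intro divide_right_mono mult_left_mono) auto
  also have "\<dots> = 1 / x" by (simp add: exp_minus)
  finally show ?case .
qed (use x in simp)

text \<open>
  For \<open>s < 1\<close> this is the tangent of the concave function \<open>x \<mapsto> x\<^sup>s\<close> at \<open>N\<close>. For \<open>s \<ge> 1\<close> the crude slope 1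
  suffices.
\<close>

lemma powr_gap:
  assumes s: "s > 0" and j: "j < N"
  shows "(if s \<ge> 1 then 1 else s * real N powr (s - 1)) * (real N - real j) \<le> real N powr s - real j powr s"
proof (cases "j = 0")
  case True
  have N: "real N \<ge> 1" using j by simp
  show ?thesis
  proof (cases "s \<ge> 1")
    case s1: True
    have "real N powr 1 \<le> real N powr s" using N s1 by (intro powr_mono) auto
    then show ?thesis using s1 True N by simp
  next
    case False
    have "s * real N powr (s - 1) * real N = s * real N powr s" using N by (simp add: powr_diff)
    also have "\<dots> \<le> 1 * real N powr s" using False by (intro mult_right_mono) auto
    finally show ?thesis using False True by simp
  qed
next
  case j0: False
  have N: "real N > 0" and j': "real j \<ge> 1" using j j0 by auto
  show ?thesis
  proof (cases "s \<ge> 1")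
    case True
    have Ns: "real N powr s = real N * real N powr (s - 1)" "real j powr s = real j * real j powr (s - 1)"
      using N j' by (simp_all add: powr_diff)
    have "1 * (real N - real j) \<le> real j powr (s - 1) * (real N - real j)"
      using j j' True by (intro mult_right_mono ge_one_powr_ge_zero) auto
    also have "\<dots> \<le> real N powr s - real j powr s"
    proof -
      have "real N * real j powr (s - 1) \<le> real N * real N powr (s - 1)"
        using j j' True by (intro mult_left_mono powr_mono2) auto
      then show ?thesis unfolding Ns by (simp add: algebra_simps)
    qed
    finally show ?thesis using True by simp
  next
    case False
    have "(real j / real N) powr s * 1 powr (1 - s) \<le> s * (real j / real N) + (1 - s) * 1"
      using s False j' N by (intro Youngs_inequality_0) auto
    then have "real j powr s / real N powr s \<le> s * (real j / real N) + (1 - s)"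
      using N by (simp add: powr_divide)
    then have "real j powr s \<le> (s * (real j / real N) + (1 - s)) * real N powr s"
      using N by (simp add: divide_le_eq)
    moreover have "s * real N powr (s - 1) * (real N - real j) = s * real N powr s - s * (real j / real N) * real N powr s"
      using N by (simp add: powr_diff field_simps)
    ultimately show ?thesis using False by (simp add: algebra_simps)
  qed
qed

text \<open>
  The sum is dominated by its last terms: by \<open>powr_gap\<close> it is at most a geometric series, whose
  effective length is \<open>N\<^bsup>1-s\<^esup>\<close> for \<open>s < 1\<close> and bounded for \<open>s \<ge> 1\<close>.
\<close>

lemma exp_sum_bound:
  assumes a: "(a :: real) > 0" and s: "s > 0"
  shows "\<exists>C>0. \<forall>N\<ge>1. (\<Sum>j<N. exp (a * real j powr s)) \<le> C * (real N powr (1 - s) + 1) * exp (a * real N powr s)"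
proof (intro exI[of _ "1 / (a * min 1 s)"] conjI allI impI)
  show "1 / (a * min 1 s) > 0" using a s by simp
  fix N :: nat assume N: "N \<ge> 1"
  define \<delta> where "\<delta> = (if s \<ge> 1 then 1 else s * real N powr (s - 1))"
  have \<delta>: "\<delta> > 0" using s N by (simp add: \<delta>_def)
  have "(\<Sum>j<N. exp (a * real j powr s)) \<le> (\<Sum>j<N. exp (a * real N powr s) * exp (- (a * \<delta>) * (real N - real j)))"
  proof (rule sum_mono)
    fix j assume "j \<in> {..<N}"
    then have "a * (\<delta> * (real N - real j)) \<le> a * (real N powr s - real j powr s)"
      using powr_gap[OF s, of j N] a unfolding \<delta>_def by (intro mult_left_mono) auto
    then show "exp (a * real j powr s) \<le> exp (a * real N powr s) * exp (- (a * \<delta>) * (real N - real j))"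
      by (simp add: exp_add[symmetric] algebra_simps)
  qed
  also have "\<dots> = exp (a * real N powr s) * (\<Sum>j<N. exp (- (a * \<delta>) * (real N - real j)))"
    by (simp add: sum_distrib_left)
  also have "\<dots> \<le> exp (a * real N powr s) * (1 / (a * \<delta>))"
    using a \<delta> by (intro mult_left_mono sum_exp_geometric) auto
  also have "\<dots> \<le> exp (a * real N powr s) * (1 / (a * min 1 s) * (real N powr (1 - s) + 1))"
  proof (rule mult_left_mono)
    show "1 / (a * \<delta>) \<le> 1 / (a * min 1 s) * (real N powr (1 - s) + 1)"
    proof (cases "s \<ge> 1")
      case True
      then show ?thesis using a by (simp add: \<delta>_def divide_right_mono)
    next
      case False
      have eq: "1 / real N powr (s - 1) = real N powr (1 - s)" by (simp add: powr_minus_divide[symmetric])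
      have "1 / (a * \<delta>) = 1 / (a * s) * (1 / real N powr (s - 1))" using False by (simp add: \<delta>_def)
      also have "\<dots> = 1 / (a * s) * real N powr (1 - s)" unfolding eq ..
      also have "\<dots> \<le> 1 / (a * s) * (real N powr (1 - s) + 1)" using a s by (intro mult_left_mono) auto
      finally show ?thesis using False by simp
    qed
  qed simp
  finally show "(\<Sum>j<N. exp (a * real j powr s)) \<le> 1 / (a * min 1 s) * (real N powr (1 - s) + 1) * exp (a * real N powr s)"
    by (simp add: mult_ac)
qed

section \<open>The eigenvalue sum\<close>

lemma exponent_comparison:
  assumes d: "CARD('n::finite) \<ge> 2" and g: "\<gamma> > 0" and r: "r > 0"
  shows "\<gamma> * real (Suc N) powr r \<le> R_const TYPE('n) \<gamma> r * real (phi TYPE('n) N) powr (r / (2 * real CARD('n) - 1))"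
proof -
  define s where "s = r / (2 * real CARD('n) - 1)"
  have s: "s > 0" using d r by (simp add: s_def)
  define K :: real where "K = fact CARD('n) * fact (CARD('n) - 1) / 2"
  have K: "K > 0" by (simp add: K_def)
  have R: "R_const TYPE('n) \<gamma> r = \<gamma> * K powr s" by (simp add: R_const_def Let_def K_def s_def)
  have "real (Suc N) powr r = (real (Suc N) powr (2 * real CARD('n) - 1)) powr s"
    using d by (simp add: powr_powr s_def)
  also have "real (Suc N) powr (2 * real CARD('n) - 1) = real (Suc N) ^ (2 * CARD('n) - 1)"
  proof -
    have "2 * real CARD('n) - 1 = real (2 * CARD('n) - 1)" using d by (simp add: of_nat_diff)
    then show ?thesis by (simp only:) (rule powr_realpow, simp)
  qed
  also have "\<dots> powr s \<le> (real (phi TYPE('n) N) * K) powr s"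
    using phi_lower[OF d, of N] s by (intro powr_mono2) (auto simp: K_def add.commute)
  also have "\<dots> = real (phi TYPE('n) N) powr s * K powr s" using K by (simp add: powr_mult)
  finally show ?thesis using g unfolding R s_def[symmetric] by (simp add: mult.left_commute mult.commute)
qed

lemma phi_level: "phi TYPE('n::finite) (Suc N) = phi TYPE('n) N + card (level_basis (Suc N) :: (complex ^ 'n \<Rightarrow> complex) set)"
  unfolding card_tbasis[symmetric] tbasis_Suc
  by (rule card_Un_disjoint[OF finite_tbasis finite_level_basis tbasis_level_disjoint])

text \<open>
  Number the eigenvalues level by level. Those of level \<open>N + 1\<close> receive numbers \<open>j \<ge> phi N\<close>, and
  \<open>exponent_comparison\<close> bounds the contribution of each by \<open>exp (2 R j\<^sup>s)\<close>.
\<close>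

lemma eigenvalue_sum_le:
  assumes d: "CARD('n::finite) \<ge> 2" and g: "\<gamma> > 0" and r: "r > 0"
  shows "(\<Sum>e\<in>(tbasis N :: (complex ^ 'n \<Rightarrow> complex) set). exp (2 * \<gamma> * real (level e) powr r)) \<le>
    (\<Sum>j<phi TYPE('n) N. exp (2 * R_const TYPE('n) \<gamma> r * real j powr (r / (2 * real CARD('n) - 1))))"
proof (induction N)
  case 0
  have "(\<Sum>e\<in>(tbasis 0 :: (complex ^ 'n \<Rightarrow> complex) set). exp (2 * \<gamma> * real (level e) powr r)) =
    (\<Sum>e\<in>(tbasis 0 :: (complex ^ 'n \<Rightarrow> complex) set). 1)"
  proof (rule sum.cong[OF refl])
    fix e :: "complex ^ 'n \<Rightarrow> complex" assume "e \<in> tbasis 0"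
    then have "level e = 0" using level_tbasis[of e 0] by simp
    then show "exp (2 * \<gamma> * real (level e) powr r) = 1" by simp
  qed
  then show ?case by (simp add: card_tbasis phi_0)
next
  case (Suc N)
  define s where "s = r / (2 * real CARD('n) - 1)"
  define R where "R = R_const TYPE('n) \<gamma> r"
  have s: "s > 0" using d r by (simp add: s_def)
  have R: "R > 0" using g by (simp add: R_def R_const_def Let_def)
  let ?L = "level_basis (Suc N) :: (complex ^ 'n \<Rightarrow> complex) set"
  have "(\<Sum>e\<in>?L. exp (2 * \<gamma> * real (level e) powr r)) = (\<Sum>e\<in>?L. exp (2 * \<gamma> * real (Suc N) powr r))"
    by (intro sum.cong) (auto simp: level_eq)
  also have "\<dots> = (\<Sum>j\<in>{phi TYPE('n) N..<phi TYPE('n) (Suc N)}. exp (2 * \<gamma> * real (Suc N) powr r))"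
    by (simp add: phi_level)
  also have "\<dots> \<le> (\<Sum>j\<in>{phi TYPE('n) N..<phi TYPE('n) (Suc N)}. exp (2 * R * real j powr s))"
  proof (rule sum_mono)
    fix j assume "j \<in> {phi TYPE('n) N..<phi TYPE('n) (Suc N)}"
    then have "real (phi TYPE('n) N) powr s \<le> real j powr s" using s by (intro powr_mono2) auto
    then have "R * real (phi TYPE('n) N) powr s \<le> R * real j powr s" using R by (intro mult_left_mono) auto
    moreover have "\<gamma> * real (Suc N) powr r \<le> R * real (phi TYPE('n) N) powr s"
      unfolding R_def s_def by (rule exponent_comparison[OF d g r])
    ultimately show "exp (2 * \<gamma> * real (Suc N) powr r) \<le> exp (2 * R * real j powr s)" by simp
  qed
  finally have L: "(\<Sum>e\<in>?L. exp (2 * \<gamma> * real (level e) powr r)) \<le> (\<Sum>j\<in>{phi TYPE('n) N..<phi TYPE('n) (Suc N)}. exp (2 * R * real j powr s))" .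
  have "(\<Sum>e\<in>(tbasis (Suc N) :: (complex ^ 'n \<Rightarrow> complex) set). exp (2 * \<gamma> * real (level e) powr r)) =
     (\<Sum>e\<in>(tbasis N :: (complex ^ 'n \<Rightarrow> complex) set). exp (2 * \<gamma> * real (level e) powr r)) + (\<Sum>e\<in>?L. exp (2 * \<gamma> * real (level e) powr r))"
    unfolding tbasis_Suc by (rule sum.union_disjoint[OF finite_tbasis finite_level_basis tbasis_level_disjoint])
  also have "\<dots> \<le> (\<Sum>j<phi TYPE('n) N. exp (2 * R * real j powr s)) + (\<Sum>j\<in>{phi TYPE('n) N..<phi TYPE('n) (Suc N)}. exp (2 * R * real j powr s))"
    using Suc L unfolding R_def s_def by (rule add_mono)
  also have "\<dots> = (\<Sum>j<phi TYPE('n) (Suc N). exp (2 * R * real j powr s))"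
  proof -
    have "phi TYPE('n) N \<le> phi TYPE('n) (Suc N)" by (simp add: phi_level)
    then show ?thesis unfolding lessThan_atLeast0 by (intro sum.atLeastLessThan_concat) simp_all
  qed
  finally show ?case by (simp add: R_def s_def)
qed

text \<open>
  If \<open>N \<le> exp l\<close>, then \<open>l N + 1 \<le> exp (3 l)\<close>, and \<open>phi\<close> grows like a power.
\<close>

lemma phi_power_bound:
  "\<exists>G>0. \<forall>l N. l \<ge> 1 \<longrightarrow> ln (real (max N 1)) \<le> real l \<longrightarrow> real (phi TYPE('n::finite) (l * N)) \<le> G ^ l"
proof -
  obtain C where C: "C > 0" "\<And>N. real (phi TYPE('n) N) \<le> C * (real N + 1) ^ (2 * CARD('n) - 1)"
    using phi_upper[where 'n = 'n] by blast
  let ?k = "2 * CARD('n) - 1"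
  show ?thesis
  proof (intro exI[of _ "max 1 C * exp 3 ^ ?k"] conjI allI impI)
    fix l N :: nat assume l: "l \<ge> 1" and N: "ln (real (max N 1)) \<le> real l"
    have N': "real (max N 1) \<le> exp (real l)"
    proof -
      have "real (max N 1) = exp (ln (real (max N 1)))" by simp
      also have "\<dots> \<le> exp (real l)" using N by (simp only: exp_le_cancel_iff)
      finally show ?thesis .
    qed
    have l': "real l \<le> exp (real l)" "2 \<le> exp (real l)"
      using exp_ge_add_one_self[of "real l"] l by linarith+
    have "real (l * N) + 1 \<le> 2 * (real l * real (max N 1))"
    proof -
      have "real l * real N \<le> real l * real (max N 1)" by (intro mult_left_mono) auto
      moreover have "1 * 1 \<le> real l * real (max N 1)" using l by (intro mult_mono) auto
      ultimately show ?thesis by simp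
    qed
    also have "\<dots> \<le> exp (real l) * (exp (real l) * exp (real l))"
      using l' N' by (intro mult_mono) auto
    also have "\<dots> = exp 3 ^ l" by (simp add: exp_add[symmetric] exp_of_nat_mult[symmetric])
    finally have "(real (l * N) + 1) ^ ?k \<le> (exp 3 ^ l) ^ ?k" by (intro power_mono) auto
    also have "\<dots> = (exp 3 ^ ?k) ^ l" by (simp add: power_mult[symmetric] mult.commute)
    finally have 1: "(real (l * N) + 1) ^ ?k \<le> (exp 3 ^ ?k) ^ l" .
    have "C \<le> max 1 C ^ 1" by simp
    also have "\<dots> \<le> max 1 C ^ l" using l by (intro power_increasing) auto
    finally have "C * (real (l * N) + 1) ^ ?k \<le> max 1 C ^ l * (exp 3 ^ ?k) ^ l"
      using 1 C(1) by (intro mult_mono) auto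
    also have "\<dots> = (max 1 C * exp 3 ^ ?k) ^ l" by (rule power_mult_distrib[symmetric])
    finally show "real (phi TYPE('n) (l * N)) \<le> (max 1 C * exp 3 ^ ?k) ^ l" using C(2)[of "l * N"] by linarith
  qed simp
qed

section \<open>The lower bounds\<close>

text \<open>
  The source of all four estimates. The second condition on \<open>n\<close> says that \<open>n\<close> is
  far enough below \<open>phi N\<close> to absorb the first factor in \<open>exp_sum_bound\<close>; the last one makes \<open>ln k\<close>
  large enough for the number \<open>l\<close> in \<open>nikolskii\<close>.
\<close>

lemma width_lower_bound:
  fixes \<gamma> r C3 D :: real
  assumes d: "CARD('n::finite) \<ge> 2" and g: "\<gamma> > 0" and r: "r > 0"
    and pq: "kappa_one_range p q \<or> kappa_log_range p q" and C3: "C3 > 0" and D: "D > 0"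
  shows "\<exists>c>0. \<forall>k n N. k \<ge> 2 \<longrightarrow> n < phi TYPE('n) N \<longrightarrow>
     real (phi TYPE('n) N) powr (1 - r / (2 * real CARD('n) - 1)) + 1 \<le> D * real (phi TYPE('n) N - n) \<longrightarrow>
     ln (real (max N 1)) \<le> C3 * ln (real k) \<longrightarrow>
     ennreal (c * (exp (- R_const TYPE('n) \<gamma> r * real (phi TYPE('n) N) powr (r / (2 * real CARD('n) - 1))) * kappa p q k))
       \<le> kolmogorov_width n (multiplier_image (lam2 \<gamma> r) (Lp_ball p) :: (complex ^ 'n \<Rightarrow> complex) set) q"
proof -
  define s where "s = r / (2 * real CARD('n) - 1)"
  define R where "R = R_const TYPE('n) \<gamma> r"
  have s: "s > 0" using d r by (simp add: s_def)
  have R: "R > 0" using g by (simp add: R_def R_const_def Let_def)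
  define lam where "lam i = exp (- \<gamma> * real i powr r)" for i :: nat
  have lam: "lam i > 0" for i by (simp add: lam_def)
  have lam2: "lam2 \<gamma> r = (\<lambda>m n. of_real (lam (max m n)))" by (simp add: lam2_def lam_def fun_eq_iff)
  have lamsq: "1 / (lam i)\<^sup>2 = exp (2 * \<gamma> * real i powr r)" for i
    by (simp add: lam_def power2_eq_square exp_add[symmetric] exp_minus field_simps)
  obtain C where C: "C > 0" "\<And>N. N \<ge> 1 \<Longrightarrow> (\<Sum>j<N. exp (2 * R * real j powr s)) \<le> C * (real N powr (1 - s) + 1) * exp (2 * R * real N powr s)"
    using exp_sum_bound[of "2 * R" s] R s by auto
  define S where "S N = C * D * exp (2 * R * real (phi TYPE('n) N) powr s)" for N
  have S: "S N > 0" for N using C(1) D by (simp add: S_def)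
  have sqS: "sqrt (S N) = sqrt (C * D) * exp (R * real (phi TYPE('n) N) powr s)" for N
  proof -
    have "exp (2 * R * real (phi TYPE('n) N) powr s) = (exp (R * real (phi TYPE('n) N) powr s))\<^sup>2"
      by (simp add: power2_eq_square exp_add[symmetric])
    then show ?thesis by (simp add: S_def real_sqrt_mult)
  qed
  have sum: "(\<Sum>e\<in>(tbasis N :: (complex ^ 'n \<Rightarrow> complex) set). 1 / (lam (level e))\<^sup>2) \<le> S N * real (phi TYPE('n) N - n)"
    if n: "real (phi TYPE('n) N) powr (1 - s) + 1 \<le> D * real (phi TYPE('n) N - n)" for n N
  proof -
    have "(\<Sum>e\<in>(tbasis N :: (complex ^ 'n \<Rightarrow> complex) set). 1 / (lam (level e))\<^sup>2) \<le> (\<Sum>j<phi TYPE('n) N. exp (2 * R * real j powr s))"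
      unfolding lamsq R_def s_def by (rule eigenvalue_sum_le[OF d g r])
    also have "\<dots> \<le> C * (real (phi TYPE('n) N) powr (1 - s) + 1) * exp (2 * R * real (phi TYPE('n) N) powr s)"
      using phi_pos[where 'n = 'n and N = N] by (intro C(2)) simp
    also have "\<dots> \<le> C * (D * real (phi TYPE('n) N - n)) * exp (2 * R * real (phi TYPE('n) N) powr s)"
      using n C(1) by (intro mult_right_mono mult_left_mono) auto
    finally show ?thesis by (simp add: S_def mult_ac)
  qed
  show ?thesis
    unfolding s_def[symmetric] R_def[symmetric] lam2
  proof (cases "kappa_one_range p q")
    case True
    obtain c where c: "c > 0" "\<And>n N S. S > 0 \<Longrightarrow> n < phi TYPE('n) N \<Longrightarrow>
       (\<Sum>e\<in>(tbasis N :: (complex ^ 'n \<Rightarrow> complex) set). 1 / (lam (level e))\<^sup>2) \<le> S * real (phi TYPE('n) N - n) \<Longrightarrow>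
       ennreal (c / sqrt S) \<le> kolmogorov_width n (image_of_ball lam p :: (complex ^ 'n \<Rightarrow> complex) set) q"
      using width_ge_one_range[where 'n = 'n, of p q lam, OF True lam] by blast
    show "\<exists>c>0. \<forall>k n N. k \<ge> 2 \<longrightarrow> n < phi TYPE('n) N \<longrightarrow>
       real (phi TYPE('n) N) powr (1 - s) + 1 \<le> D * real (phi TYPE('n) N - n) \<longrightarrow>
       ln (real (max N 1)) \<le> C3 * ln (real k) \<longrightarrow>
       ennreal (c * (exp (- R * real (phi TYPE('n) N) powr s) * kappa p q k))
         \<le> kolmogorov_width n (image_of_ball lam p :: (complex ^ 'n \<Rightarrow> complex) set) q"
    proof (intro exI[of _ "c / sqrt (C * D)"] conjI allI impI)
      show "c / sqrt (C * D) > 0" using c(1) C(1) D by simp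
      fix k n N :: nat assume "k \<ge> 2" and n: "n < phi TYPE('n) N"
        "real (phi TYPE('n) N) powr (1 - s) + 1 \<le> D * real (phi TYPE('n) N - n)"
      have "c / sqrt (S N) = c / sqrt (C * D) * (exp (- R * real (phi TYPE('n) N) powr s) * kappa p q k)"
        unfolding sqS by (simp add: kappa_def True exp_minus divide_inverse)
      then show "ennreal (c / sqrt (C * D) * (exp (- R * real (phi TYPE('n) N) powr s) * kappa p q k))
         \<le> kolmogorov_width n (image_of_ball lam p :: (complex ^ 'n \<Rightarrow> complex) set) q"
        using c(2)[OF S n(1) sum[OF n(2)]] by simp
    qed
  next
    case False
    then have lr: "kappa_log_range p q" using pq by blast
    obtain G where G: "G > 0" "\<And>l N. l \<ge> 1 \<Longrightarrow> ln (real (max N 1)) \<le> real l \<Longrightarrow> real (phi TYPE('n) (l * N)) \<le> G ^ l"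
      using phi_power_bound[where 'n = 'n] by blast
    obtain c where c: "c > 0" "\<And>n N S l. S > 0 \<Longrightarrow> l \<ge> 1 \<Longrightarrow> real (phi TYPE('n) (l * N)) \<le> G ^ l \<Longrightarrow> n < phi TYPE('n) N \<Longrightarrow>
       (\<Sum>e\<in>(tbasis N :: (complex ^ 'n \<Rightarrow> complex) set). 1 / (lam (level e))\<^sup>2) \<le> S * real (phi TYPE('n) N - n) \<Longrightarrow>
       ennreal (c / sqrt (real l * S)) \<le> kolmogorov_width n (image_of_ball lam p :: (complex ^ 'n \<Rightarrow> complex) set) q"
      using width_ge_log_range[where 'n = 'n, of p q lam G, OF lr lam G(1)] by blast
    define C4 where "C4 = C3 + 1 / ln 2"
    have C4: "C4 > 0" using C3 by (simp add: C4_def add_pos_pos)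
    show "\<exists>c>0. \<forall>k n N. k \<ge> 2 \<longrightarrow> n < phi TYPE('n) N \<longrightarrow>
       real (phi TYPE('n) N) powr (1 - s) + 1 \<le> D * real (phi TYPE('n) N - n) \<longrightarrow>
       ln (real (max N 1)) \<le> C3 * ln (real k) \<longrightarrow>
       ennreal (c * (exp (- R * real (phi TYPE('n) N) powr s) * kappa p q k))
         \<le> kolmogorov_width n (image_of_ball lam p :: (complex ^ 'n \<Rightarrow> complex) set) q"
    proof (intro exI[of _ "c / (sqrt C4 * sqrt (C * D))"] conjI allI impI)
      show "c / (sqrt C4 * sqrt (C * D)) > 0" using c(1) C(1) D C4 by simp
      fix k n N :: nat assume k: "k \<ge> 2" and n: "n < phi TYPE('n) N"
        "real (phi TYPE('n) N) powr (1 - s) + 1 \<le> D * real (phi TYPE('n) N - n)" and N: "ln (real (max N 1)) \<le> C3 * ln (real k)"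
      have lnk: "ln (real k) \<ge> ln 2" "ln (real k) > 0" using k by auto
      \<comment> \<open>The order of the moment: just large enough for \<open>phi_power_bound\<close>.\<close>
      define l where "l = nat \<lceil>C3 * ln (real k)\<rceil>"
      have pos: "C3 * ln (real k) > 0" using C3 lnk by simp
      then have l1: "l \<ge> 1" unfolding l_def by linarith
      have l2: "C3 * ln (real k) \<le> real l" unfolding l_def by linarith
      have "real l \<le> C3 * ln (real k) + 1" unfolding l_def using pos by linarith
      also have "1 \<le> 1 / ln 2 * ln (real k)" using lnk(1) by (simp add: field_simps)
      finally have l3: "real l \<le> C4 * ln (real k)" by (simp add: C4_def distrib_right)
      have "sqrt (real l * S N) \<le> sqrt (C4 * ln (real k) * S N)"
        using l3 S[of N] by (intro real_sqrt_le_mono mult_right_mono) auto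
      also have "\<dots> = sqrt C4 * sqrt (C * D) * (sqrt (ln (real k)) * exp (R * real (phi TYPE('n) N) powr s))"
        by (simp add: real_sqrt_mult sqS)
      finally have le: "sqrt (real l * S N) \<le> sqrt C4 * sqrt (C * D) * (sqrt (ln (real k)) * exp (R * real (phi TYPE('n) N) powr s))" .
      have kap: "kappa p q k = 1 / sqrt (ln (real k))"
        using lnk False by (simp add: kappa_def powr_minus_divide powr_half_sqrt)
      have "c / (sqrt C4 * sqrt (C * D)) * (exp (- R * real (phi TYPE('n) N) powr s) * kappa p q k)
        = c / (sqrt C4 * sqrt (C * D) * (sqrt (ln (real k)) * exp (R * real (phi TYPE('n) N) powr s)))"
        unfolding kap by (simp add: exp_minus divide_inverse mult_ac)
      also have "\<dots> \<le> c / sqrt (real l * S N)"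
        using le c(1) l1 S[of N] by (intro divide_left_mono mult_pos_pos) (use C4 C(1) D lnk in auto)
      finally have "ennreal (c / (sqrt C4 * sqrt (C * D)) * (exp (- R * real (phi TYPE('n) N) powr s) * kappa p q k)) \<le> ennreal (c / sqrt (real l * S N))"
        by (rule ennreal_leI)
      also have "\<dots> \<le> kolmogorov_width n (image_of_ball lam p :: (complex ^ 'n \<Rightarrow> complex) set) q"
        by (rule c(2)[OF S l1 G(2)[OF l1 order_trans[OF N l2]] n(1) sum[OF n(2)]])
      finally show "ennreal (c / (sqrt C4 * sqrt (C * D)) * (exp (- R * real (phi TYPE('n) N) powr s) * kappa p q k))
         \<le> kolmogorov_width n (image_of_ball lam p :: (complex ^ 'n \<Rightarrow> complex) set) q" .
    qed
  qed
qed

lemma kappa_nonneg: "kappa p q k \<ge> 0"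
  by (simp add: kappa_def)

text \<open>
  For a given index \<open>k\<close> take the first level \<open>N\<close> with \<open>phi N \<ge> k + k\<^bsup>1-s\<^esup>\<close>. Since \<open>r \<le> 1\<close>, consecutive
  dimensions differ by at most a multiple of \<open>(phi N)\<^bsup>1-s\<^esup>\<close>, so \<open>phi N\<close> overshoots by no more than the
  same order, and then \<open>(phi N)\<^sup>s\<close> exceeds \<open>k\<^sup>s\<close> by a bounded amount only.
\<close>

lemma level_for_index:
  assumes d: "CARD('n::finite) \<ge> 2" and r: "0 < r" "r \<le> 1"
  defines "s \<equiv> r / (2 * real CARD('n) - 1)"
  shows "\<exists>C3>0. \<exists>D>0. \<exists>M>0. \<forall>k\<ge>2. \<exists>N. k < phi TYPE('n) N \<and>
     real (phi TYPE('n) N) powr (1 - s) + 1 \<le> D * real (phi TYPE('n) N - k) \<and>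
     ln (real (max N 1)) \<le> C3 * ln (real k) \<and>
     real (phi TYPE('n) N) powr s \<le> real k powr s + M"
proof -
  let ?m = "2 * CARD('n) - 1"
  have m: "2 * real CARD('n) - 1 = real ?m" using d by (simp add: of_nat_diff)
  have s: "0 < s" "s \<le> 1" "s * real ?m = r" "s < 1"
    using r d by (auto simp: s_def divide_le_eq field_simps)
  obtain C where C: "C > 0" "\<And>N. real (phi TYPE('n) N) \<le> C * (real N + 1) ^ ?m"
    using phi_upper[where 'n = 'n] by blast
  define F :: real where "F = fact CARD('n) * fact (CARD('n) - 1) / 2"
  have F: "F > 0" by (simp add: F_def)
  define B where "B = 2 * (real CARD('n))\<^sup>2 * C powr s"
  have B: "B \<ge> 0" by (simp add: B_def)
  \<comment> \<open>The relative growth of \<open>phi\<close> is of order \<open>1 / N\<close>, and \<open>(phi N)\<^sup>s\<close> is at most of order \<open>N\<^sup>r \<le> N\<close>.\<close>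
  have step: "real (phi TYPE('n) (Suc N)) \<le> real (phi TYPE('n) N) + B * real (phi TYPE('n) N) powr (1 - s)" for N
  proof -
    define f where "f = real (phi TYPE('n) N)"
    have f: "f > 0" using phi_pos[where 'n = 'n and N = N] by (simp add: f_def)
    have "f powr s \<le> (C * (real N + 1) ^ ?m) powr s"
      using C(2)[of N] s f by (intro powr_mono2) (auto simp: f_def)
    also have "\<dots> = C powr s * ((real N + 1) powr real ?m) powr s"
    proof -
      have "(real N + 1) ^ ?m = (real N + 1) powr real ?m" by (rule powr_realpow[symmetric]) simp
      then show ?thesis using C(1) by (simp only:) (simp add: powr_mult)
    qed
    also have "((real N + 1) powr real ?m) powr s = (real N + 1) powr r" using s(3) by (simp add: powr_powr mult.commute)
    also have "(real N + 1) powr r \<le> (real N + 1) powr 1" using r by (intro powr_mono) auto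
    finally have "f powr s \<le> C powr s * (real N + 1)" by (simp add: mult_left_mono)
    then have "f powr s * f powr (1 - s) \<le> C powr s * (real N + 1) * f powr (1 - s)" by (intro mult_right_mono) auto
    then have "f \<le> C powr s * (real N + 1) * f powr (1 - s)" using f by (simp add: powr_add[symmetric])
    then have "f / (real N + 1) \<le> C powr s * f powr (1 - s)" by (simp add: divide_le_eq mult_ac)
    then have "2 * (real CARD('n))\<^sup>2 * (f / (real N + 1)) \<le> 2 * (real CARD('n))\<^sup>2 * (C powr s * f powr (1 - s))"
      by (intro mult_left_mono) auto
    moreover have "real (phi TYPE('n) (Suc N)) \<le> f + 2 * (real CARD('n))\<^sup>2 * (f / (real N + 1))"
      using phi_Suc_le[OF d, of N] by (simp add: f_def algebra_simps)
    ultimately show ?thesis unfolding f_def[symmetric] B_def by (simp add: mult.assoc)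
  qed
  have lowN: "real N + 1 \<le> F * real (phi TYPE('n) N)" for N
  proof -
    have "(real N + 1) ^ 1 \<le> (real N + 1) ^ ?m" using d by (intro power_increasing) auto
    then show ?thesis using phi_lower[OF d, of N] by (simp add: F_def mult.commute)
  qed
  define B' where "B' = 1 + B * 2 powr (1 - s)"
  have B': "B' \<ge> 1" using B by (simp add: B'_def)
  define D where "D = (1 + B') powr (1 - s) + 1"
  define C3 where "C3 = 1 + \<bar>ln (2 * F)\<bar> / ln 2"
  have "C3 > 0" by (simp add: C3_def add_pos_nonneg)
  have "D > 0" by (simp add: D_def add_nonneg_pos)
  have "B' > 0" using B' by simp
  have main: "\<exists>N. k < phi TYPE('n) N \<and> real (phi TYPE('n) N) powr (1 - s) + 1 \<le> D * real (phi TYPE('n) N - k) \<and>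
       ln (real (max N 1)) \<le> C3 * ln (real k) \<and> real (phi TYPE('n) N) powr s \<le> real k powr s + B'"
    if k: "k \<ge> 2" for k
  proof -
    from k have k0: "real k \<ge> 1" "real k > 0" by auto
    define x where "x = real k + real k powr (1 - s)"
    have kp: "real k powr (1 - s) \<ge> 1" using k0 s by (intro ge_one_powr_ge_zero) auto
    have kle: "real k powr (1 - s) \<le> real k" using powr_mono[of "1 - s" 1 "real k"] k0 s by simp
    have "\<exists>N. x \<le> real (phi TYPE('n) N)"
    proof -
      obtain N :: nat where "x * F \<le> real N" using real_arch_simple by blast
      then have "x * F \<le> F * real (phi TYPE('n) N)" using lowN[of N] by linarith
      then have "x \<le> real (phi TYPE('n) N)" using F by (simp add: mult.commute)
      then show ?thesis ..
    qed
    define N where "N = (LEAST N. x \<le> real (phi TYPE('n) N))"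
    have Nx: "x \<le> real (phi TYPE('n) N)" unfolding N_def by (rule LeastI_ex) fact
    have "N \<noteq> 0"
    proof
      assume "N = 0"
      then have "x \<le> 1" using Nx by (simp add: phi_0)
      then show False using kp k by (simp add: x_def)
    qed
    then obtain L where L: "N = Suc L" by (metis not0_implies_Suc)
    have "\<not> x \<le> real (phi TYPE('n) L)" using not_less_Least[of L "\<lambda>N. x \<le> real (phi TYPE('n) N)"] L by (simp add: N_def)
    then have Lx: "real (phi TYPE('n) L) < x" by simp
    have x2: "x \<le> 2 * real k" using kle by (simp add: x_def)
    have up: "real (phi TYPE('n) N) \<le> real k + B' * real k powr (1 - s)"
    proof -
      have "real (phi TYPE('n) L) powr (1 - s) \<le> (2 * real k) powr (1 - s)"
        using Lx x2 s by (intro powr_mono2) auto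
      also have "\<dots> = 2 powr (1 - s) * real k powr (1 - s)" by (simp add: powr_mult)
      finally have "B * real (phi TYPE('n) L) powr (1 - s) \<le> B * (2 powr (1 - s) * real k powr (1 - s))"
        using B by (intro mult_left_mono)
      then show ?thesis using step[of L] Lx unfolding L x_def B'_def by (simp add: algebra_simps)
    qed
    have diff: "real k powr (1 - s) \<le> real (phi TYPE('n) N) - real k" using Nx by (simp add: x_def)
    then have lt: "real k < real (phi TYPE('n) N)" using kp by linarith
    then have ltn: "k < phi TYPE('n) N" by simp
    have rd: "real (phi TYPE('n) N - k) = real (phi TYPE('n) N) - real k" using ltn by (simp add: of_nat_diff)
    have "real (phi TYPE('n) N) \<le> (1 + B') * real k"
    proof -
      have "B' * real k powr (1 - s) \<le> B' * real k" using kle B' by (intro mult_left_mono) auto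
      then show ?thesis using up by (simp add: algebra_simps)
    qed
    then have "real (phi TYPE('n) N) powr (1 - s) \<le> ((1 + B') * real k) powr (1 - s)"
      using s by (intro powr_mono2) auto
    also have "\<dots> = (1 + B') powr (1 - s) * real k powr (1 - s)" using B' by (simp add: powr_mult)
    finally have "real (phi TYPE('n) N) powr (1 - s) + 1 \<le> D * real k powr (1 - s)"
      using kp by (simp add: D_def algebra_simps)
    also have "\<dots> \<le> D * real (phi TYPE('n) N - k)"
      unfolding rd using diff \<open>D > 0\<close> by (intro mult_left_mono) auto
    finally have gap: "real (phi TYPE('n) N) powr (1 - s) + 1 \<le> D * real (phi TYPE('n) N - k)" .
    have logs: "ln (real (max N 1)) \<le> C3 * ln (real k)"
    proof -
      have "real N \<le> F * real (phi TYPE('n) L)" using lowN[of L] L by simp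
      also have "\<dots> \<le> F * (2 * real k)" using Lx x2 F by (intro mult_left_mono) auto
      finally have "real (max N 1) \<le> 2 * F * real k" using \<open>N \<noteq> 0\<close> by (simp add: max_def)
      then have "ln (real (max N 1)) \<le> ln (2 * F * real k)" by (subst ln_le_cancel_iff) (use F k0 in auto)
      also have "\<dots> = ln (2 * F) + ln (real k)" using F k0 by (simp add: ln_mult)
      also have "\<dots> \<le> \<bar>ln (2 * F)\<bar> / ln 2 * ln (real k) + ln (real k)"
      proof -
        have "ln 2 \<le> ln (real k)" using k by simp
        then have "\<bar>ln (2 * F)\<bar> * ln 2 \<le> \<bar>ln (2 * F)\<bar> * ln (real k)" by (intro mult_left_mono) auto
        then have "\<bar>ln (2 * F)\<bar> \<le> \<bar>ln (2 * F)\<bar> / ln 2 * ln (real k)" by (simp add: field_simps)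
        then show ?thesis by linarith
      qed
      finally show ?thesis by (simp add: C3_def algebra_simps)
    qed
    have powers: "real (phi TYPE('n) N) powr s \<le> real k powr s + B'"
    proof -
      define y where "y = B' * real k powr (- s)"
      have y: "y \<ge> 0" using B' by (simp add: y_def)
      have ky: "real k + B' * real k powr (1 - s) = real k * (1 + y)"
        using k0 by (simp add: y_def algebra_simps powr_diff powr_minus divide_inverse)
      have "real (phi TYPE('n) N) powr s \<le> (real k * (1 + y)) powr s"
        using up s unfolding ky by (intro powr_mono2) auto
      also have "\<dots> = real k powr s * (1 + y) powr s" using y by (simp add: powr_mult)
      also have "\<dots> \<le> real k powr s * (1 + y) powr 1"
        using y s by (intro mult_left_mono powr_mono) auto
      also have "\<dots> = real k powr s + real k powr s * y" using y by (simp add: algebra_simps)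
      also have "real k powr s * y = B'" using k0 by (simp add: y_def powr_minus)
      finally show ?thesis .
    qed
    show "\<exists>N. k < phi TYPE('n) N \<and> real (phi TYPE('n) N) powr (1 - s) + 1 \<le> D * real (phi TYPE('n) N - k) \<and>
       ln (real (max N 1)) \<le> C3 * ln (real k) \<and> real (phi TYPE('n) N) powr s \<le> real k powr s + B'"
      using ltn gap logs powers by blast
  qed
  show ?thesis using \<open>C3 > 0\<close> \<open>D > 0\<close> \<open>B' > 0\<close> main by blast
qed

theorem theorem6p5:
  fixes \<gamma> r :: real and p q :: ennreal
  defines "s \<equiv> r / (2 * real CARD('n::finite) - 1)"
    and "\<phi> \<equiv> phi TYPE('n)"
    and "\<psi> \<equiv> psi TYPE('n) r"
    and "R \<equiv> R_const TYPE('n) \<gamma> r"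
    and "A \<equiv> multiplier_image (lam2 \<gamma> r) (Lp_ball p :: (complex ^ 'n \<Rightarrow> complex) set)"
  assumes "CARD('n) \<ge> 2" and "\<gamma> > 0" and "r > 0"
    and "kappa_one_range p q \<or> kappa_log_range p q"
  shows
    "(\<exists>C>0. \<forall>k\<ge>2. \<lfloor>\<psi> k\<rfloor> \<ge> 0 \<longrightarrow>
        kolmogorov_width (nat \<lfloor>\<psi> k\<rfloor>) A q
          \<ge> ennreal (C * (exp (- R * real (\<phi> k) powr s) * kappa p q k))) \<and>
     (r \<le> 2 * real CARD('n) - 1 \<longrightarrow>
      (\<exists>C>0. \<forall>k\<ge>2. \<lfloor>\<psi> k\<rfloor> \<ge> 0 \<and> \<psi> k \<ge> 0 \<longrightarrow>
        kolmogorov_width (nat \<lfloor>\<psi> k\<rfloor>) A q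
          \<ge> ennreal (C * (exp (- R * \<psi> k powr s) * kappa p q k)))) \<and>
     (r > 2 * real CARD('n) - 1 \<longrightarrow>
      (\<exists>C>0. \<forall>k\<ge>2.
        kolmogorov_width (\<phi> k - 1) A q
          \<ge> ennreal (C * (exp (- R * real (\<phi> k) powr s) * kappa p q k)))) \<and>
     (r \<le> 1 \<longrightarrow>
      (\<exists>C>0. \<forall>k\<ge>2.
        kolmogorov_width k A q
          \<ge> ennreal (C * (exp (- R * real k powr s) * kappa p q k))))"
proof -
  have d: "CARD('n) \<ge> 2" and g: "\<gamma> > 0" and r: "r > 0"
    and pq: "kappa_one_range p q \<or> kappa_log_range p q" by fact+
  have R: "R > 0" using g by (simp add: R_def R_const_def Let_def)
  have s: "s > 0" using d r by (simp add: s_def)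
  have main: "\<exists>c>0. \<forall>k n N. k \<ge> 2 \<longrightarrow> n < \<phi> N \<longrightarrow>
     real (\<phi> N) powr (1 - s) + 1 \<le> D * real (\<phi> N - n) \<longrightarrow> ln (real (max N 1)) \<le> C3 * ln (real k) \<longrightarrow>
     ennreal (c * (exp (- R * real (\<phi> N) powr s) * kappa p q k)) \<le> kolmogorov_width n A q"
    if "C3 > 0" "D > 0" for C3 D
    unfolding \<phi>_def s_def R_def A_def by (rule width_lower_bound[OF d g r pq that])
  have \<psi>: "\<psi> k = real (\<phi> k) - real (\<phi> k) powr (1 - s) - 1" for k
    by (simp add: \<psi>_def psi_def \<phi>_def s_def Let_def)
  have \<phi>1: "real (\<phi> k) \<ge> 1" for k using phi_pos[where 'n = 'n and N = k] by (simp add: \<phi>_def Suc_leI)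
  obtain c1 where c1: "c1 > 0" "\<And>k n N. k \<ge> 2 \<Longrightarrow> n < \<phi> N \<Longrightarrow>
     real (\<phi> N) powr (1 - s) + 1 \<le> 2 * real (\<phi> N - n) \<Longrightarrow> ln (real (max N 1)) \<le> 1 * ln (real k) \<Longrightarrow>
     ennreal (c1 * (exp (- R * real (\<phi> N) powr s) * kappa p q k)) \<le> kolmogorov_width n A q"
    using main[of 1 2] by auto
  have lnk: "ln (real (max k 1)) \<le> 1 * ln (real k)" if "k \<ge> 2" for k :: nat using that by (simp add: max_def)
  have claim1: "ennreal (c1 * (exp (- R * real (\<phi> k) powr s) * kappa p q k)) \<le> kolmogorov_width (nat \<lfloor>\<psi> k\<rfloor>) A q"
    if k: "k \<ge> 2" and fl: "\<lfloor>\<psi> k\<rfloor> \<ge> 0" for k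
  proof -
    have "real (nat \<lfloor>\<psi> k\<rfloor>) \<le> \<psi> k" using fl by simp
    then have gap: "real (\<phi> k) powr (1 - s) + 1 \<le> real (\<phi> k) - real (nat \<lfloor>\<psi> k\<rfloor>)" by (simp add: \<psi>)
    moreover have "real (\<phi> k) powr (1 - s) \<ge> 0" by simp
    ultimately have lt: "nat \<lfloor>\<psi> k\<rfloor> < \<phi> k" by linarith
    show ?thesis
      by (rule c1(2)[OF k lt _ lnk[OF k]]) (use gap lt in \<open>simp add: of_nat_diff\<close>)
  qed
  have part1: "\<exists>C>0. \<forall>k\<ge>2. \<lfloor>\<psi> k\<rfloor> \<ge> 0 \<longrightarrow>
        kolmogorov_width (nat \<lfloor>\<psi> k\<rfloor>) A q \<ge> ennreal (C * (exp (- R * real (\<phi> k) powr s) * kappa p q k))"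
    using c1(1) claim1 by blast
  have part2: "\<exists>C>0. \<forall>k\<ge>2. \<lfloor>\<psi> k\<rfloor> \<ge> 0 \<and> \<psi> k \<ge> 0 \<longrightarrow>
        kolmogorov_width (nat \<lfloor>\<psi> k\<rfloor>) A q \<ge> ennreal (C * (exp (- R * \<psi> k powr s) * kappa p q k))"
    if r2: "r \<le> 2 * real CARD('n) - 1"
  proof (intro exI[of _ "c1 * exp (- 2 * R)"] conjI allI impI)
    show "c1 * exp (- 2 * R) > 0" using c1(1) by simp
    fix k :: nat assume k: "k \<ge> 2" and "\<lfloor>\<psi> k\<rfloor> \<ge> 0 \<and> \<psi> k \<ge> 0"
    then have fl: "\<lfloor>\<psi> k\<rfloor> \<ge> 0" and ps: "\<psi> k \<ge> 0" by auto
    have s1: "s \<le> 1" using r2 d by (simp add: s_def divide_le_eq)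
    define f where "f = real (\<phi> k)"
    have f: "f \<ge> 1" using \<phi>1 by (simp add: f_def)
    \<comment> \<open>With \<open>u = \<psi> / f\<close>, the bound \<open>u \<le> u\<^sup>s\<close> reduces the claim to \<open>f\<^sup>s (1 - u) \<le> 2\<close>, which holds
      because \<open>f - \<psi> = f\<^bsup>1-s\<^esup> + 1\<close>.\<close>
    have "f powr s \<le> \<psi> k powr s + 2"
    proof -
      define u where "u = \<psi> k / f"
      have "\<psi> k \<le> f" using powr_ge_zero[of "real (\<phi> k)" "1 - s"] unfolding \<psi> f_def by linarith
      then have u: "0 \<le> u" "u \<le> 1" using ps f by (auto simp: u_def)
      have "u powr 1 \<le> u powr s" using u s1 s by (intro powr_mono') auto
      then have "f powr s * u \<le> f powr s * u powr s" using u by (intro mult_left_mono) auto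
      also have "\<dots> = \<psi> k powr s" using f u ps by (simp add: u_def powr_mult[symmetric])
      finally have 1: "f powr s * u \<le> \<psi> k powr s" .
      have "f powr s * (1 - u) = f powr s * (f powr (1 - s) + 1) / f"
        using f by (simp add: u_def \<psi> f_def[symmetric] field_simps)
      also have "\<dots> = 1 + f powr s / f" using f by (simp add: distrib_left powr_add[symmetric] add_divide_distrib)
      also have "f powr s / f \<le> 1" using powr_mono[of s 1 f] f s1 by simp
      finally have "f powr s * (1 - u) \<le> 2" by simp
      then show ?thesis using 1 by (simp add: algebra_simps)
    qed
    then have "R * f powr s \<le> R * (\<psi> k powr s + 2)" using R by (intro mult_left_mono) auto
    then have "exp (- 2 * R) * exp (- R * \<psi> k powr s) \<le> exp (- R * f powr s)"
      by (simp add: exp_add[symmetric] algebra_simps)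
    then have "c1 * (exp (- 2 * R) * exp (- R * \<psi> k powr s) * kappa p q k) \<le> c1 * (exp (- R * f powr s) * kappa p q k)"
      using c1(1) kappa_nonneg by (intro mult_left_mono mult_right_mono) auto
    then have "ennreal (c1 * exp (- 2 * R) * (exp (- R * \<psi> k powr s) * kappa p q k)) \<le> ennreal (c1 * (exp (- R * f powr s) * kappa p q k))"
      by (intro ennreal_leI) (simp add: mult_ac)
    also have "\<dots> \<le> kolmogorov_width (nat \<lfloor>\<psi> k\<rfloor>) A q"
      unfolding f_def by (rule claim1[OF k fl])
    finally show "ennreal (c1 * exp (- 2 * R) * (exp (- R * \<psi> k powr s) * kappa p q k)) \<le> kolmogorov_width (nat \<lfloor>\<psi> k\<rfloor>) A q" .
  qed
  have part3: "\<exists>C>0. \<forall>k\<ge>2. kolmogorov_width (\<phi> k - 1) A q \<ge> ennreal (C * (exp (- R * real (\<phi> k) powr s) * kappa p q k))"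
    if r3: "r > 2 * real CARD('n) - 1"
  proof (intro exI[of _ c1] conjI allI impI c1(1))
    fix k :: nat assume k: "k \<ge> 2"
    have s1: "1 - s \<le> 0" using r3 d by (simp add: s_def field_simps)
    have "real (\<phi> k) powr (1 - s) \<le> real (\<phi> k) powr 0" using s1 \<phi>1[of k] by (intro powr_mono) auto
    then have "real (\<phi> k) powr (1 - s) + 1 \<le> 2" using \<phi>1[of k] by simp
    moreover have "\<phi> k - 1 < \<phi> k" "\<phi> k - (\<phi> k - 1) = 1" using \<phi>1[of k] by auto
    ultimately show "ennreal (c1 * (exp (- R * real (\<phi> k) powr s) * kappa p q k)) \<le> kolmogorov_width (\<phi> k - 1) A q"
      using c1(2)[OF k _ _ lnk[OF k], of "\<phi> k - 1"] by simp
  qed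
  have part4: "\<exists>C>0. \<forall>k\<ge>2. kolmogorov_width k A q \<ge> ennreal (C * (exp (- R * real k powr s) * kappa p q k))"
    if r4: "r \<le> 1"
  proof -
    obtain C3 D M where CDM: "C3 > 0" "D > 0" "M > 0" "\<forall>k\<ge>2. \<exists>N. k < \<phi> N \<and>
       real (\<phi> N) powr (1 - s) + 1 \<le> D * real (\<phi> N - k) \<and> ln (real (max N 1)) \<le> C3 * ln (real k) \<and>
       real (\<phi> N) powr s \<le> real k powr s + M"
      using level_for_index[OF d r r4] unfolding \<phi>_def s_def by blast
    obtain c where c: "c > 0" "\<And>k n N. k \<ge> 2 \<Longrightarrow> n < \<phi> N \<Longrightarrow>
       real (\<phi> N) powr (1 - s) + 1 \<le> D * real (\<phi> N - n) \<Longrightarrow> ln (real (max N 1)) \<le> C3 * ln (real k) \<Longrightarrow>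
       ennreal (c * (exp (- R * real (\<phi> N) powr s) * kappa p q k)) \<le> kolmogorov_width n A q"
      using main[OF CDM(1,2)] by auto
    show ?thesis
    proof (intro exI[of _ "c * exp (- R * M)"] conjI allI impI)
      show "c * exp (- R * M) > 0" using c(1) by simp
      fix k :: nat assume k: "k \<ge> 2"
      then obtain N where N: "k < \<phi> N" "real (\<phi> N) powr (1 - s) + 1 \<le> D * real (\<phi> N - k)"
        "ln (real (max N 1)) \<le> C3 * ln (real k)" "real (\<phi> N) powr s \<le> real k powr s + M" using CDM(4) by blast
      have "R * real (\<phi> N) powr s \<le> R * (real k powr s + M)" using N(4) R by (intro mult_left_mono) auto
      then have "exp (- R * M) * exp (- R * real k powr s) \<le> exp (- R * real (\<phi> N) powr s)"
        by (simp add: exp_add[symmetric] algebra_simps)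
      then have "c * (exp (- R * M) * exp (- R * real k powr s) * kappa p q k) \<le> c * (exp (- R * real (\<phi> N) powr s) * kappa p q k)"
        using c(1) kappa_nonneg by (intro mult_left_mono mult_right_mono) auto
      then have "ennreal (c * exp (- R * M) * (exp (- R * real k powr s) * kappa p q k)) \<le> ennreal (c * (exp (- R * real (\<phi> N) powr s) * kappa p q k))"
        by (intro ennreal_leI) (simp add: mult_ac)
      also have "\<dots> \<le> kolmogorov_width k A q" by (rule c(2)[OF k N(1-3)])
      finally show "ennreal (c * exp (- R * M) * (exp (- R * real k powr s) * kappa p q k)) \<le> kolmogorov_width k A q" .
    qed
  qed
  show ?thesis using part1 part2 part3 part4 by blast
qed

end
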